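(* Let $\beta>0$ and let $h$ and the initial density $\rho$ satisfy Assumptions (A1)–(A3) (given in the context). Consider the infinite-horizon optimal control problem $$\text{minimize over }u:\quad J(u)=\int_0^\infty\mathsf L(\rho_t,u_t)\,dt\quad\text{subject to}\quad\frac{\partial\rho_t}{\partial t}+\nabla\cdot(\rho_tu_t)=0,\ \ \rho_0=\rho,\quad\lim_{t\to\infty}\int_{\mathbb R^d}h(x)\rho_t(x)\,dx=h(\bar x),$$ with value function $V(\rho)=\inf_uJ(u)$. Then $$V(\rho)=\beta\int_{\mathbb R^d}h(x)\rho(x)\,dx-\beta h(\bar x),$$ and the associated optimal control law (at each time, with $\rho$ the density at that time) is a solution $u$ of the pde $$\frac1{\rho(x)}\nabla\cdot(\rho(x)u(x))=\beta\,(h(x)-\hat h),\quad\forall x\in\mathbb R^d,\qquad\hat h:=\int_{\mathbb R^d}h(x)\rho(x)\,dx .$$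
   Context: $\mathcal P$ is the set of probability densities $\rho$ on $\mathbb R^d$ with $\int|x|^2\rho\,dx<\infty$. Controls are time-dependent vector fields $u_t:\mathbb R^d\to\mathbb R^d$ with $u_t\in L^2(\mathbb R^d;\rho_t)$, for which the continuity equation has a solution $\rho_t\in\mathcal P$. The Lagrangian is $$\mathsf L(\rho,u)=\frac12\int_{\mathbb R^d}\Big|\frac1{\rho(x)}\nabla\cdot(\rho(x)u(x))\Big|^2\rho(x)\,dx+\frac{\beta^2}{2}\int_{\mathbb R^d}|h(x)-\hat h|^2\rho(x)\,dx,\quad\hat h=\int h\rho\,dx.$$ Assumptions. (A1) The initial density $\rho\in\mathcal P$ has the form $e^{-V_0}$ with $V_0\in C^2(\mathbb R^d)$, $D^2V_0\in L^\infty$, $\liminf_{|x|\to\infty}\nabla V_0(x)\cdot\frac{x}{|x|}=\infty$. (A2) $h:\mathbb R^d\to\mathbb R$, $h\in C^2\cap L^2(\mathbb R^d;\rho)$, $D^2h\in L^\infty$, $\liminf_{|x|\to\infty}\nabla h(x)\cdot\frac{x}{|x|}>-\infty$. (A3) $h$ has a unique minimizer $\bar x$ with value $\bar h=h(\bar x)$, and there are a compact $D\subset\mathbb R^d$ and $r>0$ with $h(x)>\bar h+r$ for $x\notin D$. *)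

theory Defs
  imports "HOL-Analysis.Analysis"
begin

definition partial_deriv :: "'a \<Rightarrow> ('a::euclidean_space \<Rightarrow> real) \<Rightarrow> 'a \<Rightarrow> real" where
  "partial_deriv b f x = frechet_derivative f (at x) b"

definition gradient :: "('a::euclidean_space \<Rightarrow> real) \<Rightarrow> 'a \<Rightarrow> 'a" where
  "gradient f x = (\<Sum>b\<in>Basis. partial_deriv b f x *\<^sub>R b)"

definition divergence :: "('a::euclidean_space \<Rightarrow> 'a) \<Rightarrow> 'a \<Rightarrow> real" where
  "divergence F x = (\<Sum>b\<in>Basis. partial_deriv b (\<lambda>y. F y \<bullet> b) x)"

primrec Ck :: "nat \<Rightarrow> ('a::euclidean_space \<Rightarrow> real) \<Rightarrow> bool" where
  "Ck 0 f \<longleftrightarrow> continuous_on UNIV f"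
| "Ck (Suc k) f \<longleftrightarrow> (\<forall>x. f differentiable (at x)) \<and> (\<forall>b\<in>Basis. Ck k (partial_deriv b f))"

text \<open>For a twice continuously differentiable function the essential bound on the second
  derivative is a pointwise bound on the second partial derivatives.\<close>

definition bounded_hessian :: "('a::euclidean_space \<Rightarrow> real) \<Rightarrow> bool" where
  "bounded_hessian f \<longleftrightarrow>
     (\<forall>b\<in>Basis. \<forall>c\<in>Basis. bounded (range (partial_deriv c (partial_deriv b f))))"

definition liminf_radial :: "('a::euclidean_space \<Rightarrow> real) \<Rightarrow> ereal" where
  "liminf_radial f = Liminf at_infinity (\<lambda>x. ereal (gradient f x \<bullet> (x /\<^sub>R norm x)))"

definition prob_densities :: "('a::euclidean_space \<Rightarrow> real) set" where
  "prob_densities = {\<rho>. \<rho> \<in> borel_measurable borel \<and> (\<forall>x. 0 \<le> \<rho> x) \<and>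
     integrable lborel \<rho> \<and> (LINT x|lborel. \<rho> x) = 1 \<and>
     integrable lborel (\<lambda>x. (norm x)\<^sup>2 * \<rho> x)}"

definition mean :: "('a::euclidean_space \<Rightarrow> real) \<Rightarrow> ('a \<Rightarrow> real) \<Rightarrow> real" where
  "mean \<rho> h = (LINT x|lborel. h x * \<rho> x)"

definition A1 :: "('a::euclidean_space \<Rightarrow> real) \<Rightarrow> bool" where
  "A1 \<rho> \<longleftrightarrow> \<rho> \<in> prob_densities \<and>
     (\<exists>V\<^sub>0. \<rho> = (\<lambda>x. exp (- V\<^sub>0 x)) \<and> Ck 2 V\<^sub>0 \<and> bounded_hessian V\<^sub>0 \<and> liminf_radial V\<^sub>0 = \<infinity>)"

definition A2 :: "('a::euclidean_space \<Rightarrow> real) \<Rightarrow> ('a \<Rightarrow> real) \<Rightarrow> bool" where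
  "A2 \<rho> h \<longleftrightarrow> Ck 2 h \<and> integrable lborel (\<lambda>x. (h x)\<^sup>2 * \<rho> x) \<and>
     bounded_hessian h \<and> liminf_radial h > -\<infinity>"

definition A3 :: "('a::euclidean_space \<Rightarrow> real) \<Rightarrow> 'a \<Rightarrow> bool" where
  "A3 h xbar \<longleftrightarrow> (\<forall>x. h xbar \<le> h x) \<and> (\<forall>y. (\<forall>x. h y \<le> h x) \<longrightarrow> y = xbar) \<and>
     (\<exists>D r. compact D \<and> r > 0 \<and> (\<forall>x. x \<notin> D \<longrightarrow> h x > h xbar + r))"

text \<open>Continuously differentiable test functions define the same weak derivatives as smooth ones
  here, since the fields tested below are always locally integrable.\<close>

definition test_fun :: "('a::euclidean_space \<Rightarrow> real) \<Rightarrow> bool" where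
  "test_fun f \<longleftrightarrow> Ck 1 f \<and> compact (closure {x. f x \<noteq> 0})"

definition locally_integrable :: "('a::euclidean_space \<Rightarrow> 'b::euclidean_space) \<Rightarrow> bool" where
  "locally_integrable F \<longleftrightarrow>
     F \<in> borel_measurable borel \<and> (\<forall>K. compact K \<longrightarrow> set_integrable lborel K F)"

definition has_weak_divergence :: "('a::euclidean_space \<Rightarrow> 'a) \<Rightarrow> ('a \<Rightarrow> real) \<Rightarrow> bool" where
  "has_weak_divergence F g \<longleftrightarrow> locally_integrable F \<and> locally_integrable g \<and>
     (\<forall>f. test_fun f \<longrightarrow>
        (LINT x|lborel. gradient f x \<bullet> F x) = - (LINT x|lborel. f x * g x))"

text \<open>\<open>weighted_divergence \<rho> u a\<close> says that \<open>a\<close> is the quotient of the distributional divergence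
  of \<open>\<rho> u\<close> by \<open>\<rho>\<close>. Writing this as \<open>\<nabla>\<cdot>(\<rho> u) = \<rho> a\<close> determines \<open>a\<close> up to \<open>\<rho>\<close>-null sets and forces the
  divergence to vanish where \<open>\<rho>\<close> does; with HOL's \<open>c / 0 = 0\<close> a literal quotient would make
  divergence in the region \<open>\<rho> = 0\<close> free of cost.\<close>

definition weighted_divergence ::
    "('a::euclidean_space \<Rightarrow> real) \<Rightarrow> ('a \<Rightarrow> 'a) \<Rightarrow> ('a \<Rightarrow> real) \<Rightarrow> bool" where
  "weighted_divergence \<rho> u a \<longleftrightarrow> a \<in> borel_measurable borel \<and>
     has_weak_divergence (\<lambda>x. \<rho> x *\<^sub>R u x) (\<lambda>x. \<rho> x * a x)"

text \<open>The choice of \<open>a\<close> is immaterial, being unique \<open>\<rho>\<close>-almost everywhere. The kinetic cost is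
  infinite if the weighted divergence is not a function.\<close>

definition kinetic :: "('a::euclidean_space \<Rightarrow> real) \<Rightarrow> ('a \<Rightarrow> 'a) \<Rightarrow> ennreal" where
  "kinetic \<rho> u = (if \<exists>a. weighted_divergence \<rho> u a
     then (\<integral>\<^sup>+x. ennreal (1/2 * \<bar>(SOME a. weighted_divergence \<rho> u a) x\<bar>\<^sup>2 * \<rho> x) \<partial>lborel)
     else \<infinity>)"

definition Lagrangian ::
    "real \<Rightarrow> ('a::euclidean_space \<Rightarrow> real) \<Rightarrow> ('a \<Rightarrow> real) \<Rightarrow> ('a \<Rightarrow> 'a) \<Rightarrow> ennreal" where
  "Lagrangian \<beta> h \<rho> u = kinetic \<rho> u +
     (\<integral>\<^sup>+x. ennreal (\<beta>\<^sup>2/2 * \<bar>h x - mean \<rho> h\<bar>\<^sup>2 * \<rho> x) \<partial>lborel)"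

text \<open>A curve of densities \<open>\<rho>\<close> and a control \<open>u\<close> (only times \<open>t \<ge> 0\<close> matter) solving the continuity
  equation with initial density \<open>\<rho>\<^sub>0\<close> in the weak sense, tested at every time \<open>t\<close>.\<close>

definition controlled_flow :: "('a::euclidean_space \<Rightarrow> real) \<Rightarrow>
    (real \<Rightarrow> 'a \<Rightarrow> real) \<Rightarrow> (real \<Rightarrow> 'a \<Rightarrow> 'a) \<Rightarrow> bool" where
  "controlled_flow \<rho>\<^sub>0 \<rho> u \<longleftrightarrow>
     set_borel_measurable borel ({0..} \<times> UNIV) (\<lambda>(t, x). \<rho> t x) \<and>
     set_borel_measurable borel ({0..} \<times> UNIV) (\<lambda>(t, x). u t x) \<and>
     (\<forall>t\<ge>0. \<rho> t \<in> prob_densities \<and> integrable lborel (\<lambda>x. (norm (u t x))\<^sup>2 * \<rho> t x)) \<and>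
     \<rho> 0 = \<rho>\<^sub>0 \<and>
     (\<forall>f. test_fun f \<longrightarrow> (\<forall>t\<ge>0.
        set_integrable lborel ({0..t} \<times> UNIV) (\<lambda>(s, x). gradient f x \<bullet> (\<rho> s x *\<^sub>R u s x)) \<and>
        (LINT x|lborel. f x * \<rho> t x) - (LINT x|lborel. f x * \<rho>\<^sub>0 x) =
          (LINT (s, x):{0..t} \<times> UNIV|lborel. gradient f x \<bullet> (\<rho> s x *\<^sub>R u s x))))"

definition admissible :: "('a::euclidean_space \<Rightarrow> real) \<Rightarrow> 'a \<Rightarrow> ('a \<Rightarrow> real) \<Rightarrow>
    (real \<Rightarrow> 'a \<Rightarrow> real) \<Rightarrow> (real \<Rightarrow> 'a \<Rightarrow> 'a) \<Rightarrow> bool" where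
  "admissible h xbar \<rho>\<^sub>0 \<rho> u \<longleftrightarrow> controlled_flow \<rho>\<^sub>0 \<rho> u \<and>
     ((\<lambda>t. mean (\<rho> t) h) \<longlongrightarrow> h xbar) at_top"

definition cost :: "real \<Rightarrow> ('a::euclidean_space \<Rightarrow> real) \<Rightarrow>
    (real \<Rightarrow> 'a \<Rightarrow> real) \<Rightarrow> (real \<Rightarrow> 'a \<Rightarrow> 'a) \<Rightarrow> ennreal" where
  "cost \<beta> h \<rho> u = (\<integral>\<^sup>+t\<in>{0..}. Lagrangian \<beta> h (\<rho> t) (u t) \<partial>lborel)"

definition value_fun ::
    "real \<Rightarrow> ('a::euclidean_space \<Rightarrow> real) \<Rightarrow> 'a \<Rightarrow> ('a \<Rightarrow> real) \<Rightarrow> ennreal" where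
  "value_fun \<beta> h xbar \<rho>\<^sub>0 = Inf {cost \<beta> h \<rho> u | \<rho> u. admissible h xbar \<rho>\<^sub>0 \<rho> u}"

definition optimal_control :: "real \<Rightarrow> ('a::euclidean_space \<Rightarrow> real) \<Rightarrow> 'a \<Rightarrow> ('a \<Rightarrow> real) \<Rightarrow>
    (real \<Rightarrow> 'a \<Rightarrow> real) \<Rightarrow> (real \<Rightarrow> 'a \<Rightarrow> 'a) \<Rightarrow> bool" where
  "optimal_control \<beta> h xbar \<rho>\<^sub>0 \<rho> u \<longleftrightarrow> admissible h xbar \<rho>\<^sub>0 \<rho> u \<and>
     cost \<beta> h \<rho> u = value_fun \<beta> h xbar \<rho>\<^sub>0"

definition solves_pde ::
    "real \<Rightarrow> ('a::euclidean_space \<Rightarrow> real) \<Rightarrow> ('a \<Rightarrow> real) \<Rightarrow> ('a \<Rightarrow> 'a) \<Rightarrow> bool" where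
  "solves_pde \<beta> h \<rho> u \<longleftrightarrow> weighted_divergence \<rho> u (\<lambda>x. \<beta> * (h x - mean \<rho> h))"

definition solves_pde_classically ::
    "real \<Rightarrow> ('a::euclidean_space \<Rightarrow> real) \<Rightarrow> ('a \<Rightarrow> real) \<Rightarrow> ('a \<Rightarrow> 'a) \<Rightarrow> bool" where
  "solves_pde_classically \<beta> h \<rho> u \<longleftrightarrow> (\<forall>b\<in>Basis. Ck 1 (\<lambda>x. (\<rho> x *\<^sub>R u x) \<bullet> b)) \<and>
     (\<forall>x. 0 < \<rho> x \<and>
        1 / \<rho> x * divergence (\<lambda>y. \<rho> y *\<^sub>R u y) x = \<beta> * (h x - mean \<rho> h))"

end

theory Submission
  imports Defs
begin

text \<open>
  Write \<open>g = h - h xbar \<ge> 0\<close> for the excess cost and \<open>m\<^sub>t\<close> for its mean under \<open>\<rho>\<^sub>t\<close>. If \<open>a\<close> is the weighted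
  divergence of a control \<open>u\<close>, then \<open>m\<close> changes at the rate \<open>- \<integral> g a \<rho>\<close>. Since \<open>\<integral> a \<rho> = 0\<close>, completing the
  square turns the Lagrangian into
  \<open>L = 1/2 \<integral> (a - \<beta> (g - m))\<^sup>2 \<rho> + \<beta> \<integral> g a \<rho> = 1/2 \<integral> (a - \<beta> (g - m))\<^sup>2 \<rho> - \<beta> m'\<close>.
  Integrating over time, with \<open>m\<close> tending to \<open>0\<close>, gives cost at least \<open>\<beta> m\<^sub>0\<close>, with equality exactly if
  \<open>a = \<beta> (g - m)\<close> at almost every time, which is the asserted equation. Three things separate this from a
  proof.

  First, a flow is only tested against functions of compact support, and nothing is known uniformly in time
  about the moments of \<open>\<rho>\<^sub>t\<close> or \<open>u\<^sub>t\<close>. Therefore \<open>g\<close> is replaced by a bounded 1-Lipschitz function of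
  itself, which does not increase its variance, and this is cut off by wide bumps
  (\<open>Lagrangian_lower_bound\<close>, \<open>flow_lower_bound\<close>). In the case of equality all residuals against a fixed test
  function vanish at almost every time; countably many test functions are dense for the \<open>C\<^sup>1\<close> norm, so one
  null set of times serves for all (\<open>optimal_imp_solution\<close>).

  Second, a flow that satisfies the equation must be shown to be admissible, that is, \<open>m\<close> must tend to
  \<open>0\<close>. The mean of \<open>g\<close> decreases and the mean of any decreasing function of \<open>g\<close> increases, both at \<open>\<beta>\<close>
  times a covariance. If \<open>m\<close> stayed above some \<open>c > 0\<close>, a decreasing function of \<open>g\<close> supported
  where \<open>g \<le> c/2\<close> would have a mean growing at least linearly, although it is bounded
  (\<open>mean_excess_tendsto_0\<close>).

  Third, an optimal flow has to exist. The densities are the exponential tilts of the initial density by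
  \<open>- \<beta> t g\<close>. A flux whose divergence is the prescribed source is written down explicitly, as an average of
  radial fields over their poles, arranged so that no singularity remains (\<open>transport_flux_divergence\<close>).
  Because the potentials of these densities grow superlinearly, the densities decay along all rays that
  leave the unit ball, and this keeps the flux small enough for the control to have finite energy
  (\<open>transport_flux_decay\<close>).
\<close>


section \<open>Continuously differentiable functions and test functions\<close>

text \<open>The gradient is an argument, so that the rules below compute it.\<close>

definition C1_grad :: "('a::euclidean_space \<Rightarrow> real) \<Rightarrow> ('a \<Rightarrow> 'a) \<Rightarrow> bool" where
  "C1_grad f G \<longleftrightarrow> (\<forall>x. (f has_derivative (\<lambda>v. G x \<bullet> v)) (at x)) \<and> continuous_on UNIV G"

lemma C1_gradI:
  assumes "\<And>x. (f has_derivative (\<lambda>v. G x \<bullet> v)) (at x)" and "continuous_on UNIV G"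
  shows "C1_grad f G"
  using assms by (auto simp: C1_grad_def)

lemma C1_grad_derivative: "C1_grad f G \<Longrightarrow> (f has_derivative (\<lambda>v. G x \<bullet> v)) (at x)"
  by (auto simp: C1_grad_def)

lemma C1_grad_continuous: "C1_grad f G \<Longrightarrow> continuous_on A f"
  by (meson C1_grad_derivative continuous_at_imp_continuous_on has_derivative_continuous)

lemma C1_grad_continuous_grad: "C1_grad f G \<Longrightarrow> continuous_on A G"
  by (meson C1_grad_def continuous_on_subset subset_UNIV)

lemma C1_grad_partial_deriv:
  assumes "C1_grad f G" shows "partial_deriv b f x = G x \<bullet> b"
  using frechet_derivative_at[OF C1_grad_derivative[OF assms, of x]]
  by (simp add: partial_deriv_def)

lemma C1_grad_gradient:
  assumes "C1_grad f G" shows "gradient f = G"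
proof
  fix x show "gradient f x = G x"
    by (simp add: gradient_def C1_grad_partial_deriv[OF assms] euclidean_representation)
qed

lemma frechet_derivative_eq_gradient:
  assumes "f differentiable (at x)"
  shows "(f has_derivative (\<lambda>v. gradient f x \<bullet> v)) (at x)"
proof -
  let ?D = "frechet_derivative f (at x)"
  have D: "(f has_derivative ?D) (at x)"
    using assms frechet_derivative_works by blast
  have lin: "linear ?D" using D has_derivative_linear by blast
  have "?D v = gradient f x \<bullet> v" for v
  proof -
    have "?D v = ?D (\<Sum>b\<in>Basis. (v \<bullet> b) *\<^sub>R b)" by (simp add: euclidean_representation)
    also have "\<dots> = (\<Sum>b\<in>Basis. (v \<bullet> b) * ?D b)"
      by (simp add: linear_sum[OF lin] linear_scale[OF lin])
    also have "\<dots> = gradient f x \<bullet> v"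
      by (simp add: gradient_def inner_sum_right partial_deriv_def inner_commute mult.commute)
    finally show ?thesis .
  qed
  then have "?D = (\<lambda>v. gradient f x \<bullet> v)" by auto
  with D show ?thesis by simp
qed

lemma Ck_1_iff_C1_grad: "Ck 1 f \<longleftrightarrow> C1_grad f (gradient f)"
proof
  assume c: "Ck 1 f"
  then have d: "f differentiable (at x)" for x by simp
  have "continuous_on UNIV (gradient f)"
    unfolding gradient_def using c by (intro continuous_intros) auto
  with d show "C1_grad f (gradient f)" by (intro C1_gradI frechet_derivative_eq_gradient)
next
  assume c: "C1_grad f (gradient f)"
  have "f differentiable (at x)" for x
    using C1_grad_derivative[OF c] differentiable_def by blast
  moreover have "partial_deriv b f = (\<lambda>x. gradient f x \<bullet> b)" for b
    using C1_grad_partial_deriv[OF c] by auto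
  ultimately show "Ck 1 f"
    using C1_grad_continuous_grad[OF c] by (auto intro!: continuous_intros)
qed

lemma C1_grad_imp_Ck: "C1_grad f G \<Longrightarrow> Ck 1 f"
  using C1_grad_gradient Ck_1_iff_C1_grad by blast

lemma C1_grad_const: "C1_grad (\<lambda>x. c) (\<lambda>x. 0)"
  by (auto simp: C1_grad_def)

lemma C1_grad_diff:
  assumes "C1_grad f F" "C1_grad g G"
  shows "C1_grad (\<lambda>x. f x - g x) (\<lambda>x. F x - G x)"
  by (intro C1_gradI continuous_intros C1_grad_continuous_grad[OF assms(1)]
      C1_grad_continuous_grad[OF assms(2)])
    (auto intro!: derivative_eq_intros C1_grad_derivative[OF assms(1)]
      C1_grad_derivative[OF assms(2)] simp: inner_diff_left)

lemma C1_grad_add: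
  assumes "C1_grad f F" "C1_grad g G"
  shows "C1_grad (\<lambda>x. f x + g x) (\<lambda>x. F x + G x)"
  by (intro C1_gradI continuous_intros C1_grad_continuous_grad[OF assms(1)]
      C1_grad_continuous_grad[OF assms(2)])
    (auto intro!: derivative_eq_intros C1_grad_derivative[OF assms(1)]
      C1_grad_derivative[OF assms(2)] simp: inner_add_left)

lemma C1_grad_mult:
  assumes "C1_grad f F" "C1_grad g G"
  shows "C1_grad (\<lambda>x. f x * g x) (\<lambda>x. f x *\<^sub>R G x + g x *\<^sub>R F x)"
  by (intro C1_gradI continuous_intros C1_grad_continuous_grad[OF assms(1)]
      C1_grad_continuous_grad[OF assms(2)] C1_grad_continuous[OF assms(1)]
      C1_grad_continuous[OF assms(2)])
    (auto intro!: derivative_eq_intros C1_grad_derivative[OF assms(1)]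
      C1_grad_derivative[OF assms(2)] simp: inner_add_left)

lemma C1_grad_cmult:
  assumes "C1_grad f F"
  shows "C1_grad (\<lambda>x. c * f x) (\<lambda>x. c *\<^sub>R F x)"
  using C1_grad_mult[OF C1_grad_const[of c] assms] by simp

lemma C1_grad_compose:
  assumes f: "C1_grad f F"
    and d: "\<And>x. (\<phi> has_real_derivative \<phi>' (f x)) (at (f x))"
    and c: "continuous_on UNIV (\<lambda>x. \<phi>' (f x))"
  shows "C1_grad (\<lambda>x. \<phi> (f x)) (\<lambda>x. \<phi>' (f x) *\<^sub>R F x)"
proof (intro C1_gradI continuous_intros c C1_grad_continuous_grad[OF f])
  fix x
  have "((\<lambda>x. \<phi> (f x)) has_derivative (\<lambda>v. \<phi>' (f x) * (F x \<bullet> v))) (at x)"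
    using has_derivative_compose[OF C1_grad_derivative[OF f]
        d[of x, unfolded has_field_derivative_def]] by simp
  then show "((\<lambda>x. \<phi> (f x)) has_derivative (\<lambda>v. (\<phi>' (f x) *\<^sub>R F x) \<bullet> v)) (at x)" by simp
qed

lemma max_zero_square_derivative:
  "((\<lambda>y::real. (max 0 y)\<^sup>2) has_real_derivative 2 * max 0 y) (at y)"
proof -
  consider "y > 0" | "y < 0" | "y = 0" by linarith
  then show ?thesis
  proof cases
    case 1
    have "((\<lambda>y::real. y\<^sup>2) has_real_derivative 2 * max 0 y) (at y)"
      using 1 by (auto intro!: derivative_eq_intros)
    then show ?thesis
      by (rule has_field_derivative_transform_within_open[where S="{0<..}"]) (use 1 in auto)
  next
    case 2
    have "((\<lambda>y::real. 0) has_real_derivative 2 * max 0 y) (at y)"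
      using 2 by (auto intro!: derivative_eq_intros)
    then show ?thesis
      by (rule has_field_derivative_transform_within_open[where S="{..<0}"]) (use 2 in auto)
  next
    case 3
    have "((\<lambda>h::real. (max 0 h)\<^sup>2 / h) \<longlongrightarrow> 0) (at 0)"
    proof (rule Lim_null_comparison)
      have "(max 0 h)\<^sup>2 / \<bar>h\<bar> \<le> \<bar>h\<bar>" for h :: real
        by (cases "h > 0") (auto simp: power2_eq_square max_def)
      then show "\<forall>\<^sub>F h::real in at 0. norm ((max 0 h)\<^sup>2 / h) \<le> \<bar>h\<bar>"
        by (auto intro!: always_eventually)
      show "((\<lambda>h::real. \<bar>h\<bar>) \<longlongrightarrow> 0) (at 0)" by (auto intro!: tendsto_eq_intros)
    qed
    then show ?thesis using 3 by (simp add: DERIV_def)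
  qed
qed

text \<open>The square makes the profile continuously differentiable at the edge of its support. The bump
  is nowhere constant near its centre, but it tends to \<open>1\<close> everywhere as \<open>r\<close> grows, with gradient at most
  \<open>4 / r\<close>, and a cutoff has to do no more than this.\<close>

definition bump :: "'a::euclidean_space \<Rightarrow> real \<Rightarrow> 'a \<Rightarrow> real" where
  "bump c r x = (max 0 (1 - (norm (x - c) / r)\<^sup>2))\<^sup>2"

definition bump_grad :: "'a::euclidean_space \<Rightarrow> real \<Rightarrow> 'a \<Rightarrow> 'a" where
  "bump_grad c r x = - (4 * max 0 (1 - (norm (x - c) / r)\<^sup>2) / r\<^sup>2) *\<^sub>R (x - c)"

lemma C1_grad_bump: "C1_grad (bump c r) (bump_grad c r)"
proof -
  have eq: "1 - (norm (x - c) / r)\<^sup>2 = 1 - ((x - c) \<bullet> (x - c)) / r\<^sup>2" for x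
    by (simp add: power_divide dot_square_norm)
  have "C1_grad (\<lambda>x. 1 - ((x - c) \<bullet> (x - c)) / r\<^sup>2) (\<lambda>x. - (2 / r\<^sup>2) *\<^sub>R (x - c))"
    by (intro C1_gradI continuous_intros)
      (auto intro!: derivative_eq_intros
        simp: divide_inverse fun_eq_iff inner_commute algebra_simps)
  moreover have "continuous_on UNIV (\<lambda>x. 2 * max 0 (1 - ((x - c) \<bullet> (x - c)) / r\<^sup>2))"
    by (auto intro!: continuous_intros simp: divide_inverse)
  ultimately have "C1_grad (\<lambda>x. (max 0 (1 - ((x - c) \<bullet> (x - c)) / r\<^sup>2))\<^sup>2)
     (\<lambda>x. (2 * max 0 (1 - ((x - c) \<bullet> (x - c)) / r\<^sup>2)) *\<^sub>R - (2 / r\<^sup>2) *\<^sub>R (x - c))"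
    by (rule C1_grad_compose[where \<phi>="\<lambda>y. (max 0 y)\<^sup>2" and \<phi>'="\<lambda>y. 2 * max 0 y", OF _ max_zero_square_derivative])
  moreover have "bump c r = (\<lambda>x. (max 0 (1 - ((x - c) \<bullet> (x - c)) / r\<^sup>2))\<^sup>2)"
    by (auto simp: bump_def eq)
  moreover have "bump_grad c r =
     (\<lambda>x. (2 * max 0 (1 - ((x - c) \<bullet> (x - c)) / r\<^sup>2)) *\<^sub>R - (2 / r\<^sup>2) *\<^sub>R (x - c))"
    by (auto simp: bump_grad_def eq)
  ultimately show ?thesis by simp
qed

lemma bump_nonneg: "0 \<le> bump c r x"
  by (simp add: bump_def)

lemma bump_le_1: "bump c r x \<le> 1"
  unfolding bump_def by (rule power_le_one) auto

lemma bump_pos_iff: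
  assumes "r > 0" shows "bump c r x > 0 \<longleftrightarrow> norm (x - c) < r"
proof -
  have "bump c r x > 0 \<longleftrightarrow> (norm (x - c) / r)\<^sup>2 < 1" by (auto simp: bump_def max_def)
  also have "\<dots> \<longleftrightarrow> norm (x - c) / r < 1"
    using assms by (simp add: power_less_one_iff)
  also have "\<dots> \<longleftrightarrow> norm (x - c) < r" using assms by simp
  finally show ?thesis .
qed

lemma bump_eq_0: "r > 0 \<Longrightarrow> norm (x - c) \<ge> r \<Longrightarrow> bump c r x = 0"
  using bump_pos_iff[of r c x] bump_nonneg[of c r x] by force

lemma norm_bump_grad:
  assumes r: "r > 0" shows "norm (bump_grad c r x) \<le> 4 / r"
proof (cases "norm (x - c) < r")
  case True
  have "norm (bump_grad c r x) = 4 * max 0 (1 - (norm (x - c) / r)\<^sup>2) / r\<^sup>2 * norm (x - c)"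
    by (simp add: bump_grad_def abs_mult)
  also have "\<dots> \<le> 4 * 1 / r\<^sup>2 * r"
    using True r by (intro mult_mono divide_right_mono) auto
  also have "\<dots> = 4 / r" using r by (simp add: power2_eq_square)
  finally show ?thesis .
next
  case False
  then have "1 \<le> (norm (x - c) / r)\<^sup>2" using r by simp
  then show ?thesis using r by (simp add: bump_grad_def)
qed

lemma bump_tendsto_1: "(\<lambda>n. bump 0 (real (Suc n)) x) \<longlonglongrightarrow> 1"
proof -
  have "(\<lambda>n. norm x / real (Suc n)) \<longlonglongrightarrow> 0"
    using tendsto_mult[OF tendsto_const[of "norm x"] LIMSEQ_inverse_real_of_nat]
    by (simp add: divide_inverse)
  from tendsto_power[OF tendsto_max[OF tendsto_const[of 0] tendsto_diff[OF tendsto_const[of 1]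
        tendsto_power[OF this, of 2]]], of 2]
  show ?thesis by (simp add: bump_def)
qed

lemma test_funI:
  assumes "C1_grad f G" "compact K" "\<And>x. x \<notin> K \<Longrightarrow> f x = 0"
  shows "test_fun f"
proof -
  have "{x. f x \<noteq> 0} \<subseteq> K" using assms(3) by auto
  then have "closure {x. f x \<noteq> 0} \<subseteq> K"
    by (rule closure_minimal) (simp add: assms(2) compact_imp_closed)
  then have "compact (closure {x. f x \<noteq> 0})"
    using assms(2) by (metis closed_closure closure_closure compact_Int_closed inf.absorb_iff2)
  then show ?thesis using C1_grad_imp_Ck[OF assms(1)] by (simp add: test_fun_def)
qed

lemma test_fun_C1_grad: "test_fun f \<Longrightarrow> C1_grad f (gradient f)"
  by (simp add: test_fun_def Ck_1_iff_C1_grad del: One_nat_def)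

lemma test_funE:
  assumes "test_fun f"
  obtains K c where "compact K" "0 < c" "\<And>x. \<bar>f x\<bar> \<le> c" "\<And>x. norm (gradient f x) \<le> c"
    "\<And>x. x \<notin> K \<Longrightarrow> f x = 0" "\<And>x. x \<notin> K \<Longrightarrow> gradient f x = 0"
proof -
  define K where "K = closure {x. f x \<noteq> 0}"
  have K: "compact K" using assms by (simp add: test_fun_def K_def)
  have C: "C1_grad f (gradient f)" using assms by (rule test_fun_C1_grad)
  have z: "f x = 0" if "x \<notin> K" for x
    using that closure_subset[of "{x. f x \<noteq> 0}"] by (auto simp: K_def)
  have zg: "gradient f x = 0" if "x \<notin> K" for x
  proof -
    have "((\<lambda>x. 0) has_derivative (\<lambda>v. 0)) (at x)" by simp
    then have "(f has_derivative (\<lambda>v. 0)) (at x)"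
      by (rule has_derivative_transform_within_open[where s="- K"])
        (use that z K in \<open>auto simp: compact_imp_closed open_Compl\<close>)
    with C1_grad_derivative[OF C, of x] have "(\<lambda>v. gradient f x \<bullet> v) = (\<lambda>v. 0)"
      using has_derivative_unique by blast
    then show ?thesis by (metis inner_eq_zero_iff)
  qed
  have "bounded (f ` K)" "bounded (gradient f ` K)"
    by (auto intro!: compact_imp_bounded compact_continuous_image K
        C1_grad_continuous[OF C] C1_grad_continuous_grad[OF C])
  then obtain c1 c2 where c: "\<And>x. x \<in> K \<Longrightarrow> norm (f x) \<le> c1" "\<And>x. x \<in> K \<Longrightarrow> norm (gradient f x) \<le> c2"
    by (auto simp: bounded_iff)
  define c where "c = max 1 (max c1 c2)"
  show thesis
  proof
    show "compact K" "0 < c" using K by (auto simp: c_def)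
    show "\<bar>f x\<bar> \<le> c" for x using z[of x] c(1)[of x] by (cases "x \<in> K") (auto simp: c_def)
    show "norm (gradient f x) \<le> c" for x
      using zg[of x] c(2)[of x] by (cases "x \<in> K") (auto simp: c_def)
  qed (use z zg in auto)
qed

lemma test_fun_measurable:
  assumes "test_fun f"
  shows "f \<in> borel_measurable borel" "gradient f \<in> borel_measurable borel"
  using test_fun_C1_grad[OF assms]
  by (auto intro!: borel_measurable_continuous_onI C1_grad_continuous C1_grad_continuous_grad)

lemma test_fun_bump: "r > 0 \<Longrightarrow> test_fun (bump c r)"
  by (rule test_funI[OF C1_grad_bump, of "cball c r"])
    (auto intro!: bump_eq_0 simp: dist_norm norm_minus_commute)

lemma test_fun_mult:
  assumes "test_fun f" "C1_grad g G" shows "test_fun (\<lambda>x. f x * g x)"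
  using assms(1)
proof (rule test_funE)
  fix K assume "compact K" "\<And>x. x \<notin> K \<Longrightarrow> f x = 0"
  then show ?thesis
    by (intro test_funI[OF C1_grad_mult[OF test_fun_C1_grad[OF assms(1)] assms(2)], of K]) auto
qed

section \<open>Uniqueness of weak divergences\<close>

text \<open>Saturation of a nonnegative test function: test functions see the sets where other test
  functions are positive.\<close>

lemma test_fun_approximates_indicator:
  assumes f: "test_fun f" "\<And>x. 0 \<le> f x"
  shows "test_fun (\<lambda>x. f x * (real n / (1 + real n * f x)))"
    and "(\<lambda>n. f x * (real n / (1 + real n * f x))) \<longlonglongrightarrow> indicator {x. 0 < f x} x"
    and "\<bar>f x * (real n / (1 + real n * f x))\<bar> \<le> indicator {x. 0 < f x} x"
proof -
  have pos: "1 + real n * f x > 0" for n x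
    using f(2)[of x] by (simp add: add_pos_nonneg)
  have "C1_grad (\<lambda>x. real n / (1 + real n * f x))
    (\<lambda>x. (- (real n)\<^sup>2 / (1 + real n * f x)\<^sup>2) *\<^sub>R gradient f x)"
    using pos[of n]
    by (intro C1_grad_compose[OF test_fun_C1_grad[OF f(1)], where \<phi>="\<lambda>y. real n / (1 + real n * y)"
          and \<phi>'="\<lambda>y. - (real n)\<^sup>2 / (1 + real n * y)\<^sup>2"])
      (auto intro!: derivative_eq_intros continuous_intros C1_grad_continuous[OF test_fun_C1_grad[OF f(1)]]
        simp: power2_eq_square less_imp_neq[symmetric])
  from test_fun_mult[OF f(1) this]
  show "test_fun (\<lambda>x. f x * (real n / (1 + real n * f x)))" .
  show "(\<lambda>n. f x * (real n / (1 + real n * f x))) \<longlonglongrightarrow> indicator {x. 0 < f x} x"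
  proof (cases "f x > 0")
    case True
    have eq: "1 - 1 / (1 + real n * f x) = f x * (real n / (1 + real n * f x))" for n
      using pos[of n x] by (simp add: field_simps)
    have "filterlim (\<lambda>n. 1 + real n * f x) at_top sequentially"
      by (intro filterlim_tendsto_add_at_top[OF tendsto_const]
          filterlim_at_top_mult_tendsto_pos[OF tendsto_const True] filterlim_real_sequentially)
    from tendsto_diff[OF tendsto_const[of 1] real_tendsto_divide_at_top[OF tendsto_const[of 1] this]]
    show ?thesis using True by (simp add: eq)
  next
    case False
    then have "f x = 0" using f(2)[of x] by simp
    then show ?thesis by simp
  qed
  have "f x * real n \<le> 1 + real n * f x" by (simp add: mult.commute)
  then show "\<bar>f x * (real n / (1 + real n * f x))\<bar> \<le> indicator {x. 0 < f x} x"
    using pos[of n x] f(2)[of x] by (cases "f x > 0") (auto simp: abs_mult field_simps)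
qed

text \<open>Sets of the form \<open>{x. 0 < f x}\<close> contain all balls and, unlike these, are stable under
  intersection, by taking products of test functions. That makes them fit for comparing measures.\<close>

lemma sets_borel_generated_by_test_funs:
  "sets (borel :: 'a::euclidean_space measure) =
     sigma_sets UNIV {{x. 0 < f x} | f. test_fun f \<and> (\<forall>x. 0 \<le> f x)}" (is "_ = sigma_sets UNIV ?E")
proof
  have "open {x. 0 < f x}" if "test_fun f" for f :: "'a \<Rightarrow> real"
    using C1_grad_continuous[OF test_fun_C1_grad[OF that], of UNIV]
    by (intro open_Collect_less continuous_intros)
  then have "?E \<subseteq> {S. open S}" by auto
  then show "sigma_sets UNIV ?E \<subseteq> sets borel"
    by (intro sets.sigma_sets_subset[of _ borel, simplified]) (auto intro: borel_open)
next
  have "S \<in> sigma_sets UNIV ?E" if "open S" for S :: "'a set"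
  proof -
    let ?F = "{ball c r | c r. r > 0 \<and> ball c r \<subseteq> S}"
    obtain F' where F': "F' \<subseteq> ?F" "countable F'" "\<Union>F' = \<Union>?F"
      using Lindelof[of ?F] by auto
    have "\<Union>?F = S"
    proof
      show "S \<subseteq> \<Union>?F"
      proof
        fix x assume "x \<in> S"
        then obtain e where "e > 0" "ball x e \<subseteq> S" using \<open>open S\<close> openE by blast
        then show "x \<in> \<Union>?F" by (intro UnionI[of "ball x e"]) auto
      qed
    qed auto
    moreover have "\<Union>F' \<in> sigma_sets UNIV ?E"
    proof (rule sigma_sets_UNION[OF F'(2)])
      fix b assume "b \<in> F'"
      then obtain c r where b: "b = ball c r" "r > 0" using F'(1) by auto
      have "ball c r = {x. 0 < bump c r x}"
        using b(2) by (auto simp: bump_pos_iff dist_norm norm_minus_commute)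
      then show "b \<in> sigma_sets UNIV ?E"
        using b test_fun_bump[OF b(2), of c] bump_nonneg[of c r]
        by (intro sigma_sets.Basic) auto
    qed
    ultimately show ?thesis using F'(3) by simp
  qed
  then show "sets borel \<subseteq> sigma_sets UNIV ?E"
    by (auto simp: borel_def intro!: sigma_sets_mono)
qed

text \<open>The positive and negative part of \<open>w\<close> are densities of measures that agree on a generator
  stable under intersection.\<close>

lemma weakly_zero_imp_AE_zero:
  fixes w :: "'a::euclidean_space \<Rightarrow> real"
  assumes w: "locally_integrable w"
    and zero: "\<And>f. test_fun f \<Longrightarrow> (LINT x|lborel. f x * w x) = 0"
  shows "AE x in lborel. w x = 0"
proof -
  have [measurable]: "w \<in> borel_measurable borel" using w by (simp add: locally_integrable_def)
  let ?E = "{{x. 0 < f x} | f :: 'a \<Rightarrow> real. test_fun f \<and> (\<forall>x. 0 \<le> f x)}"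
  let ?P = "density lborel (\<lambda>x. ennreal (w x))" and ?N = "density lborel (\<lambda>x. ennreal (- w x))"
  have fin: "emeasure ?P {x. 0 < f x} \<noteq> \<infinity> \<and> emeasure ?P {x. 0 < f x} = emeasure ?N {x. 0 < f x}"
    if f: "test_fun f" "\<And>x. 0 \<le> f x" for f :: "'a \<Rightarrow> real"
  proof -
    obtain K c where K: "compact K" "\<And>x. x \<notin> K \<Longrightarrow> f x = 0" using f(1) by (elim test_funE) blast
    let ?U = "{x. 0 < f x}"
    note test_fun_measurable[OF f(1), measurable]
    have iK: "integrable lborel (\<lambda>x. indicator K x *\<^sub>R w x)"
      using w K(1) by (auto simp: locally_integrable_def set_integrable_def)
    have int: "integrable lborel (\<lambda>x. indicator ?U x * w x)"
      by (rule Bochner_Integration.integrable_bound[OF iK])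
        (use K(2) in \<open>auto simp: indicator_def intro!: AE_I2\<close>)
    have "(\<lambda>n. LINT x|lborel. (f x * (real n / (1 + real n * f x))) * w x) \<longlonglongrightarrow>
        (LINT x|lborel. indicator ?U x * w x)"
    proof (rule integral_dominated_convergence[where w="\<lambda>x. norm (indicator ?U x * w x)"])
      show "AE x in lborel. (\<lambda>n. (f x * (real n / (1 + real n * f x))) * w x) \<longlonglongrightarrow> indicator ?U x * w x"
        by (intro AE_I2 tendsto_intros test_fun_approximates_indicator(2) f)
      show "AE x in lborel. norm ((f x * (real n / (1 + real n * f x))) * w x) \<le> norm (indicator ?U x * w x)" for n
        using test_fun_approximates_indicator(3)[OF f, where n=n]
        by (intro AE_I2) (auto simp: abs_mult[of _ "w _"] simp del: times_divide_eq_right intro!: mult_right_mono intro: order_trans)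
      show "integrable lborel (\<lambda>x. norm (indicator ?U x * w x))" by (rule integrable_norm[OF int])
    qed measurable
    moreover have "(LINT x|lborel. (f x * (real n / (1 + real n * f x))) * w x) = 0" for n
      by (rule zero[OF test_fun_approximates_indicator(1)[OF f]])
    ultimately have "(LINT x|lborel. indicator ?U x * w x) = 0"
      by (simp add: LIMSEQ_const_iff)
    then have eq: "enn2real (\<integral>\<^sup>+x. ennreal (indicator ?U x * w x) \<partial>lborel) =
        enn2real (\<integral>\<^sup>+x. ennreal (- (indicator ?U x * w x)) \<partial>lborel)"
      by (simp add: real_lebesgue_integral_def[OF int])
    have f1: "(\<integral>\<^sup>+x. ennreal (indicator ?U x * w x) \<partial>lborel) < \<infinity>"
      using int by (simp add: real_integrable_def top.not_eq_extremum)
    have f2: "(\<integral>\<^sup>+x. ennreal (- (indicator ?U x * w x)) \<partial>lborel) < \<infinity>"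
      using int by (simp add: real_integrable_def top.not_eq_extremum)
    have U: "?U \<in> sets lborel" by measurable
    have "emeasure ?P ?U = (\<integral>\<^sup>+x. ennreal (indicator ?U x * w x) \<partial>lborel)"
      using U by (subst emeasure_density) (auto intro!: nn_integral_cong simp: indicator_def)
    moreover have "emeasure ?N ?U = (\<integral>\<^sup>+x. ennreal (- (indicator ?U x * w x)) \<partial>lborel)"
      using U by (subst emeasure_density) (auto intro!: nn_integral_cong simp: indicator_def)
    ultimately show ?thesis
      using eq f1 f2 by (metis ennreal_enn2real infinity_ennreal_def less_irrefl)
  qed
  have "?P = ?N"
  proof (rule measure_eqI_generator_eq[where \<Omega>=UNIV and E="?E" and A="\<lambda>n. {x. 0 < bump 0 (real (Suc n)) x}"])
    show "Int_stable ?E"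
    proof (rule Int_stableI)
      fix a b assume "a \<in> ?E" "b \<in> ?E"
      then obtain f g where fg: "test_fun f" "\<forall>x. 0 \<le> f x" "test_fun g" "\<forall>x. 0 \<le> g x"
        "a = {x. 0 < f x}" "b = {x. 0 < g x}" by auto
      have "a \<inter> b = {x. 0 < f x * g x}"
        using fg by (auto simp: zero_less_mult_iff not_less[symmetric])
      then show "a \<inter> b \<in> ?E"
        using fg test_fun_mult[OF fg(1) test_fun_C1_grad[OF fg(3)]] by auto
    qed
    show "(\<Union>i. {x. 0 < bump (0::'a) (real (Suc i)) x}) = UNIV"
    proof -
      have "\<exists>i. norm x < real (Suc i)" for x :: 'a
      proof -
        obtain n where "norm x < real n" using reals_Archimedean2 by blast
        then have "norm x < real (Suc n)" by simp
        then show ?thesis by blast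
      qed
      then show ?thesis by (auto simp: bump_pos_iff simp del: of_nat_Suc)
    qed
    show "range (\<lambda>i. {x. 0 < bump (0::'a) (real (Suc i)) x}) \<subseteq> ?E"
    proof (rule image_subsetI)
      fix i
      show "{x. 0 < bump (0::'a) (real (Suc i)) x} \<in> ?E"
        by (intro CollectI exI[of _ "bump 0 (real (Suc i))"] conjI refl allI bump_nonneg test_fun_bump) simp
    qed
    show "emeasure ?P {x. 0 < bump 0 (real (Suc i)) x} \<noteq> \<infinity>" for i
      by (rule conjunct1[OF fin[OF test_fun_bump bump_nonneg]]) simp
    show "emeasure ?P X = emeasure ?N X" if "X \<in> ?E" for X using that fin by auto
  qed (auto simp: sets_borel_generated_by_test_funs)
  then have "AE x in lborel. ennreal (w x) = ennreal (- w x)"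
    by (intro sigma_finite_measure.density_unique[OF sigma_finite_lborel]) auto
  then show ?thesis
    by eventually_elim (metis ennreal_eq_0_iff ennreal_inj le_cases neg_0_le_iff_le neg_le_0_iff_le order_antisym)
qed

text \<open>The kinetic cost refers to an arbitrarily chosen weighted divergence; any other one may
  be used to compute it.\<close>

lemma weighted_divergence_unique:
  assumes a: "weighted_divergence \<rho> u a" and b: "weighted_divergence \<rho> u b"
  shows "AE x in lborel. \<rho> x * a x = \<rho> x * b x"
proof -
  have la: "locally_integrable (\<lambda>x. \<rho> x * a x)" and lb: "locally_integrable (\<lambda>x. \<rho> x * b x)"
    using a b by (auto simp: weighted_divergence_def has_weak_divergence_def)
  have int: "integrable lborel (\<lambda>x. f x * w x)"
    if f: "test_fun f" and w: "locally_integrable w" for f w :: "'a \<Rightarrow> real"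
  proof -
    obtain K c where K: "compact K" "\<And>x. x \<notin> K \<Longrightarrow> f x = 0" "\<And>x. \<bar>f x\<bar> \<le> c"
      using f by (elim test_funE) blast
    have [measurable]: "w \<in> borel_measurable borel" using w by (simp add: locally_integrable_def)
    note test_fun_measurable[OF f, measurable]
    have "integrable lborel (\<lambda>x. c * (indicator K x *\<^sub>R w x))"
      using w K(1) by (auto simp: locally_integrable_def set_integrable_def)
    then show ?thesis
      by (rule Bochner_Integration.integrable_bound)
        (use K(2,3) in \<open>auto simp: indicator_def abs_mult intro!: AE_I2 mult_mono intro: order_trans[OF _ abs_ge_self]\<close>)
  qed
  have "AE x in lborel. \<rho> x * a x - \<rho> x * b x = 0"
  proof (rule weakly_zero_imp_AE_zero)
    show "locally_integrable (\<lambda>x. \<rho> x * a x - \<rho> x * b x)"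
      using la lb by (auto simp: locally_integrable_def intro: set_integral_diff(1))
    show "(LINT x|lborel. f x * (\<rho> x * a x - \<rho> x * b x)) = 0" if f: "test_fun f" for f
      using a b f int[OF f la] int[OF f lb]
      by (auto simp: weighted_divergence_def has_weak_divergence_def right_diff_distrib)
  qed
  then show ?thesis by simp
qed

section \<open>Differentiation under the integral sign and integration by parts\<close>

lemma C1_grad_mean_value_bound:
  assumes f: "C1_grad f G" and S: "convex S" "x \<in> S" "y \<in> S" and B: "\<And>z. z \<in> S \<Longrightarrow> norm (G z) \<le> B"
  shows "\<bar>f y - f x\<bar> \<le> B * norm (y - x)"
proof -
  have B0: "0 \<le> B" using B[OF S(2)] norm_ge_zero order_trans by blast
  have "norm (f y - f x) \<le> B * norm (y - x)"
  proof (rule differentiable_bound[OF S(1) _ _ S(3,2)])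
    show "(f has_derivative (\<lambda>v. G z \<bullet> v)) (at z within S)" for z
      by (rule has_derivative_at_withinI[OF C1_grad_derivative[OF f]])
    show "onorm (\<lambda>v. G z \<bullet> v) \<le> B" if "z \<in> S" for z
    proof (rule onorm_bound[OF B0])
      show "norm (G z \<bullet> v) \<le> B * norm v" for v
        unfolding real_norm_def using B[OF that]
        by (intro order_trans[OF Cauchy_Schwarz_ineq2] mult_right_mono) auto
    qed
  qed
  then show ?thesis by simp
qed

text \<open>A dominating function is required only near each point, because difference quotients
  are bounded by the gradient on the ball in which they are formed.\<close>

lemma C1_grad_integral:
  fixes f :: "'a::euclidean_space \<Rightarrow> 'b \<Rightarrow> real" and D :: "'a \<Rightarrow> 'b \<Rightarrow> 'a"
  assumes der: "\<And>x \<omega>. ((\<lambda>x. f x \<omega>) has_derivative (\<lambda>v. D x \<omega> \<bullet> v)) (at x)"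
    and cont: "\<And>\<omega>. continuous_on UNIV (\<lambda>x. D x \<omega>)"
    and int: "\<And>x. integrable M (f x)"
    and [measurable]: "\<And>x. D x \<in> borel_measurable M"
    and dom: "\<And>x. \<exists>G. integrable M G \<and> (\<forall>y\<in>ball x 1. \<forall>\<omega>. norm (D y \<omega>) \<le> G \<omega>)"
  shows "C1_grad (\<lambda>x. \<integral>\<omega>. f x \<omega> \<partial>M) (\<lambda>x. \<integral>\<omega>. D x \<omega> \<partial>M)"
    and "integrable M (D x)"
proof -
  have [measurable]: "f x \<in> borel_measurable M" for x using int by auto
  have intD: "integrable M (D x)" for x
  proof -
    obtain G where G: "integrable M G" "\<forall>y\<in>ball x 1. \<forall>\<omega>. norm (D y \<omega>) \<le> G \<omega>" using dom by blast
    show ?thesis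
    proof (rule Bochner_Integration.integrable_bound[OF G(1)])
      show "AE \<omega> in M. norm (D x \<omega>) \<le> norm (G \<omega>)"
        using G(2) by (intro AE_I2 order_trans[OF _ abs_ge_self, of _ "G _", folded real_norm_def]) auto
    qed simp
  qed
  then show "integrable M (D x)" .
  have shift: "\<exists>N. \<forall>n. X (n + N) \<in> ball x 1" if "X \<longlonglongrightarrow> x" for X :: "nat \<Rightarrow> 'a" and x
    using that[unfolded lim_sequentially, rule_format, of 1]
    by (auto simp: dist_commute) (metis le_add2)
  show "C1_grad (\<lambda>x. \<integral>\<omega>. f x \<omega> \<partial>M) (\<lambda>x. \<integral>\<omega>. D x \<omega> \<partial>M)"
  proof (rule C1_gradI)
    fix x
    obtain G where G: "integrable M G" "\<forall>y\<in>ball x 1. \<forall>\<omega>. norm (D y \<omega>) \<le> G \<omega>" using dom by blast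
    let ?q = "\<lambda>y \<omega>. (f y \<omega> - f x \<omega> - D x \<omega> \<bullet> (y - x)) / norm (y - x)"
    have lip: "norm (?q y \<omega>) \<le> 2 * G \<omega>" if y: "y \<in> ball x 1" "y \<noteq> x" for y \<omega>
    proof -
      have "\<bar>f y \<omega> - f x \<omega>\<bar> \<le> G \<omega> * norm (y - x)"
        by (rule C1_grad_mean_value_bound[OF C1_gradI[OF der cont] convex_ball[of x 1]]) (use G(2) y in auto)
      moreover have "\<bar>D x \<omega> \<bullet> (y - x)\<bar> \<le> G \<omega> * norm (y - x)"
        using G(2)[rule_format, of x \<omega>]
        by (intro order_trans[OF Cauchy_Schwarz_ineq2] mult_right_mono) auto
      ultimately have "\<bar>f y \<omega> - f x \<omega> - D x \<omega> \<bullet> (y - x)\<bar> \<le> 2 * G \<omega> * norm (y - x)"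
        by auto
      then show ?thesis using y by (simp add: field_simps)
    qed
    have q: "(\<integral>\<omega>. ?q y \<omega> \<partial>M) =
        ((\<integral>\<omega>. f y \<omega> \<partial>M) - (\<integral>\<omega>. f x \<omega> \<partial>M) - (\<integral>\<omega>. D x \<omega> \<partial>M) \<bullet> (y - x)) / norm (y - x)" for y
      using int intD by (simp add: integral_inner_left)
    have lim: "(\<lambda>n. \<integral>\<omega>. ?q (X n) \<omega> \<partial>M) \<longlonglongrightarrow> 0" if X: "X \<longlonglongrightarrow> x" "\<And>n. X n \<noteq> x" for X
    proof -
      obtain N where N: "\<And>n. X (n + N) \<in> ball x 1" using shift[OF X(1)] by blast
      have "(\<lambda>n. \<integral>\<omega>. ?q (X (n + N)) \<omega> \<partial>M) \<longlonglongrightarrow> (\<integral>\<omega>. 0 \<partial>M)"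
      proof (rule integral_dominated_convergence[where w="\<lambda>\<omega>. 2 * G \<omega>"])
        show "AE \<omega> in M. (\<lambda>n. ?q (X (n + N)) \<omega>) \<longlonglongrightarrow> 0"
        proof (rule AE_I2)
          fix \<omega>
          have "((\<lambda>y. norm (f y \<omega> - f x \<omega> - D x \<omega> \<bullet> (y - x)) / norm (y - x)) \<longlongrightarrow> 0) (at x)"
            using der[where x=x and \<omega>=\<omega>] by (simp add: has_derivative_iff_norm)
          then have "(\<lambda>n. norm (f (X n) \<omega> - f x \<omega> - D x \<omega> \<bullet> (X n - x)) / norm (X n - x)) \<longlonglongrightarrow> 0"
            using X by (auto simp: tendsto_at_iff_sequentially o_def)
          then have "(\<lambda>n. norm (?q (X n) \<omega>)) \<longlonglongrightarrow> 0" by (simp add: norm_divide)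
          then have "(\<lambda>n. ?q (X n) \<omega>) \<longlonglongrightarrow> 0" by (rule tendsto_norm_zero_cancel)
          then show "(\<lambda>n. ?q (X (n + N)) \<omega>) \<longlonglongrightarrow> 0" by (rule LIMSEQ_ignore_initial_segment)
        qed
        show "AE \<omega> in M. norm (?q (X (n + N)) \<omega>) \<le> 2 * G \<omega>" for n
          by (intro AE_I2 lip N X)
      qed (use G(1) in auto)
      then have "(\<lambda>n. \<integral>\<omega>. ?q (X (n + N)) \<omega> \<partial>M) \<longlonglongrightarrow> 0" by simp
      then show ?thesis by (rule LIMSEQ_offset)
    qed
    show "((\<lambda>x. \<integral>\<omega>. f x \<omega> \<partial>M) has_derivative (\<lambda>v. (\<integral>\<omega>. D x \<omega> \<partial>M) \<bullet> v)) (at x)"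
      unfolding has_derivative_iff_norm
    proof
      show "bounded_linear ((\<bullet>) (\<integral>\<omega>. D x \<omega> \<partial>M))" by (rule bounded_linear_inner_right)
      show "((\<lambda>y. norm ((\<integral>\<omega>. f y \<omega> \<partial>M) - (\<integral>\<omega>. f x \<omega> \<partial>M) - (\<integral>\<omega>. D x \<omega> \<partial>M) \<bullet> (y - x)) / norm (y - x)) \<longlongrightarrow> 0) (at x)"
        unfolding tendsto_at_iff_sequentially o_def
      proof (intro allI impI)
        fix X :: "nat \<Rightarrow> 'a" assume "\<forall>i. X i \<in> UNIV - {x}" "X \<longlonglongrightarrow> x"
        then have "(\<lambda>n. norm (\<integral>\<omega>. ?q (X n) \<omega> \<partial>M)) \<longlonglongrightarrow> 0" by (intro tendsto_norm_zero lim) auto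
        then show "(\<lambda>n. norm ((\<integral>\<omega>. f (X n) \<omega> \<partial>M) - (\<integral>\<omega>. f x \<omega> \<partial>M) - (\<integral>\<omega>. D x \<omega> \<partial>M) \<bullet> (X n - x))
            / norm (X n - x)) \<longlonglongrightarrow> 0"
          unfolding q by (simp add: norm_divide)
      qed
    qed
  next
    show "continuous_on UNIV (\<lambda>x. \<integral>\<omega>. D x \<omega> \<partial>M)"
      unfolding continuous_on_sequentially o_def
    proof (intro ballI allI impI, elim conjE)
      fix x and X :: "nat \<Rightarrow> 'a" assume X: "X \<longlonglongrightarrow> x"
      obtain G where G: "integrable M G" "\<forall>y\<in>ball x 1. \<forall>\<omega>. norm (D y \<omega>) \<le> G \<omega>" using dom by blast
      obtain N where N: "\<And>n. X (n + N) \<in> ball x 1" using shift[OF X] by blast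
      have "(\<lambda>n. \<integral>\<omega>. D (X (n + N)) \<omega> \<partial>M) \<longlonglongrightarrow> (\<integral>\<omega>. D x \<omega> \<partial>M)"
      proof (rule integral_dominated_convergence[where w=G])
        show "AE \<omega> in M. (\<lambda>n. D (X (n + N)) \<omega>) \<longlonglongrightarrow> D x \<omega>"
          using cont X by (intro AE_I2 LIMSEQ_ignore_initial_segment[where f="\<lambda>n. D (X n) _"])
            (auto simp: continuous_on_sequentially o_def)
      qed (use G N in auto)
      then show "(\<lambda>n. \<integral>\<omega>. D (X n) \<omega> \<partial>M) \<longlonglongrightarrow> (\<integral>\<omega>. D x \<omega> \<partial>M)" by (rule LIMSEQ_offset)
    qed
  qed
qed

lemma integral_translate:
  fixes f :: "'a::euclidean_space \<Rightarrow> real"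
  assumes [measurable]: "f \<in> borel_measurable borel"
  shows "(LINT x|lborel. f (c + x)) = (LINT x|lborel. f x)"
proof -
  have "(LINT x|lborel. f x) = (LINT x|distr lborel borel ((+) c). f x)"
    by (simp only: lborel_distr_plus)
  also have "\<dots> = (LINT x|lborel. f (c + x))" by (subst integral_distr) auto
  finally show ?thesis by simp
qed

lemma integrable_lborel_bounded_support:
  fixes f :: "'a::euclidean_space \<Rightarrow> 'b::euclidean_space"
  assumes f: "f \<in> borel_measurable borel" "\<And>x. norm (f x) \<le> c" "\<And>x. x \<notin> K \<Longrightarrow> f x = 0"
    and K: "compact K"
  shows "integrable lborel f"
proof -
  have "emeasure lborel K < \<infinity>" using emeasure_bounded_finite[OF compact_imp_bounded[OF K]] by simp
  then have "integrable lborel (\<lambda>x. indicator K x * c :: real)"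
    using K by (intro integrable_mult_left integrable_real_indicator) (auto simp: compact_imp_closed)
  then show ?thesis
  proof (rule Bochner_Integration.integrable_bound)
    show "AE x in lborel. norm (f x) \<le> norm (indicator K x * c)"
      using f(2,3) norm_ge_zero by (intro AE_I2) (auto simp: indicator_def intro: order_trans[OF f(2)])
  qed (use f(1) in simp)
qed

text \<open>Translation invariance says that \<open>\<integral> f (x + t b) dx\<close> is constant in \<open>t\<close>; its derivative at
  \<open>t = 0\<close> is the integral of a partial derivative, which is why no boundary term appears.\<close>

lemma integral_partial_eq_0:
  fixes f :: "'a::euclidean_space \<Rightarrow> real"
  assumes f: "test_fun f"
  shows "(LINT x|lborel. gradient f x \<bullet> b) = 0"
proof -
  note test_fun_measurable[OF f, measurable]
  note C = test_fun_C1_grad[OF f]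
  obtain K c where K: "compact K" "0 < c" "\<And>x. \<bar>f x\<bar> \<le> c" "\<And>x. norm (gradient f x) \<le> c"
    "\<And>x. x \<notin> K \<Longrightarrow> f x = 0" "\<And>x. x \<notin> K \<Longrightarrow> gradient f x = 0" using f by (elim test_funE) blast
  obtain r where r: "\<And>x. x \<in> K \<Longrightarrow> norm x \<le> r" using compact_imp_bounded[OF K(1)] by (auto simp: bounded_iff)
  have "C1_grad (\<lambda>t. LINT x|lborel. f (t *\<^sub>R b + x)) (\<lambda>t. LINT x|lborel. gradient f (t *\<^sub>R b + x) \<bullet> b)"
  proof (rule C1_grad_integral)
    show "((\<lambda>t. f (t *\<^sub>R b + x)) has_derivative (\<lambda>v. (gradient f (t *\<^sub>R b + x) \<bullet> b) \<bullet> v)) (at t)" for t x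
    proof -
      have "((\<lambda>t. t *\<^sub>R b + x) has_derivative (\<lambda>v. v *\<^sub>R b)) (at t)" by (auto intro!: derivative_eq_intros)
      from has_derivative_compose[OF this C1_grad_derivative[OF C]]
      show ?thesis by (simp add: mult.commute)
    qed
    show "continuous_on UNIV (\<lambda>t. gradient f (t *\<^sub>R b + x) \<bullet> b)" for x
      by (intro continuous_intros continuous_on_compose2[OF C1_grad_continuous_grad[OF C, of UNIV]]) auto
    show "integrable lborel (\<lambda>x. f (t *\<^sub>R b + x))" for t
    proof (rule integrable_lborel_bounded_support[where K="cball 0 (r + norm (t *\<^sub>R b))"])
      show "f (t *\<^sub>R b + x) = 0" if "x \<notin> cball 0 (r + norm (t *\<^sub>R b))" for x
        using that r[of "t *\<^sub>R b + x"] norm_triangle_ineq4[of "t *\<^sub>R b + x" "t *\<^sub>R b"] K(5) by force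
    qed (use K(3) in auto)
    show "\<exists>G. integrable lborel G \<and>
      (\<forall>s\<in>ball t 1. \<forall>x. norm (gradient f (s *\<^sub>R b + x) \<bullet> b) \<le> G x)" for t
    proof (intro exI conjI ballI allI)
      let ?B = "cball (0::'a) (r + (\<bar>t\<bar> + 1) * norm b)"
      show "integrable lborel (\<lambda>x. (c * norm b) * indicator ?B x)"
        by (rule integrable_lborel_bounded_support[where K="?B" and c="c * norm b"])
           (use K(2) in \<open>auto simp: indicator_def\<close>)
      fix s x assume s: "s \<in> ball t 1"
      then have s': "\<bar>s\<bar> \<le> \<bar>t\<bar> + 1" by (auto simp: dist_real_def)
      show "norm (gradient f (s *\<^sub>R b + x) \<bullet> b) \<le> (c * norm b) * indicator ?B x"
      proof (cases "s *\<^sub>R b + x \<in> K")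
        case True
        have "norm x \<le> norm (s *\<^sub>R b + x) + norm (s *\<^sub>R b)"
          using norm_triangle_ineq4[of "s *\<^sub>R b + x" "s *\<^sub>R b"] by simp
        also have "\<dots> \<le> r + (\<bar>t\<bar> + 1) * norm b"
          using r[OF True] s' by (intro add_mono) (auto intro!: mult_right_mono)
        finally have "x \<in> ?B" by simp
        moreover have "norm (gradient f (s *\<^sub>R b + x) \<bullet> b) \<le> c * norm b"
          unfolding real_norm_def
          by (intro order_trans[OF Cauchy_Schwarz_ineq2] mult_right_mono K(4)) auto
        ultimately show ?thesis by simp
      next
        case False
        then show ?thesis using K(2,6) by simp
      qed
    qed
  qed measurable
  moreover have "(LINT x|lborel. f (t *\<^sub>R b + x)) = (LINT x|lborel. f x)" for t
    by (rule integral_translate) simp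
  ultimately have "C1_grad (\<lambda>t::real. LINT x|lborel. f x) (\<lambda>t. LINT x|lborel. gradient f (t *\<^sub>R b + x) \<bullet> b)"
    by simp
  then have "(\<lambda>t. LINT x|lborel. gradient f (t *\<^sub>R b + x) \<bullet> b) = (\<lambda>t::real. 0)"
    using C1_grad_gradient C1_grad_const by metis
  from fun_cong[OF this, of 0] show ?thesis by simp
qed

text \<open>The partial derivatives of \<open>f (F \<bullet> b)\<close> integrate to zero for each \<open>b\<close>; their sum is the claim.\<close>

lemma integration_by_parts:
  fixes F :: "'a::euclidean_space \<Rightarrow> 'a"
  assumes F: "\<And>b. b \<in> Basis \<Longrightarrow> C1_grad (\<lambda>x. F x \<bullet> b) (D b)"
    and f: "test_fun f"
  shows "(LINT x|lborel. gradient f x \<bullet> F x) = - (LINT x|lborel. f x * (\<Sum>b\<in>Basis. D b x \<bullet> b))"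
proof -
  note test_fun_measurable[OF f, measurable]
  have [measurable]: "D b \<in> borel_measurable borel" "(\<lambda>x. F x \<bullet> b) \<in> borel_measurable borel"
    if "b \<in> Basis" for b
    using F[OF that] by (auto intro!: borel_measurable_continuous_onI C1_grad_continuous C1_grad_continuous_grad)
  obtain K c where K: "compact K" "\<And>x. x \<notin> K \<Longrightarrow> f x = 0" "\<And>x. x \<notin> K \<Longrightarrow> gradient f x = 0"
    using f by (elim test_funE) blast
  have int: "integrable lborel w"
    if w: "continuous_on UNIV w" "\<And>x. x \<notin> K \<Longrightarrow> w x = 0" for w :: "'a \<Rightarrow> real"
  proof -
    have "bounded (w ` K)"
      by (intro compact_imp_bounded compact_continuous_image K(1) continuous_on_subset[OF w(1)]) auto
    then obtain c where "\<And>x. x \<in> K \<Longrightarrow> norm (w x) \<le> c" by (auto simp: bounded_iff)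
    then have "norm (w x) \<le> max 0 c" for x by (cases "x \<in> K") (fastforce simp: w(2) le_max_iff_disj)+
    then show ?thesis
      by (intro integrable_lborel_bounded_support[OF _ _ w(2) K(1)] borel_measurable_continuous_onI w(1))
  qed
  note C = test_fun_C1_grad[OF f]
  have i1: "integrable lborel (\<lambda>x. f x * (D b x \<bullet> b))"
    and i2: "integrable lborel (\<lambda>x. (F x \<bullet> b) * (gradient f x \<bullet> b))" if b: "b \<in> Basis" for b
    using K by (auto intro!: int continuous_on_mult continuous_on_inner continuous_on_const
        C1_grad_continuous[OF C] C1_grad_continuous_grad[OF C] C1_grad_continuous_grad[OF F[OF b]]
        C1_grad_continuous[OF F[OF b]])
  have "(LINT x|lborel. f x * (D b x \<bullet> b)) + (LINT x|lborel. (F x \<bullet> b) * (gradient f x \<bullet> b)) = 0"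
    if b: "b \<in> Basis" for b
  proof -
    have "gradient (\<lambda>x. f x * (F x \<bullet> b)) = (\<lambda>x. f x *\<^sub>R D b x + (F x \<bullet> b) *\<^sub>R gradient f x)"
      by (rule C1_grad_gradient[OF C1_grad_mult[OF C F[OF b]]])
    with integral_partial_eq_0[OF test_fun_mult[OF f F[OF b]], of b]
    have "(LINT x|lborel. f x * (D b x \<bullet> b) + (F x \<bullet> b) * (gradient f x \<bullet> b)) = 0"
      by (simp add: inner_add_left)
    then show ?thesis using i1[OF b] i2[OF b] by simp
  qed
  moreover have inner_sum_F: "gradient f x \<bullet> F x = (\<Sum>b\<in>Basis. (F x \<bullet> b) * (gradient f x \<bullet> b))" for x
    by (subst euclidean_inner) (simp add: mult.commute)
  ultimately have "(\<Sum>b\<in>Basis. (LINT x|lborel. f x * (D b x \<bullet> b)) + (LINT x|lborel. (F x \<bullet> b) * (gradient f x \<bullet> b))) = 0"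
    by (simp del: sum.distrib)
  then have "(\<Sum>b\<in>Basis. LINT x|lborel. f x * (D b x \<bullet> b)) +
      (\<Sum>b\<in>Basis. LINT x|lborel. (F x \<bullet> b) * (gradient f x \<bullet> b)) = 0"
    by (simp add: sum.distrib)
  moreover have "(\<Sum>b\<in>Basis. LINT x|lborel. f x * (D b x \<bullet> b)) = (LINT x|lborel. f x * (\<Sum>b\<in>Basis. D b x \<bullet> b))"
    using i1 by (subst Bochner_Integration.integral_sum[symmetric]) (auto simp: sum_distrib_left)
  moreover have "(\<Sum>b\<in>Basis. LINT x|lborel. (F x \<bullet> b) * (gradient f x \<bullet> b)) = (LINT x|lborel. gradient f x \<bullet> F x)"
    using i2 by (subst Bochner_Integration.integral_sum[symmetric])
      (auto intro!: Bochner_Integration.integral_cong simp: inner_sum_F)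
  ultimately show ?thesis by simp
qed

section \<open>Probability densities and controlled flows\<close>

lemma prob_densityD:
  assumes "\<rho> \<in> prob_densities"
  shows "\<rho> \<in> borel_measurable borel" "0 \<le> \<rho> x" "integrable lborel \<rho>"
    "(LINT x|lborel. \<rho> x) = 1" "integrable lborel (\<lambda>x. (norm x)\<^sup>2 * \<rho> x)"
  using assms by (auto simp: prob_densities_def)

lemma integrable_bounded_times_density:
  fixes \<phi> :: "'a::euclidean_space \<Rightarrow> real"
  assumes p: "\<rho> \<in> prob_densities" and [measurable]: "\<phi> \<in> borel_measurable borel" and c: "\<And>x. \<bar>\<phi> x\<bar> \<le> c"
  shows "integrable lborel (\<lambda>x. \<phi> x * \<rho> x)"
proof (rule Bochner_Integration.integrable_bound[OF integrable_mult_right[OF prob_densityD(3)[OF p], of c]])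
  note prob_densityD(1)[OF p, measurable]
  show "(\<lambda>x. \<phi> x * \<rho> x) \<in> borel_measurable lborel" by measurable
  have "\<bar>\<phi> x\<bar> \<le> \<bar>c\<bar>" for x using c[of x] by simp
  then show "AE x in lborel. norm (\<phi> x * \<rho> x) \<le> norm (c * \<rho> x)"
    using prob_densityD(2)[OF p] by (auto simp: abs_mult intro!: mult_right_mono AE_I2)
qed

lemma abs_mean_le:
  fixes \<phi> :: "'a::euclidean_space \<Rightarrow> real"
  assumes p: "\<rho> \<in> prob_densities" and m: "\<phi> \<in> borel_measurable borel" and c: "\<And>x. \<bar>\<phi> x\<bar> \<le> c"
  shows "\<bar>mean \<rho> \<phi>\<bar> \<le> c"
proof -
  have "\<bar>mean \<rho> \<phi>\<bar> \<le> (LINT x|lborel. \<bar>\<phi> x * \<rho> x\<bar>)"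
    unfolding mean_def by (rule integral_abs_bound)
  also have "\<dots> \<le> (LINT x|lborel. c * \<rho> x)"
  proof (rule integral_mono)
    show "integrable lborel (\<lambda>x. \<bar>\<phi> x * \<rho> x\<bar>)"
      by (rule integrable_abs[OF integrable_bounded_times_density[OF p m c]])
  qed (use prob_densityD[OF p] c in \<open>auto simp: abs_mult intro!: mult_right_mono\<close>)
  also have "\<dots> = c" using prob_densityD[OF p] by simp
  finally show ?thesis .
qed

lemma integrable_times_density_of_square:
  fixes \<phi> :: "'a::euclidean_space \<Rightarrow> 'b::euclidean_space"
  assumes p: "\<rho> \<in> prob_densities" and [measurable]: "\<phi> \<in> borel_measurable borel"
    and sq: "integrable lborel (\<lambda>x. (norm (\<phi> x))\<^sup>2 * \<rho> x)"
  shows "integrable lborel (\<lambda>x. \<rho> x *\<^sub>R \<phi> x)"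
proof (rule Bochner_Integration.integrable_bound[OF Bochner_Integration.integrable_add[OF prob_densityD(3)[OF p] sq]])
  note prob_densityD(1)[OF p, measurable]
  show "(\<lambda>x. \<rho> x *\<^sub>R \<phi> x) \<in> borel_measurable lborel" by measurable
  have "norm (\<phi> x) \<le> 1 + (norm (\<phi> x))\<^sup>2" for x
  proof -
    have "0 \<le> (norm (\<phi> x) - 1)\<^sup>2" by simp
    then have "2 * norm (\<phi> x) \<le> 1 + (norm (\<phi> x))\<^sup>2" by (simp add: power2_diff)
    then show ?thesis using norm_ge_zero[of "\<phi> x"] by linarith
  qed
  then have "\<rho> x * norm (\<phi> x) \<le> \<rho> x * (1 + (norm (\<phi> x))\<^sup>2)" for x
    by (rule mult_left_mono) (rule prob_densityD(2)[OF p])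
  then show "AE x in lborel. norm (\<rho> x *\<^sub>R \<phi> x) \<le> norm (\<rho> x + (norm (\<phi> x))\<^sup>2 * \<rho> x)"
    using prob_densityD(2)[OF p] by (intro AE_I2) (auto simp: algebra_simps intro: order_trans[OF _ abs_ge_self])
qed

lemma integrable_square_shift:
  fixes \<phi> :: "'a::euclidean_space \<Rightarrow> real"
  assumes p: "\<rho> \<in> prob_densities" and m: "\<phi> \<in> borel_measurable borel"
    and sq: "integrable lborel (\<lambda>x. (\<phi> x)\<^sup>2 * \<rho> x)"
  shows "integrable lborel (\<lambda>x. (\<phi> x - c)\<^sup>2 * \<rho> x)"
    and "(LINT x|lborel. (\<phi> x - c)\<^sup>2 * \<rho> x) = (LINT x|lborel. (\<phi> x)\<^sup>2 * \<rho> x) - 2 * c * mean \<rho> \<phi> + c\<^sup>2"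
proof -
  have i: "integrable lborel (\<lambda>x. \<phi> x * \<rho> x)"
    using integrable_times_density_of_square[OF p m] sq by (simp add: mult.commute)
  have eq: "(\<phi> x - c)\<^sup>2 * \<rho> x = (\<phi> x)\<^sup>2 * \<rho> x - 2 * c * (\<phi> x * \<rho> x) + c\<^sup>2 * \<rho> x" for x
    by (simp add: power2_eq_square algebra_simps)
  show "integrable lborel (\<lambda>x. (\<phi> x - c)\<^sup>2 * \<rho> x)"
    unfolding eq using sq i prob_densityD[OF p] by auto
  show "(LINT x|lborel. (\<phi> x - c)\<^sup>2 * \<rho> x) = (LINT x|lborel. (\<phi> x)\<^sup>2 * \<rho> x) - 2 * c * mean \<rho> \<phi> + c\<^sup>2"
    unfolding eq mean_def using sq i prob_densityD[OF p] by simp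
qed

lemma variance_le:
  fixes \<phi> :: "'a::euclidean_space \<Rightarrow> real"
  assumes "\<rho> \<in> prob_densities" "\<phi> \<in> borel_measurable borel" "integrable lborel (\<lambda>x. (\<phi> x)\<^sup>2 * \<rho> x)"
  shows "(LINT x|lborel. (\<phi> x - mean \<rho> \<phi>)\<^sup>2 * \<rho> x) \<le> (LINT x|lborel. (\<phi> x - c)\<^sup>2 * \<rho> x)"
proof -
  have "0 \<le> (mean \<rho> \<phi> - c)\<^sup>2" by simp
  then show ?thesis
    unfolding integrable_square_shift(2)[OF assms] by (simp add: power2_eq_square algebra_simps)
qed

lemma mean_square_le:
  fixes \<phi> :: "'a::euclidean_space \<Rightarrow> real"
  assumes p: "\<rho> \<in> prob_densities" and m: "\<phi> \<in> borel_measurable borel"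
    and sq: "integrable lborel (\<lambda>x. (\<phi> x)\<^sup>2 * \<rho> x)"
  shows "(mean \<rho> \<phi>)\<^sup>2 \<le> (LINT x|lborel. (\<phi> x)\<^sup>2 * \<rho> x)"
proof -
  have "0 \<le> (LINT x|lborel. (\<phi> x - mean \<rho> \<phi>)\<^sup>2 * \<rho> x)"
    using prob_densityD(2)[OF p] by (intro integral_nonneg_AE AE_I2) auto
  then show ?thesis
    unfolding integrable_square_shift(2)[OF assms] by (simp add: power2_eq_square)
qed

lemma mean_dominated_convergence:
  fixes \<phi> :: "nat \<Rightarrow> 'a::euclidean_space \<Rightarrow> real"
  assumes p: "\<rho> \<in> prob_densities" and [measurable]: "\<And>n. \<phi> n \<in> borel_measurable borel" "\<psi> \<in> borel_measurable borel"
    and lim: "\<And>x. (\<lambda>n. \<phi> n x) \<longlonglongrightarrow> \<psi> x"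
    and dom: "integrable lborel (\<lambda>x. w x * \<rho> x)" "\<And>n x. \<bar>\<phi> n x\<bar> \<le> w x"
  shows "(\<lambda>n. mean \<rho> (\<phi> n)) \<longlonglongrightarrow> mean \<rho> \<psi>"
  unfolding mean_def
proof (rule integral_dominated_convergence[where w="\<lambda>x. w x * \<rho> x"])
  note prob_densityD(1)[OF p, measurable]
  show "(\<lambda>x. \<psi> x * \<rho> x) \<in> borel_measurable lborel" "(\<lambda>x. \<phi> n x * \<rho> x) \<in> borel_measurable lborel" for n
    by measurable
  show "AE x in lborel. (\<lambda>n. \<phi> n x * \<rho> x) \<longlonglongrightarrow> \<psi> x * \<rho> x" by (intro AE_I2 tendsto_intros lim)
  show "AE x in lborel. norm (\<phi> n x * \<rho> x) \<le> w x * \<rho> x" for n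
    using dom(2) prob_densityD(2)[OF p] by (intro AE_I2) (auto simp: abs_mult intro!: mult_right_mono)
qed (rule dom)

text \<open>This is the rate of change of \<open>\<integral> f \<rho>\<close> while \<open>\<rho>\<close> moves with velocity \<open>u\<close>.\<close>

definition flux_rate :: "('a::euclidean_space \<Rightarrow> real) \<Rightarrow> ('a \<Rightarrow> real) \<Rightarrow> ('a \<Rightarrow> 'a) \<Rightarrow> real" where
  "flux_rate f \<rho> u = (LINT x|lborel. gradient f x \<bullet> (\<rho> x *\<^sub>R u x))"

lemma indicator_strip: "indicator ({s..t} \<times> UNIV) (r, x) = indicator {s..t} r"
  by (simp add: indicator_def)

context
  fixes \<rho>\<^sub>0 :: "'a::euclidean_space \<Rightarrow> real" and \<rho> u
  assumes flow: "controlled_flow \<rho>\<^sub>0 \<rho> u"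
begin

lemma flow_density: "0 \<le> t \<Longrightarrow> \<rho> t \<in> prob_densities"
  using flow by (auto simp: controlled_flow_def)

lemma flow_0: "\<rho> 0 = \<rho>\<^sub>0"
  using flow by (auto simp: controlled_flow_def)

lemma flow_square_integrable: "0 \<le> t \<Longrightarrow> integrable lborel (\<lambda>x. (norm (u t x))\<^sup>2 * \<rho> t x)"
  using flow by (auto simp: controlled_flow_def)

lemma flow_control_measurable: "0 \<le> t \<Longrightarrow> u t \<in> borel_measurable borel"
proof -
  assume t: "0 \<le> t"
  have "(\<lambda>p. indicator ({0..} \<times> UNIV) p *\<^sub>R (case p of (t, x) \<Rightarrow> u t x)) \<in> borel_measurable borel"
    using flow by (auto simp: controlled_flow_def set_borel_measurable_def)
  moreover have "(\<lambda>p. indicator ({0..} \<times> UNIV) p *\<^sub>R (case p of (t, x) \<Rightarrow> u t x)) =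
      (\<lambda>(t, x). indicator {0..} t *\<^sub>R u t x)" by (auto simp: fun_eq_iff indicator_def)
  ultimately have [measurable]: "(\<lambda>(t, x). indicator {0..} t *\<^sub>R u t x) \<in> borel_measurable (borel \<Otimes>\<^sub>M borel)"
    by (simp only: borel_prod)
  have "(\<lambda>x. case (t, x) of (t, x) \<Rightarrow> indicator {0..} t *\<^sub>R u t x) \<in> borel_measurable borel"
    by measurable
  then show ?thesis using t by (simp add: indicator_def)
qed

lemma flow_mean_measurable:
  assumes [measurable]: "\<phi> \<in> borel_measurable borel"
  shows "set_borel_measurable borel {0..} (\<lambda>t. mean (\<rho> t) \<phi>)"
proof -
  have "(\<lambda>p. indicator ({0..} \<times> UNIV) p *\<^sub>R (case p of (t, x) \<Rightarrow> \<rho> t x)) \<in> borel_measurable borel"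
    using flow by (auto simp: controlled_flow_def set_borel_measurable_def)
  moreover have "(\<lambda>p. indicator ({0..} \<times> UNIV) p *\<^sub>R (case p of (t, x) \<Rightarrow> \<rho> t x)) =
      (\<lambda>(t, x). indicator {0..} t *\<^sub>R \<rho> t x)" by (auto simp: fun_eq_iff indicator_def)
  ultimately have [measurable]: "(\<lambda>(t, x). indicator {0..} t *\<^sub>R \<rho> t x) \<in> borel_measurable (borel \<Otimes>\<^sub>M borel)"
    by (simp only: borel_prod)
  have "(\<lambda>t. LINT x|lborel. \<phi> x * (indicator {0..} t *\<^sub>R \<rho> t x)) \<in> borel_measurable borel"
    by measurable
  moreover have "(LINT x|lborel. \<phi> x * (indicator {0..} t *\<^sub>R \<rho> t x)) = indicator {0..} t *\<^sub>R mean (\<rho> t) \<phi>" for t :: real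
    by (simp add: mean_def indicator_def)
  ultimately show ?thesis by (simp add: set_borel_measurable_def)
qed

lemma flow_mean_measurable_Icc:
  assumes "\<phi> \<in> borel_measurable borel" "0 \<le> s"
  shows "(\<lambda>r. indicator {s..t} r * mean (\<rho> r) \<phi>) \<in> borel_measurable borel"
proof -
  have "(\<lambda>r. indicator {s..t} r * (indicator {0..} r *\<^sub>R mean (\<rho> r) \<phi>)) \<in> borel_measurable borel"
    using flow_mean_measurable[OF assms(1)] unfolding set_borel_measurable_def by measurable
  moreover have "indicator {s..t} r * (indicator {0..} r *\<^sub>R mean (\<rho> r) \<phi>) = indicator {s..t} r * mean (\<rho> r) \<phi>" for r
    using assms(2) by (simp add: indicator_def)
  ultimately show ?thesis by (simp only:)
qed

text \<open>Fubini on the strip \<open>{0..t} \<times> UNIV\<close>, and the difference of the weak equation at two times.\<close>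

lemma flow_rate:
  assumes f: "test_fun f" and st: "0 \<le> s" "s \<le> t"
  shows "set_integrable lborel {s..t} (\<lambda>r. flux_rate f (\<rho> r) (u r))"
    and "mean (\<rho> t) f - mean (\<rho> s) f = (LINT r:{s..t}|lborel. flux_rate f (\<rho> r) (u r))"
proof -
  have *: "set_integrable lborel {0..t} (\<lambda>r. flux_rate f (\<rho> r) (u r)) \<and>
     mean (\<rho> t) f - mean \<rho>\<^sub>0 f = (LINT r:{0..t}|lborel. flux_rate f (\<rho> r) (u r))"
    if "0 \<le> t" for t
  proof -
    let ?w = "\<lambda>(s, x). indicator ({0..t} \<times> UNIV) (s, x) *\<^sub>R (gradient f x \<bullet> (\<rho> s x *\<^sub>R u s x))"
    have i: "integrable (lborel \<Otimes>\<^sub>M lborel) ?w"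
      and e: "mean (\<rho> t) f - mean \<rho>\<^sub>0 f = integral\<^sup>L (lborel \<Otimes>\<^sub>M lborel) ?w"
      using flow f that
      by (auto simp: controlled_flow_def set_integrable_def set_lebesgue_integral_def lborel_prod
          mean_def split_beta')
    have in1: "(LINT x|lborel. ?w (s, x)) = indicator {0..t} s *\<^sub>R flux_rate f (\<rho> s) (u s)" for s
      by (simp add: flux_rate_def indicator_strip)
    show ?thesis
      using lborel_pair.integrable_fst'[OF i] lborel_pair.integral_fst'[OF i] e
      unfolding in1 by (simp add: set_integrable_def set_lebesgue_integral_def)
  qed
  have t: "0 \<le> t" using st by simp
  show i: "set_integrable lborel {s..t} (\<lambda>r. flux_rate f (\<rho> r) (u r))"
    by (rule set_integrable_subset[OF conjunct1[OF *[OF t]]]) (use st in auto)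
  have i2: "set_integrable lborel {0..<s} (\<lambda>r. flux_rate f (\<rho> r) (u r))"
    by (rule set_integrable_subset[OF conjunct1[OF *[OF t]]]) (use st in auto)
  have U: "{0..t} = {0..<s} \<union> {s..t}" using st by auto
  have "(LINT r:{0..t}|lborel. flux_rate f (\<rho> r) (u r)) =
     (LINT r:{0..<s}|lborel. flux_rate f (\<rho> r) (u r)) + (LINT r:{s..t}|lborel. flux_rate f (\<rho> r) (u r))"
    unfolding U by (rule set_integral_Un[OF _ i2 i]) auto
  moreover have "(LINT r:{0..<s}|lborel. flux_rate f (\<rho> r) (u r)) = (LINT r:{0..s}|lborel. flux_rate f (\<rho> r) (u r))"
    unfolding set_lebesgue_integral_def
  proof (rule integral_cong_AE)
    show "AE x in lborel. indicator {0..<s} x *\<^sub>R flux_rate f (\<rho> x) (u x) = indicator {0..s} x *\<^sub>R flux_rate f (\<rho> x) (u x)"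
      using AE_lborel_singleton[of s] by eventually_elim (auto simp: indicator_def)
    show "(\<lambda>x. indicator {0..<s} x *\<^sub>R flux_rate f (\<rho> x) (u x)) \<in> borel_measurable lborel"
      using i2 by (auto simp: set_integrable_def)
    show "(\<lambda>x. indicator {0..s} x *\<^sub>R flux_rate f (\<rho> x) (u x)) \<in> borel_measurable lborel"
      using *[OF st(1)] by (auto simp: set_integrable_def)
  qed
  ultimately show "mean (\<rho> t) f - mean (\<rho> s) f = (LINT r:{s..t}|lborel. flux_rate f (\<rho> r) (u r))"
    using *[OF t] *[OF st(1)] by simp
qed

end

section \<open>The excess cost and its truncations\<close>

text \<open>A bounded function that is 1-Lipschitz on the nonnegative reals, where it increases to the
  identity with \<open>n\<close>. Being a smooth fraction there, it keeps functions of the excess cost \<open>C\<^sup>1\<close>.\<close>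

definition saturate :: "nat \<Rightarrow> real \<Rightarrow> real" where
  "saturate n y = real (Suc n) * y / (real (Suc n) + y)"

lemma saturate_diff:
  assumes "0 \<le> y" "0 \<le> z"
  shows "saturate n y - saturate n z = (real (Suc n))\<^sup>2 / ((real (Suc n) + y) * (real (Suc n) + z)) * (y - z)"
proof -
  have "real (Suc n) + y > 0" "real (Suc n) + z > 0" using assms by auto
  then show ?thesis
    unfolding saturate_def by (simp add: divide_simps del: of_nat_Suc) (simp add: algebra_simps power2_eq_square)
qed

lemma saturate_slope:
  assumes "0 \<le> y" "0 \<le> z"
  shows "0 \<le> (real (Suc n))\<^sup>2 / ((real (Suc n) + y) * (real (Suc n) + z))"
    and "(real (Suc n))\<^sup>2 / ((real (Suc n) + y) * (real (Suc n) + z)) \<le> 1"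
proof -
  have p: "real (Suc n) + y > 0" "real (Suc n) + z > 0" using assms by auto
  then show "0 \<le> (real (Suc n))\<^sup>2 / ((real (Suc n) + y) * (real (Suc n) + z))" by simp
  have "(real (Suc n))\<^sup>2 \<le> (real (Suc n) + y) * (real (Suc n) + z)"
    unfolding power2_eq_square using assms by (intro mult_mono) auto
  then show "(real (Suc n))\<^sup>2 / ((real (Suc n) + y) * (real (Suc n) + z)) \<le> 1" using p by simp
qed

lemma saturate_bounds:
  assumes "0 \<le> y" shows "0 \<le> saturate n y" "saturate n y \<le> y" "saturate n y \<le> real (Suc n)"
proof -
  have p: "real (Suc n) + y > 0" using assms by auto
  show "0 \<le> saturate n y" using assms by (simp add: saturate_def)
  show "saturate n y \<le> y" "saturate n y \<le> real (Suc n)"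
    unfolding saturate_def using p assms by (auto simp: divide_simps algebra_simps simp del: of_nat_Suc)
qed

lemma saturate_lipschitz:
  assumes "0 \<le> y" "0 \<le> z" shows "\<bar>saturate n y - saturate n z\<bar> \<le> \<bar>y - z\<bar>"
  unfolding saturate_diff[OF assms] abs_mult[of _ "y - z"]
  using saturate_slope[OF assms, of n] mult_right_mono[OF _ abs_ge_zero, of _ 1 "y - z"]
  by (simp only: abs_of_nonneg mult_1_left)

lemma saturate_tendsto:
  assumes "0 \<le> y" shows "(\<lambda>n. saturate n y) \<longlonglongrightarrow> y"
proof -
  have eq: "y - y\<^sup>2 / (real (Suc n) + y) = saturate n y" for n
  proof -
    have "real (Suc n) + y > 0" using assms by auto
    then show ?thesis unfolding saturate_def by (simp add: field_simps power2_eq_square del: of_nat_Suc)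
  qed
  have "filterlim (\<lambda>n. real (Suc n) + y) at_top sequentially"
    unfolding add.commute[of _ y]
    by (intro filterlim_tendsto_add_at_top[OF tendsto_const])
      (rule filterlim_compose[OF filterlim_real_sequentially filterlim_Suc])
  from tendsto_diff[OF tendsto_const[of y] real_tendsto_divide_at_top[OF tendsto_const[of "y\<^sup>2"] this]]
  show ?thesis by (simp only: eq diff_0_right)
qed

text \<open>What flows in general require of the observation \<open>h\<close>. The growth bound makes its mean finite
  on all densities with a second moment; coercivity makes functions of low cost values compactly supported.\<close>

locale observation =
  fixes \<beta> :: real and h :: "'a::euclidean_space \<Rightarrow> real" and xbar :: 'a
  assumes \<beta>_pos: "0 < \<beta>"
    and h_C1: "C1_grad h (gradient h)"
    and h_min: "h xbar \<le> h x"
    and h_growth: "\<exists>C. \<forall>x. h x - h xbar \<le> C * (1 + (norm x)\<^sup>2)"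
    and h_coercive: "\<exists>D r. compact D \<and> 0 < r \<and> (\<forall>x. x \<notin> D \<longrightarrow> h xbar + r < h x)"
begin

definition excess :: "'a \<Rightarrow> real" where
  "excess x = h x - h xbar"

definition trunc :: "nat \<Rightarrow> 'a \<Rightarrow> real" where
  "trunc n x = saturate n (excess x)"

lemma excess_nonneg: "0 \<le> excess x"
  using h_min by (simp add: excess_def)

lemma excess_C1: "C1_grad excess (gradient h)"
  using C1_grad_diff[OF h_C1 C1_grad_const[of "h xbar"]] by (simp add: excess_def[abs_def])

lemma excess_measurable [measurable]: "excess \<in> borel_measurable borel"
  by (intro borel_measurable_continuous_onI C1_grad_continuous[OF excess_C1])

lemma h_measurable [measurable]: "h \<in> borel_measurable borel"
  by (intro borel_measurable_continuous_onI C1_grad_continuous[OF h_C1])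

lemma trunc_C1: "\<exists>T. C1_grad (trunc n) T"
proof -
  have p: "real (Suc n) + excess x > 0" for x using excess_nonneg[of x] by auto
  have "C1_grad (\<lambda>x. saturate n (excess x)) (\<lambda>x. ((real (Suc n))\<^sup>2 / (real (Suc n) + excess x)\<^sup>2) *\<^sub>R gradient h x)"
  proof (rule C1_grad_compose[OF excess_C1, where \<phi>="saturate n" and \<phi>'="\<lambda>y. (real (Suc n))\<^sup>2 / (real (Suc n) + y)\<^sup>2"])
    show "(saturate n has_real_derivative (real (Suc n))\<^sup>2 / (real (Suc n) + excess x)\<^sup>2) (at (excess x))" for x
    proof -
      have "((\<lambda>y. K * y / (K + y)) has_real_derivative K\<^sup>2 / (K + y)\<^sup>2) (at y)" if "K + y \<noteq> 0" for K y :: real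
        using that by (auto intro!: derivative_eq_intros simp: field_simps power2_eq_square)
      from this[of "real (Suc n)" "excess x"] p[of x] show ?thesis
        unfolding saturate_def[abs_def] by simp
    qed
    have "real (Suc n) + excess x \<noteq> 0" for x using p[of x] by linarith
    then show "continuous_on UNIV (\<lambda>x. (real (Suc n))\<^sup>2 / (real (Suc n) + excess x)\<^sup>2)"
      by (intro continuous_intros C1_grad_continuous[OF excess_C1]) auto
  qed
  then show ?thesis by (auto simp: trunc_def[abs_def])
qed

lemma trunc_measurable [measurable]: "trunc n \<in> borel_measurable borel"
  unfolding trunc_def[abs_def] saturate_def by measurable

lemma trunc_bounds: "0 \<le> trunc n x" "trunc n x \<le> excess x" "trunc n x \<le> real (Suc n)" "\<bar>trunc n x\<bar> \<le> real (Suc n)"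
  using saturate_bounds[OF excess_nonneg, of n x] by (auto simp: trunc_def)

lemma trunc_tendsto: "(\<lambda>n. trunc n x) \<longlonglongrightarrow> excess x"
  unfolding trunc_def by (rule saturate_tendsto[OF excess_nonneg])

text \<open>Truncation and cutoff are separate, and the limit in \<open>j\<close> comes first: only truncation alone is a
  1-Lipschitz function of the excess cost, so only after removing the cutoff are variances comparable.\<close>

definition cut_trunc :: "nat \<Rightarrow> nat \<Rightarrow> 'a \<Rightarrow> real" where
  "cut_trunc n j x = bump 0 (real (Suc j)) x * trunc n x"

lemma cut_trunc_test_fun: "test_fun (cut_trunc n j)"
proof -
  obtain T where "C1_grad (trunc n) T" using trunc_C1 by blast
  then show ?thesis unfolding cut_trunc_def[abs_def] by (intro test_fun_mult[OF test_fun_bump]) auto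
qed

lemma cut_trunc_abs: "\<bar>cut_trunc n j x\<bar> \<le> trunc n x"
  unfolding cut_trunc_def abs_mult
  using bump_le_1[of 0 "real (Suc j)" x] bump_nonneg[of 0 "real (Suc j)" x] trunc_bounds(1)[of n x]
  by (simp add: mult_left_le_one_le abs_of_nonneg del: of_nat_Suc)

lemma cut_trunc_tendsto: "(\<lambda>j. cut_trunc n j x) \<longlonglongrightarrow> trunc n x"
  using tendsto_mult[OF bump_tendsto_1[of x] tendsto_const[of "trunc n x"]]
  unfolding cut_trunc_def by (simp only: mult_1_left)

lemma cut_trunc_measurable [measurable]: "cut_trunc n j \<in> borel_measurable borel"
  by (rule test_fun_measurable(1)[OF cut_trunc_test_fun])

context
  fixes \<rho> :: "'a \<Rightarrow> real"
  assumes p: "\<rho> \<in> prob_densities"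
begin

lemma excess_integrable: "integrable lborel (\<lambda>x. excess x * \<rho> x)"
proof -
  obtain C where C: "\<And>x. excess x \<le> C * (1 + (norm x)\<^sup>2)" using h_growth by (auto simp: excess_def)
  note prob_densityD(1)[OF p, measurable]
  have "integrable lborel (\<lambda>x. C * (\<rho> x + (norm x)\<^sup>2 * \<rho> x))" using prob_densityD[OF p] by auto
  then show ?thesis
  proof (rule Bochner_Integration.integrable_bound)
    have "norm (excess x * \<rho> x) \<le> norm (C * (\<rho> x + (norm x)\<^sup>2 * \<rho> x))" for x
    proof -
      have "norm (excess x * \<rho> x) = excess x * \<rho> x"
        using excess_nonneg[of x] prob_densityD(2)[OF p, of x] by simp
      also have "\<dots> \<le> C * (\<rho> x + (norm x)\<^sup>2 * \<rho> x)"
        using mult_right_mono[OF C prob_densityD(2)[OF p]] by (simp add: algebra_simps)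
      also have "\<dots> \<le> norm (C * (\<rho> x + (norm x)\<^sup>2 * \<rho> x))" by simp
      finally show ?thesis .
    qed
    then show "AE x in lborel. norm (excess x * \<rho> x) \<le> norm (C * (\<rho> x + (norm x)\<^sup>2 * \<rho> x))" by simp
  qed measurable
qed

lemma mean_h: "mean \<rho> h = mean \<rho> excess + h xbar"
proof -
  have "(\<lambda>x. h x * \<rho> x) = (\<lambda>x. excess x * \<rho> x + h xbar * \<rho> x)" by (auto simp: excess_def algebra_simps)
  then show ?thesis using excess_integrable prob_densityD[OF p] by (simp add: mean_def)
qed

lemma h_minus_mean: "h x - mean \<rho> h = excess x - mean \<rho> excess"
  using mean_h by (simp add: excess_def)

lemma mean_excess_nonneg: "0 \<le> mean \<rho> excess"
  unfolding mean_def using excess_nonneg prob_densityD(2)[OF p] by (intro integral_nonneg_AE AE_I2) auto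

lemma trunc_integrable: "integrable lborel (\<lambda>x. trunc n x * \<rho> x)"
  by (rule integrable_bounded_times_density[OF p _ trunc_bounds(4)]) simp

lemma mean_trunc_bounds: "0 \<le> mean \<rho> (trunc n)" "mean \<rho> (trunc n) \<le> mean \<rho> excess"
proof -
  show "0 \<le> mean \<rho> (trunc n)"
    unfolding mean_def using trunc_bounds prob_densityD(2)[OF p] by (intro integral_nonneg_AE AE_I2) auto
  show "mean \<rho> (trunc n) \<le> mean \<rho> excess"
    unfolding mean_def
    by (intro integral_mono trunc_integrable excess_integrable mult_right_mono trunc_bounds prob_densityD(2)[OF p])
qed

lemma mean_trunc_tendsto: "(\<lambda>n. mean \<rho> (trunc n)) \<longlonglongrightarrow> mean \<rho> excess"
  by (rule mean_dominated_convergence[OF p _ _ trunc_tendsto excess_integrable])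
    (simp_all add: trunc_bounds)

lemma mean_cut_trunc_tendsto: "(\<lambda>j. mean \<rho> (cut_trunc n j)) \<longlonglongrightarrow> mean \<rho> (trunc n)"
  by (rule mean_dominated_convergence[OF p _ _ cut_trunc_tendsto trunc_integrable cut_trunc_abs]) auto

end

end

section \<open>The lower bound\<close>

lemma flux_rate_weighted_divergence:
  assumes "weighted_divergence \<rho> u a" "test_fun f"
  shows "flux_rate f \<rho> u = - mean \<rho> (\<lambda>x. f x * a x)"
  using assms by (simp add: weighted_divergence_def has_weak_divergence_def flux_rate_def mean_def ac_simps)

text \<open>No mass is created: tested against a bump of radius \<open>r\<close>, the flux contributes at most
  \<open>4 / r\<close> times its integral, which is finite because \<open>u\<close> is square integrable for \<open>\<rho>\<close>.\<close>

lemma mean_weighted_divergence: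
  assumes p: "\<rho> \<in> prob_densities" and wd: "weighted_divergence \<rho> u a"
    and [measurable]: "u \<in> borel_measurable borel"
    and u2: "integrable lborel (\<lambda>x. (norm (u x))\<^sup>2 * \<rho> x)"
    and a1: "integrable lborel (\<lambda>x. a x * \<rho> x)"
  shows "mean \<rho> a = 0"
proof -
  note prob_densityD(1)[OF p, measurable]
  have [measurable]: "a \<in> borel_measurable borel" using wd by (simp add: weighted_divergence_def)
  let ?b = "\<lambda>j. bump (0::'a) (real (Suc j))"
  have tb: "test_fun (?b j)" for j by (rule test_fun_bump) simp
  note test_fun_measurable[OF tb, measurable]
  have "(\<lambda>j. mean \<rho> (\<lambda>x. ?b j x * a x)) \<longlonglongrightarrow> mean \<rho> (\<lambda>x. 1 * a x)"
  proof (rule mean_dominated_convergence[OF p])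
    show "(\<lambda>j. ?b j x * a x) \<longlonglongrightarrow> 1 * a x" for x
      by (intro tendsto_mult bump_tendsto_1 tendsto_const)
    show "integrable lborel (\<lambda>x. \<bar>a x\<bar> * \<rho> x)"
      using integrable_abs[OF a1] prob_densityD(2)[OF p] by (simp add: abs_mult)
    show "\<bar>?b j x * a x\<bar> \<le> \<bar>a x\<bar>" for j x
      using bump_le_1[of 0 "real (Suc j)" x] bump_nonneg[of 0 "real (Suc j)" x]
      by (simp add: abs_mult mult_left_le_one_le del: of_nat_Suc)
  qed measurable
  moreover have "(\<lambda>j. mean \<rho> (\<lambda>x. ?b j x * a x)) \<longlonglongrightarrow> 0"
  proof (rule Lim_null_comparison)
    have iu: "integrable lborel (\<lambda>x. norm (\<rho> x *\<^sub>R u x))"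
      by (intro integrable_norm integrable_times_density_of_square[OF p] u2) simp
    have "norm (mean \<rho> (\<lambda>x. ?b j x * a x)) \<le> (4 * (LINT x|lborel. norm (\<rho> x *\<^sub>R u x))) * inverse (real (Suc j))" for j
    proof -
      have "norm (mean \<rho> (\<lambda>x. ?b j x * a x)) = norm (flux_rate (?b j) \<rho> u)"
        by (simp add: flux_rate_weighted_divergence[OF wd tb] del: of_nat_Suc)
      also have "\<dots> \<le> (LINT x|lborel. 4 / real (Suc j) * norm (\<rho> x *\<^sub>R u x))"
        unfolding flux_rate_def
      proof (rule order_trans[OF integral_norm_bound integral_mono[OF integrable_norm]])
        show le: "norm (gradient (?b j) x \<bullet> (\<rho> x *\<^sub>R u x)) \<le> 4 / real (Suc j) * norm (\<rho> x *\<^sub>R u x)" for x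
          unfolding real_norm_def C1_grad_gradient[OF C1_grad_bump]
          by (intro order_trans[OF Cauchy_Schwarz_ineq2] mult_right_mono norm_bump_grad) auto
        show i: "integrable lborel (\<lambda>x. 4 / real (Suc j) * norm (\<rho> x *\<^sub>R u x))"
          by (intro integrable_mult_right iu)
        show "integrable lborel (\<lambda>x. gradient (?b j) x \<bullet> (\<rho> x *\<^sub>R u x))"
        proof (rule Bochner_Integration.integrable_bound[OF i])
          show "AE x in lborel. norm (gradient (?b j) x \<bullet> (\<rho> x *\<^sub>R u x)) \<le> norm (4 / real (Suc j) * norm (\<rho> x *\<^sub>R u x))"
            by (intro AE_I2 order_trans[OF le]) simp
        qed measurable
      qed
      also have "\<dots> = (4 * (LINT x|lborel. norm (\<rho> x *\<^sub>R u x))) * inverse (real (Suc j))"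
        unfolding integral_mult_right_zero by (simp only: divide_inverse ac_simps)
      finally show ?thesis .
    qed
    then show "\<forall>\<^sub>F j in sequentially. norm (mean \<rho> (\<lambda>x. ?b j x * a x)) \<le>
        (4 * (LINT x|lborel. norm (\<rho> x *\<^sub>R u x))) * inverse (real (Suc j))" by simp
    show "(\<lambda>j. (4 * (LINT x|lborel. norm (\<rho> x *\<^sub>R u x))) * inverse (real (Suc j))) \<longlonglongrightarrow> 0"
      using tendsto_mult[OF tendsto_const LIMSEQ_inverse_real_of_nat] by fastforce
  qed
  ultimately show ?thesis using LIMSEQ_unique by fastforce
qed

context observation
begin

text \<open>The truncated optimality equation \<open>\<nabla>\<cdot>(\<rho> u) = \<beta> (trunc n - mean) \<rho>\<close>, tested against \<open>f\<close>;
  the mean is multiplied out so that measurability in time is evident.\<close>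

definition residual :: "('a \<Rightarrow> real) \<Rightarrow> nat \<Rightarrow> ('a \<Rightarrow> real) \<Rightarrow> ('a \<Rightarrow> 'a) \<Rightarrow> real" where
  "residual f n \<rho> u = flux_rate f \<rho> u +
     \<beta> * (mean \<rho> (\<lambda>x. f x * trunc n x) - mean \<rho> f * mean \<rho> (trunc n))"

lemma finite_LagrangianE:
  assumes p: "\<rho> \<in> prob_densities" and fin: "Lagrangian \<beta> h \<rho> u < \<infinity>"
  obtains a where "weighted_divergence \<rho> u a" "integrable lborel (\<lambda>x. (a x)\<^sup>2 * \<rho> x)"
    "integrable lborel (\<lambda>x. (excess x - mean \<rho> excess)\<^sup>2 * \<rho> x)"
    "Lagrangian \<beta> h \<rho> u = ennreal (1/2 * (LINT x|lborel. (a x)\<^sup>2 * \<rho> x) +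
       \<beta>\<^sup>2/2 * (LINT x|lborel. (excess x - mean \<rho> excess)\<^sup>2 * \<rho> x))"
proof -
  note prob_densityD(1)[OF p, measurable]
  define a where "a = (SOME a. weighted_divergence \<rho> u a)"
  have kin: "kinetic \<rho> u < \<infinity>" and obs: "(\<integral>\<^sup>+x. ennreal (\<beta>\<^sup>2/2 * \<bar>h x - mean \<rho> h\<bar>\<^sup>2 * \<rho> x) \<partial>lborel) < \<infinity>"
    using fin by (auto simp: Lagrangian_def)
  then have "\<exists>a. weighted_divergence \<rho> u a" by (auto simp: kinetic_def split: if_splits)
  then have wd: "weighted_divergence \<rho> u a" unfolding a_def by (rule someI_ex)
  then have k: "kinetic \<rho> u = (\<integral>\<^sup>+x. ennreal (1/2 * \<bar>a x\<bar>\<^sup>2 * \<rho> x) \<partial>lborel)"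
    unfolding a_def by (auto simp: kinetic_def)
  have [measurable]: "a \<in> borel_measurable borel" using wd by (simp add: weighted_divergence_def)
  have *: "integrable lborel (\<lambda>x. (\<phi> x)\<^sup>2 * \<rho> x)"
    "(\<integral>\<^sup>+x. ennreal (c * \<bar>\<phi> x\<bar>\<^sup>2 * \<rho> x) \<partial>lborel) = ennreal (c * (LINT x|lborel. (\<phi> x)\<^sup>2 * \<rho> x))"
    if [measurable]: "\<phi> \<in> borel_measurable borel" and c: "c > 0"
      and f: "(\<integral>\<^sup>+x. ennreal (c * \<bar>\<phi> x\<bar>\<^sup>2 * \<rho> x) \<partial>lborel) < \<infinity>" for \<phi> and c :: real
  proof -
    have i: "integrable lborel (\<lambda>x. c * \<bar>\<phi> x\<bar>\<^sup>2 * \<rho> x)"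
      using f c prob_densityD(2)[OF p] by (intro integrableI_nonneg) (auto intro!: AE_I2)
    then have "integrable lborel (\<lambda>x. inverse c * (c * \<bar>\<phi> x\<bar>\<^sup>2 * \<rho> x))" by (rule integrable_mult_right)
    then show "integrable lborel (\<lambda>x. (\<phi> x)\<^sup>2 * \<rho> x)" using c by (simp add: mult.assoc[symmetric])
    show "(\<integral>\<^sup>+x. ennreal (c * \<bar>\<phi> x\<bar>\<^sup>2 * \<rho> x) \<partial>lborel) = ennreal (c * (LINT x|lborel. (\<phi> x)\<^sup>2 * \<rho> x))"
      using c prob_densityD(2)[OF p] by (subst nn_integral_eq_integral[OF i]) (auto simp: mult.assoc)
  qed
  show thesis
  proof
    note o = obs[unfolded h_minus_mean[OF p]]
    have b: "\<beta>\<^sup>2/2 > 0" using \<beta>_pos by simp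
    show "weighted_divergence \<rho> u a" by (rule wd)
    show "integrable lborel (\<lambda>x. (a x)\<^sup>2 * \<rho> x)" using *(1)[of a "1/2"] kin k by auto
    show "integrable lborel (\<lambda>x. (excess x - mean \<rho> excess)\<^sup>2 * \<rho> x)"
      by (rule *(1)[OF _ b o]) measurable
    have pos: "0 \<le> (LINT x|lborel. (\<phi> x)\<^sup>2 * \<rho> x)" for \<phi>
      using prob_densityD(2)[OF p] by (intro integral_nonneg_AE AE_I2) auto
    have "kinetic \<rho> u = ennreal (1/2 * (LINT x|lborel. (a x)\<^sup>2 * \<rho> x))"
      using *(2)[of a "1/2"] kin k by auto
    moreover have "(\<integral>\<^sup>+x. ennreal (\<beta>\<^sup>2/2 * \<bar>h x - mean \<rho> h\<bar>\<^sup>2 * \<rho> x) \<partial>lborel) =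
        ennreal (\<beta>\<^sup>2/2 * (LINT x|lborel. (excess x - mean \<rho> excess)\<^sup>2 * \<rho> x))"
      unfolding h_minus_mean[OF p] by (rule *(2)[OF _ b o]) measurable
    ultimately show "Lagrangian \<beta> h \<rho> u = ennreal (1/2 * (LINT x|lborel. (a x)\<^sup>2 * \<rho> x) +
       \<beta>\<^sup>2/2 * (LINT x|lborel. (excess x - mean \<rho> excess)\<^sup>2 * \<rho> x))"
      using pos[of a] pos[of "\<lambda>x. excess x - mean \<rho> excess"] by (simp add: Lagrangian_def ennreal_plus)
  qed
qed

text \<open>Completing the square at a fixed time: with \<open>a\<close> the weighted divergence,
  \<open>\<integral> (a - \<beta> (trunc n - mean))\<^sup>2 \<rho>\<close> is at most twice the Lagrangian minus \<open>2 \<beta>\<close> times the rate at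
  which the mean of the truncated cost decreases, because truncation is 1-Lipschitz in the cost and
  hence does not raise its variance. By Cauchy-Schwarz, \<open>c\<^sup>2\<close> times this integral bounds the square of the
  residual. The last bound is what will dominate the rates \<open>flux_rate (cut_trunc n j)\<close> in time,
  uniformly in \<open>j\<close>.\<close>

lemma Lagrangian_lower_bound:
  assumes p: "\<rho> \<in> prob_densities" and um[measurable]: "u \<in> borel_measurable borel"
    and u2: "integrable lborel (\<lambda>x. (norm (u x))\<^sup>2 * \<rho> x)"
    and f: "test_fun f" "\<And>x. \<bar>f x\<bar> \<le> c" "0 < c"
    and fin: "Lagrangian \<beta> h \<rho> u < \<infinity>"
  obtains G where "(\<lambda>j. flux_rate (cut_trunc n j) \<rho> u) \<longlonglongrightarrow> G"
    "ennreal ((residual f n \<rho> u)\<^sup>2 / (2 * c\<^sup>2) - \<beta> * G) \<le> Lagrangian \<beta> h \<rho> u"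
    "\<And>j. ennreal ((flux_rate (cut_trunc n j) \<rho> u)\<^sup>2 / (2 * (real (Suc n))\<^sup>2)) \<le> Lagrangian \<beta> h \<rho> u"
proof -
  note prob_densityD(1)[OF p, measurable] test_fun_measurable[OF f(1), measurable]
  note rho_nn = prob_densityD(2)[OF p]
  obtain a where wd: "weighted_divergence \<rho> u a" and a2: "integrable lborel (\<lambda>x. (a x)\<^sup>2 * \<rho> x)"
    and v: "integrable lborel (\<lambda>x. (excess x - mean \<rho> excess)\<^sup>2 * \<rho> x)"
    and L: "Lagrangian \<beta> h \<rho> u = ennreal (1/2 * (LINT x|lborel. (a x)\<^sup>2 * \<rho> x) +
       \<beta>\<^sup>2/2 * (LINT x|lborel. (excess x - mean \<rho> excess)\<^sup>2 * \<rho> x))"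
    by (rule finite_LagrangianE[OF p fin])
  define A where "A = (LINT x|lborel. (a x)\<^sup>2 * \<rho> x)"
  define W where "W = (LINT x|lborel. (excess x - mean \<rho> excess)\<^sup>2 * \<rho> x)"
  have W0: "0 \<le> W" unfolding W_def using rho_nn by (intro integral_nonneg_AE AE_I2) auto
  have am[measurable]: "a \<in> borel_measurable borel" using wd by (simp add: weighted_divergence_def)
  have a1: "integrable lborel (\<lambda>x. a x * \<rho> x)"
    using integrable_times_density_of_square[OF p am] a2 by (simp add: mult.commute)
  have a0: "mean \<rho> a = 0" by (rule mean_weighted_divergence[OF p wd um u2 a1])
  have bm: "integrable lborel (\<lambda>x. (\<phi> x * \<psi> x) * \<rho> x)"
    if [measurable]: "\<phi> \<in> borel_measurable borel" and i: "integrable lborel (\<lambda>x. \<psi> x * \<rho> x)"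
      and c: "\<And>x. \<bar>\<phi> x\<bar> \<le> c" for \<phi> \<psi> :: "'a \<Rightarrow> real" and c
  proof (rule Bochner_Integration.integrable_bound[OF integrable_mult_right[OF i, of c]])
    have "(\<lambda>x. \<phi> x * (\<psi> x * \<rho> x)) \<in> borel_measurable lborel" using i by auto
    then show "(\<lambda>x. (\<phi> x * \<psi> x) * \<rho> x) \<in> borel_measurable lborel" by (simp add: mult.assoc)
    have "\<bar>\<phi> x\<bar> \<le> \<bar>c\<bar>" for x using c[of x] by simp
    then show "AE x in lborel. norm ((\<phi> x * \<psi> x) * \<rho> x) \<le> norm (c * (\<psi> x * \<rho> x))"
      by (auto simp: abs_mult mult.assoc intro!: AE_I2 mult_right_mono)
  qed
  \<comment> \<open>Centring \<open>trunc n\<close> is free, as \<open>a\<close> has mean zero.\<close>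
  define m where "m = mean \<rho> (trunc n)"
  define \<tau> where "\<tau> x = trunc n x - m" for x
  have [measurable]: "\<tau> \<in> borel_measurable borel" by (simp add: \<tau>_def[abs_def])
  define K where "K = real (Suc n) + \<bar>m\<bar>"
  have \<tau>b: "\<bar>\<tau> x\<bar> \<le> K" for x
    using trunc_bounds(4)[of n x] unfolding \<tau>_def K_def by linarith
  have \<tau>1: "integrable lborel (\<lambda>x. \<tau> x * \<rho> x)"
    by (rule integrable_bounded_times_density[OF p _ \<tau>b]) simp
  have \<tau>2: "integrable lborel (\<lambda>x. (\<tau> x)\<^sup>2 * \<rho> x)"
    using bm[OF _ \<tau>1 \<tau>b] by (simp add: power2_eq_square)
  have a\<tau>: "integrable lborel (\<lambda>x. (\<tau> x * a x) * \<rho> x)" by (rule bm[OF _ a1 \<tau>b]) simp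
  have at: "integrable lborel (\<lambda>x. (trunc n x * a x) * \<rho> x)" by (rule bm[OF _ a1 trunc_bounds(4)]) simp
  have \<tau>W: "(LINT x|lborel. (\<tau> x)\<^sup>2 * \<rho> x) \<le> W"
  proof -
    let ?c = "saturate n (mean \<rho> excess)"
    have t2: "integrable lborel (\<lambda>x. (trunc n x)\<^sup>2 * \<rho> x)"
      using bm[OF _ trunc_integrable[OF p] trunc_bounds(4)] by (simp add: power2_eq_square)
    have "(LINT x|lborel. (\<tau> x)\<^sup>2 * \<rho> x) \<le> (LINT x|lborel. (trunc n x - ?c)\<^sup>2 * \<rho> x)"
      unfolding \<tau>_def m_def by (rule variance_le[OF p _ t2]) simp
    also have "\<dots> \<le> W"
      unfolding W_def
    proof (rule integral_mono)
      show "integrable lborel (\<lambda>x. (trunc n x - ?c)\<^sup>2 * \<rho> x)"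
        by (rule integrable_square_shift[OF p _ t2]) simp
      have "\<bar>trunc n x - ?c\<bar> \<le> \<bar>excess x - mean \<rho> excess\<bar>" for x
        unfolding trunc_def by (rule saturate_lipschitz[OF excess_nonneg mean_excess_nonneg[OF p]])
      then have "(trunc n x - ?c)\<^sup>2 \<le> (excess x - mean \<rho> excess)\<^sup>2" for x by (simp add: abs_le_square_iff)
      then show "(trunc n x - ?c)\<^sup>2 * \<rho> x \<le> (excess x - mean \<rho> excess)\<^sup>2 * \<rho> x" for x
        by (rule mult_right_mono[OF _ rho_nn])
    qed (rule v)
    finally show ?thesis .
  qed
  define B where "B = mean \<rho> (\<lambda>x. trunc n x * a x)"
  have B: "(LINT x|lborel. (\<tau> x * a x) * \<rho> x) = B"
  proof -
    have "(\<tau> x * a x) * \<rho> x = (trunc n x * a x) * \<rho> x - m * (a x * \<rho> x)" for x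
      by (simp add: \<tau>_def algebra_simps)
    then show ?thesis using at a1 a0 by (simp add: B_def mean_def)
  qed
  let ?\<psi> = "\<lambda>x. a x - \<beta> * \<tau> x"
  have \<psi>: "(?\<psi> x)\<^sup>2 * \<rho> x = (a x)\<^sup>2 * \<rho> x - 2 * \<beta> * ((\<tau> x * a x) * \<rho> x) + \<beta>\<^sup>2 * ((\<tau> x)\<^sup>2 * \<rho> x)" for x
    by (simp add: power2_eq_square algebra_simps)
  have \<psi>2: "integrable lborel (\<lambda>x. (?\<psi> x)\<^sup>2 * \<rho> x)" unfolding \<psi> using a2 a\<tau> \<tau>2 by auto
  have "(LINT x|lborel. (?\<psi> x)\<^sup>2 * \<rho> x) = A - 2 * \<beta> * B + \<beta>\<^sup>2 * (LINT x|lborel. (\<tau> x)\<^sup>2 * \<rho> x)"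
    unfolding \<psi> using a2 a\<tau> \<tau>2 by (simp add: A_def B)
  also have "\<dots> \<le> A - 2 * \<beta> * B + \<beta>\<^sup>2 * W" using \<tau>W by (simp add: mult_left_mono)
  finally have \<psi>W: "(LINT x|lborel. (?\<psi> x)\<^sup>2 * \<rho> x) \<le> A - 2 * \<beta> * B + \<beta>\<^sup>2 * W" .
  have fa: "integrable lborel (\<lambda>x. (f x * a x) * \<rho> x)" by (rule bm[OF _ a1 f(2)]) simp
  have f\<tau>: "integrable lborel (\<lambda>x. (f x * \<tau> x) * \<rho> x)" by (rule bm[OF _ \<tau>1 f(2)]) simp
  have f1: "integrable lborel (\<lambda>x. f x * \<rho> x)" by (rule integrable_bounded_times_density[OF p _ f(2)]) simp
  have ft: "integrable lborel (\<lambda>x. (f x * trunc n x) * \<rho> x)"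
    by (rule bm[OF _ trunc_integrable[OF p] f(2)]) simp
  have R: "residual f n \<rho> u = - mean \<rho> (\<lambda>x. f x * ?\<psi> x)"
  proof -
    have "(f x * ?\<psi> x) * \<rho> x = (f x * a x) * \<rho> x - \<beta> * ((f x * trunc n x) * \<rho> x - m * (f x * \<rho> x))" for x
      by (simp add: \<tau>_def algebra_simps)
    then have "mean \<rho> (\<lambda>x. f x * ?\<psi> x) = mean \<rho> (\<lambda>x. f x * a x) -
        \<beta> * (mean \<rho> (\<lambda>x. f x * trunc n x) - m * mean \<rho> f)"
      using fa ft f1 by (simp add: mean_def)
    then show ?thesis
      by (simp add: residual_def flux_rate_weighted_divergence[OF wd f(1)] m_def mult.commute)
  qed
  have sq: "(mean \<rho> (\<lambda>x. \<phi> x * \<psi> x))\<^sup>2 \<le> d\<^sup>2 * (LINT x|lborel. (\<psi> x)\<^sup>2 * \<rho> x)"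
    if [measurable]: "\<phi> \<in> borel_measurable borel" "\<psi> \<in> borel_measurable borel"
      and \<psi>2: "integrable lborel (\<lambda>x. (\<psi> x)\<^sup>2 * \<rho> x)"
      and d: "\<And>x. \<bar>\<phi> x\<bar> \<le> d" for \<phi> \<psi> :: "'a \<Rightarrow> real" and d
  proof -
    have d2: "(\<phi> x)\<^sup>2 \<le> d\<^sup>2" for x using d[of x] by (simp add: abs_le_square_iff[symmetric])
    have "integrable lborel (\<lambda>x. ((\<phi> x)\<^sup>2 * (\<psi> x)\<^sup>2) * \<rho> x)"
      by (rule bm[OF _ \<psi>2, where c="d\<^sup>2"]) (use d2 in auto)
    then have i: "integrable lborel (\<lambda>x. (\<phi> x * \<psi> x)\<^sup>2 * \<rho> x)" by (simp add: power_mult_distrib)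
    have "(mean \<rho> (\<lambda>x. \<phi> x * \<psi> x))\<^sup>2 \<le> (LINT x|lborel. (\<phi> x * \<psi> x)\<^sup>2 * \<rho> x)"
      by (rule mean_square_le[OF p _ i]) simp
    also have "\<dots> \<le> (LINT x|lborel. d\<^sup>2 * ((\<psi> x)\<^sup>2 * \<rho> x))"
      using i \<psi>2 d2 rho_nn by (intro integral_mono) (auto simp: power_mult_distrib mult.assoc intro!: mult_right_mono)
    finally show ?thesis by simp
  qed
  show thesis
  proof
    have "(\<lambda>j. mean \<rho> (\<lambda>x. cut_trunc n j x * a x)) \<longlonglongrightarrow> B"
      unfolding B_def
    proof (rule mean_dominated_convergence[OF p])
      show "(\<lambda>j. cut_trunc n j x * a x) \<longlonglongrightarrow> trunc n x * a x" for x
        by (intro tendsto_mult cut_trunc_tendsto tendsto_const)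
      show "integrable lborel (\<lambda>x. \<bar>trunc n x * a x\<bar> * \<rho> x)"
        using integrable_abs[OF at] rho_nn by (simp add: abs_mult)
      show "\<bar>cut_trunc n j x * a x\<bar> \<le> \<bar>trunc n x * a x\<bar>" for j x
        unfolding abs_mult by (intro mult_right_mono order_trans[OF cut_trunc_abs]) auto
    qed measurable
    then show "(\<lambda>j. flux_rate (cut_trunc n j) \<rho> u) \<longlonglongrightarrow> - B"
      unfolding flux_rate_weighted_divergence[OF wd cut_trunc_test_fun] by (rule tendsto_minus)
    have "(residual f n \<rho> u)\<^sup>2 \<le> c\<^sup>2 * (A - 2 * \<beta> * B + \<beta>\<^sup>2 * W)"
      unfolding R power2_minus
      by (rule order_trans[OF sq[OF _ _ \<psi>2 f(2)] mult_left_mono[OF \<psi>W]]) auto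
    then have "(residual f n \<rho> u)\<^sup>2 / (2 * c\<^sup>2) \<le> (A - 2 * \<beta> * B + \<beta>\<^sup>2 * W) / 2"
      using f(3) by (simp add: field_simps)
    then have "(residual f n \<rho> u)\<^sup>2 / (2 * c\<^sup>2) - \<beta> * - B \<le> 1/2 * A + \<beta>\<^sup>2 / 2 * W" by (simp add: field_simps)
    then show "ennreal ((residual f n \<rho> u)\<^sup>2 / (2 * c\<^sup>2) - \<beta> * - B) \<le> Lagrangian \<beta> h \<rho> u"
      unfolding L A_def[symmetric] W_def[symmetric] by (rule ennreal_leI)
    fix j
    have "\<bar>cut_trunc n j x\<bar> \<le> real (Suc n)" for x using cut_trunc_abs[of n j x] trunc_bounds(3)[of n x] by linarith
    then have "(flux_rate (cut_trunc n j) \<rho> u)\<^sup>2 \<le> (real (Suc n))\<^sup>2 * A"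
      unfolding flux_rate_weighted_divergence[OF wd cut_trunc_test_fun] power2_minus A_def
      by (intro sq a2) auto
    then have "(flux_rate (cut_trunc n j) \<rho> u)\<^sup>2 / (2 * (real (Suc n))\<^sup>2) \<le> A / 2"
      by (simp add: field_simps del: of_nat_Suc)
    also have "\<dots> \<le> 1/2 * A + \<beta>\<^sup>2 / 2 * W" using W0 by simp
    finally show "ennreal ((flux_rate (cut_trunc n j) \<rho> u)\<^sup>2 / (2 * (real (Suc n))\<^sup>2)) \<le> Lagrangian \<beta> h \<rho> u"
      unfolding L A_def[symmetric] W_def[symmetric] by (rule ennreal_leI)
  qed
qed

end

context observation
begin

text \<open>No measurability in time is known for the Lagrangian, whose kinetic part is defined pointwise,
  so every comparison with its (lower) integral goes through a measurable minorant.\<close>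

lemma flow_lower_bound:
  assumes flow: "controlled_flow \<rho>\<^sub>0 \<rho> u" and T: "0 \<le> T"
    and fin: "(\<integral>\<^sup>+t\<in>{0..T}. Lagrangian \<beta> h (\<rho> t) (u t) \<partial>lborel) < \<infinity>"
    and f: "test_fun f" "\<And>x. \<bar>f x\<bar> \<le> c" "0 < c"
  shows "set_integrable lborel {0..T} (\<lambda>s. (residual f n (\<rho> s) (u s))\<^sup>2)"
    and "(LINT s:{0..T}|lborel. (residual f n (\<rho> s) (u s))\<^sup>2) / (2 * c\<^sup>2) +
      \<beta> * (mean \<rho>\<^sub>0 (trunc n) - mean (\<rho> T) (trunc n))
      \<le> enn2real (\<integral>\<^sup>+t\<in>{0..T}. Lagrangian \<beta> h (\<rho> t) (u t) \<partial>lborel)"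
proof -
  note P = flow_density[OF flow]
  let ?I = "indicator {0..T} :: real \<Rightarrow> real"
  let ?L = "\<lambda>s. Lagrangian \<beta> h (\<rho> s) (u s) * indicator {0..T} s"
  let ?k = "real (Suc n)"
  define w where "w j s = ?I s * flux_rate (cut_trunc n j) (\<rho> s) (u s)" for j s
  have wi: "integrable lborel (w j)" for j
    using flow_rate(1)[OF flow cut_trunc_test_fun _ T] by (simp add: set_integrable_def w_def[abs_def])
  then have [measurable]: "w j \<in> borel_measurable borel" for j using borel_measurable_integrable by force
  define R where "R s = ?I s * residual f n (\<rho> s) (u s)" for s
  note mm = flow_mean_measurable_Icc[OF flow _ order_refl, of _ T]
  note test_fun_measurable(1)[OF f(1), measurable]
  have Rm[measurable]: "R \<in> borel_measurable borel"
  proof -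
    have [measurable]: "(\<lambda>s. ?I s * flux_rate f (\<rho> s) (u s)) \<in> borel_measurable borel"
      using flow_rate(1)[OF flow f(1) _ T] borel_measurable_integrable by (force simp: set_integrable_def)
    have eq: "R = (\<lambda>s. ?I s * flux_rate f (\<rho> s) (u s) + \<beta> * (?I s * mean (\<rho> s) (\<lambda>x. f x * trunc n x) -
        (?I s * mean (\<rho> s) f) * (?I s * mean (\<rho> s) (trunc n))))"
      by (rule ext) (simp add: R_def residual_def indicator_def)
    note mm[measurable]
    show ?thesis unfolding eq by measurable
  qed
  have low: "(\<exists>G. (\<lambda>j. w j s) \<longlonglongrightarrow> G \<and> ennreal ((R s)\<^sup>2 / (2 * c\<^sup>2) - \<beta> * G) \<le> ?L s) \<and>
       (\<forall>j. ennreal ((w j s)\<^sup>2 / (2 * ?k\<^sup>2)) \<le> ?L s) \<or> ?L s = \<infinity>" for s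
  proof (cases "s \<in> {0..T}")
    case True
    then have s: "0 \<le> s" by simp
    show ?thesis
    proof (cases "Lagrangian \<beta> h (\<rho> s) (u s) < \<infinity>")
      case fin: True
      obtain G where "(\<lambda>j. flux_rate (cut_trunc n j) (\<rho> s) (u s)) \<longlonglongrightarrow> G"
        "ennreal ((residual f n (\<rho> s) (u s))\<^sup>2 / (2 * c\<^sup>2) - \<beta> * G) \<le> Lagrangian \<beta> h (\<rho> s) (u s)"
        "\<And>j. ennreal ((flux_rate (cut_trunc n j) (\<rho> s) (u s))\<^sup>2 / (2 * ?k\<^sup>2)) \<le> Lagrangian \<beta> h (\<rho> s) (u s)"
        using Lagrangian_lower_bound[OF P[OF s] flow_control_measurable[OF flow s]
            flow_square_integrable[OF flow s] f fin, of n] by blast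
      then show ?thesis using True by (auto simp: w_def R_def)
    next
      case False
      then show ?thesis using True by (simp add: less_top[symmetric])
    qed
  next
    case False
    then show ?thesis by (auto simp: w_def R_def intro!: exI[of _ 0])
  qed
  \<comment> \<open>A measurable minorant of the Lagrangian that dominates all the rates \<open>w j\<close>.\<close>
  define N where "N s = (SUP j. ennreal ((w j s)\<^sup>2 / (2 * ?k\<^sup>2)))" for s
  have [measurable]: "N \<in> borel_measurable borel" unfolding N_def[abs_def] by measurable
  have "N s \<le> ?L s" for s
    using low[of s] unfolding N_def by (auto intro: SUP_least)
  then have "(\<integral>\<^sup>+s. N s \<partial>lborel) \<le> (\<integral>\<^sup>+s. ?L s \<partial>lborel)" by (intro nn_integral_mono)
  then have Nfin: "(\<integral>\<^sup>+s. N s \<partial>lborel) < \<infinity>" using fin by (rule order.strict_trans1)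
  then have NAE: "AE s in lborel. N s \<noteq> \<infinity>" by (intro nn_integral_PInf_AE) auto
  \<comment> \<open>The rates converge wherever the Lagrangian is finite; the exceptional set is measurable, and
    \<open>\<infinity>\<close> times its indicator is a minorant of the Lagrangian.\<close>
  have conv: "AE s in lborel. Cauchy (\<lambda>j. w j s)"
  proof -
    define S where "S = {s. \<not> Cauchy (\<lambda>j. w j s)}"
    have "{s \<in> space borel. Cauchy (\<lambda>j. w j s)} \<in> sets borel" by (rule sets_Collect_Cauchy) simp
    then have "space borel - {s \<in> space borel. Cauchy (\<lambda>j. w j s)} \<in> sets borel" by (rule sets.compl_sets)
    moreover have "S = space borel - {s \<in> space borel. Cauchy (\<lambda>j. w j s)}" by (auto simp: S_def)
    ultimately have S: "S \<in> sets lborel" by simp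
    have le: "\<infinity> * indicator S s \<le> ?L s" for s
    proof (cases "s \<in> S")
      case True
      then have "?L s = \<infinity>" using low[of s] convergent_Cauchy[of "\<lambda>j. w j s"] by (auto simp: S_def convergent_def)
      then show ?thesis by simp
    qed simp
    have "\<infinity> * emeasure lborel S = (\<integral>\<^sup>+s. \<infinity> * indicator S s \<partial>lborel)"
      using S by (subst nn_integral_cmult) auto
    also have "\<dots> \<le> (\<integral>\<^sup>+s. ?L s \<partial>lborel)" by (intro nn_integral_mono le)
    also have "\<dots> < \<infinity>" by (rule fin)
    finally have "emeasure lborel S = 0" by (auto simp: ennreal_mult_less_top)
    then show ?thesis using S by (intro AE_I[of _ _ S]) (auto simp: S_def)
  qed
  define G where "G s = lim (\<lambda>j. w j s)" for s
  have [measurable]: "G \<in> borel_measurable borel" unfolding G_def[abs_def] by measurable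
  have wG: "AE s in lborel. (\<lambda>j. w j s) \<longlonglongrightarrow> G s"
    using conv by eventually_elim (simp add: G_def Cauchy_convergent_iff convergent_LIMSEQ_iff)
  let ?D = "\<lambda>s. ?I s + 2 * ?k\<^sup>2 * enn2real (N s)"
  have Di: "integrable lborel ?D"
  proof -
    have "integrable lborel ?I" using T by (intro integrable_real_indicator) auto
    moreover have "integrable lborel (\<lambda>s. enn2real (N s))"
    proof (rule integrableI_nonneg)
      have "(\<integral>\<^sup>+s. ennreal (enn2real (N s)) \<partial>lborel) \<le> (\<integral>\<^sup>+s. N s \<partial>lborel)"
        by (intro nn_integral_mono) (simp add: ennreal_enn2real_if)
      then show "(\<integral>\<^sup>+s. ennreal (enn2real (N s)) \<partial>lborel) < \<infinity>" using Nfin by (rule order.strict_trans1)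
    qed auto
    ultimately show ?thesis by (intro Bochner_Integration.integrable_add integrable_mult_right)
  qed
  have wD: "AE s in lborel. norm (w j s) \<le> ?D s" for j
    using NAE
  proof eventually_elim
    case (elim s)
    have "ennreal ((w j s)\<^sup>2 / (2 * ?k\<^sup>2)) \<le> N s" unfolding N_def by (rule SUP_upper) simp
    then have "(w j s)\<^sup>2 / (2 * ?k\<^sup>2) \<le> enn2real (N s)"
      using elim by (metis enn2real_ennreal enn2real_mono infinity_ennreal_def top.not_eq_extremum
          zero_le_divide_iff zero_le_power2 mult_nonneg_nonneg zero_le_numeral)
    then have "(w j s)\<^sup>2 \<le> 2 * ?k\<^sup>2 * enn2real (N s)" by (simp add: field_simps del: of_nat_Suc)
    moreover have "\<bar>w j s\<bar> \<le> ?I s + (w j s)\<^sup>2"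
    proof (cases "s \<in> {0..T}")
      case True
      have "0 \<le> (\<bar>w j s\<bar> - 1)\<^sup>2" by simp
      then have "2 * \<bar>w j s\<bar> \<le> 1 + (w j s)\<^sup>2" by (simp add: power2_diff)
      then show ?thesis using True abs_ge_zero[of "w j s"] by (simp del: abs_ge_zero)
    qed (simp add: w_def)
    ultimately show ?case by simp
  qed
  have Gi: "integrable lborel G"
    by (rule integrable_dominated_convergence[OF _ _ Di wG wD]) measurable
  have "(\<lambda>j. LINT s|lborel. w j s) \<longlonglongrightarrow> (LINT s|lborel. G s)"
    by (rule integral_dominated_convergence[OF _ _ Di wG wD]) measurable
  moreover have "(LINT s|lborel. w j s) = mean (\<rho> T) (cut_trunc n j) - mean \<rho>\<^sub>0 (cut_trunc n j)" for j
    using flow_rate(2)[OF flow cut_trunc_test_fun order_refl T, of n j]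
    by (simp add: w_def[abs_def] set_lebesgue_integral_def flow_0[OF flow])
  moreover have "(\<lambda>j. mean (\<rho> T) (cut_trunc n j) - mean \<rho>\<^sub>0 (cut_trunc n j)) \<longlonglongrightarrow>
      mean (\<rho> T) (trunc n) - mean \<rho>\<^sub>0 (trunc n)"
    using P[OF T] P[of 0] by (intro tendsto_diff mean_cut_trunc_tendsto) (auto simp: flow_0[OF flow])
  ultimately have intG: "(LINT s|lborel. G s) = mean (\<rho> T) (trunc n) - mean \<rho>\<^sub>0 (trunc n)"
    using LIMSEQ_unique by force
  define \<phi> where "\<phi> s = (R s)\<^sup>2 / (2 * c\<^sup>2) - \<beta> * G s" for s
  have [measurable]: "\<phi> \<in> borel_measurable borel" unfolding \<phi>_def[abs_def] by measurable
  have "AE s in lborel. ennreal (\<phi> s) \<le> ?L s"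
    using wG
  proof eventually_elim
    case (elim s)
    show ?case using low[of s] LIMSEQ_unique[OF elim] by (auto simp: \<phi>_def)
  qed
  then have \<phi>le: "(\<integral>\<^sup>+s. ennreal (\<phi> s) \<partial>lborel) \<le> (\<integral>\<^sup>+s. ?L s \<partial>lborel)" by (rule nn_integral_mono_AE)
  then have \<phi>fin: "(\<integral>\<^sup>+s. ennreal (\<phi> s) \<partial>lborel) < \<infinity>" using fin by (rule order.strict_trans1)
  have R2: "integrable lborel (\<lambda>s. (R s)\<^sup>2 / (2 * c\<^sup>2))"
  proof (rule integrableI_nonneg)
    have "(\<integral>\<^sup>+s. ennreal ((R s)\<^sup>2 / (2 * c\<^sup>2)) \<partial>lborel) \<le> (\<integral>\<^sup>+s. ennreal (\<phi> s) + ennreal (norm (\<beta> * G s)) \<partial>lborel)"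
    proof (intro nn_integral_mono)
      fix s
      have "(R s)\<^sup>2 / (2 * c\<^sup>2) \<le> max 0 (\<phi> s) + norm (\<beta> * G s)" by (auto simp: \<phi>_def)
      then have "ennreal ((R s)\<^sup>2 / (2 * c\<^sup>2)) \<le> ennreal (max 0 (\<phi> s) + norm (\<beta> * G s))" by (rule ennreal_leI)
      also have "\<dots> = ennreal (max 0 (\<phi> s)) + ennreal (norm (\<beta> * G s))" by (rule ennreal_plus) auto
      also have "ennreal (max 0 (\<phi> s)) = ennreal (\<phi> s)" by (simp add: ennreal_neg max_def)
      finally show "ennreal ((R s)\<^sup>2 / (2 * c\<^sup>2)) \<le> ennreal (\<phi> s) + ennreal (norm (\<beta> * G s))" .
    qed
    also have "\<dots> = (\<integral>\<^sup>+s. ennreal (\<phi> s) \<partial>lborel) + (\<integral>\<^sup>+s. ennreal (norm (\<beta> * G s)) \<partial>lborel)"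
      by (rule nn_integral_add) auto
    also have "(\<integral>\<^sup>+s. ennreal (norm (\<beta> * G s)) \<partial>lborel) < \<infinity>"
      using integrable_mult_right[OF Gi, of \<beta>] by (simp only: integrable_iff_bounded)
    then have "(\<integral>\<^sup>+s. ennreal (\<phi> s) \<partial>lborel) + (\<integral>\<^sup>+s. ennreal (norm (\<beta> * G s)) \<partial>lborel) < \<infinity>"
      using \<phi>fin by simp
    finally show "(\<integral>\<^sup>+s. ennreal ((R s)\<^sup>2 / (2 * c\<^sup>2)) \<partial>lborel) < \<infinity>" .
  qed auto
  have "integrable lborel (\<lambda>s. (2 * c\<^sup>2) * ((R s)\<^sup>2 / (2 * c\<^sup>2)))" by (rule integrable_mult_right[OF R2])
  then have "integrable lborel (\<lambda>s. (R s)\<^sup>2)" using f(3) by simp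
  moreover have RI: "(R s)\<^sup>2 = ?I s * (residual f n (\<rho> s) (u s))\<^sup>2" for s by (simp add: R_def indicator_def)
  ultimately show "set_integrable lborel {0..T} (\<lambda>s. (residual f n (\<rho> s) (u s))\<^sup>2)"
    by (simp add: set_integrable_def)
  have \<phi>i: "integrable lborel \<phi>" unfolding \<phi>_def[abs_def] using R2 Gi by auto
  have "(LINT s|lborel. \<phi> s) \<le> enn2real (\<integral>\<^sup>+s. ennreal (\<phi> s) \<partial>lborel)"
    by (simp add: real_lebesgue_integral_def[OF \<phi>i])
  also have "\<dots> \<le> enn2real (\<integral>\<^sup>+s. ?L s \<partial>lborel)" using \<phi>le fin by (intro enn2real_mono) auto
  finally have "(LINT s|lborel. \<phi> s) \<le> enn2real (\<integral>\<^sup>+s. ?L s \<partial>lborel)" .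
  moreover have "(LINT s|lborel. \<phi> s) = (LINT s|lborel. (R s)\<^sup>2) / (2 * c\<^sup>2) - \<beta> * (LINT s|lborel. G s)"
    unfolding \<phi>_def[abs_def] using R2 Gi by simp
  moreover have "(LINT s|lborel. (R s)\<^sup>2) = (LINT s:{0..T}|lborel. (residual f n (\<rho> s) (u s))\<^sup>2)"
    by (simp add: RI set_lebesgue_integral_def)
  ultimately show "(LINT s:{0..T}|lborel. (residual f n (\<rho> s) (u s))\<^sup>2) / (2 * c\<^sup>2) +
      \<beta> * (mean \<rho>\<^sub>0 (trunc n) - mean (\<rho> T) (trunc n))
      \<le> enn2real (\<integral>\<^sup>+t\<in>{0..T}. Lagrangian \<beta> h (\<rho> t) (u t) \<partial>lborel)"
    by (simp add: intG algebra_simps)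
qed

lemma cost_restrict_le: "(\<integral>\<^sup>+t\<in>{0..T}. Lagrangian \<beta> h (\<rho> t) (u t) \<partial>lborel) \<le> cost \<beta> h \<rho> u"
  unfolding cost_def by (intro nn_integral_mono) (auto simp: indicator_def)

lemma admissible_mean_excess_tendsto:
  assumes "admissible h xbar \<rho>\<^sub>0 \<rho> u"
  shows "((\<lambda>t. mean (\<rho> t) excess) \<longlongrightarrow> 0) at_top"
proof -
  have "((\<lambda>t. mean (\<rho> t) h - h xbar) \<longlongrightarrow> h xbar - h xbar) at_top"
    using assms by (intro tendsto_diff tendsto_const) (simp add: admissible_def)
  moreover have "\<forall>\<^sub>F t in at_top. mean (\<rho> t) h - h xbar = mean (\<rho> t) excess"
    using eventually_ge_at_top[of 0]
  proof eventually_elim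
    case (elim t)
    have "\<rho> t \<in> prob_densities" using assms elim by (auto simp: admissible_def intro: flow_density)
    then show ?case by (simp add: mean_h)
  qed
  ultimately show ?thesis unfolding diff_self by (rule Lim_transform_eventually)
qed

text \<open>Tested against \<open>f = 0\<close> the residual vanishes. The limit \<open>T \<rightarrow> \<infinity>\<close> uses that truncation only lowers the
  mean at time \<open>T\<close>; truncation at time \<open>0\<close> is removed afterwards.\<close>

lemma cost_lower_bound:
  assumes adm: "admissible h xbar \<rho>\<^sub>0 \<rho> u"
  shows "ennreal (\<beta> * mean \<rho>\<^sub>0 excess) \<le> cost \<beta> h \<rho> u"
proof (cases "cost \<beta> h \<rho> u < \<infinity>")
  case True
  have flow: "controlled_flow \<rho>\<^sub>0 \<rho> u" using adm by (simp add: admissible_def)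
  have p0: "\<rho>\<^sub>0 \<in> prob_densities" using flow_density[OF flow, of 0] by (simp add: flow_0[OF flow])
  let ?C = "enn2real (cost \<beta> h \<rho> u)"
  have le: "\<beta> * (mean \<rho>\<^sub>0 (trunc n) - mean (\<rho> T) excess) \<le> ?C" if T: "0 \<le> T" for n T
  proof -
    have fin: "(\<integral>\<^sup>+t\<in>{0..T}. Lagrangian \<beta> h (\<rho> t) (u t) \<partial>lborel) < \<infinity>"
      using cost_restrict_le True by (rule order.strict_trans1)
    have t0: "test_fun (\<lambda>x::'a. 0)" by (rule test_funI[OF C1_grad_const compact_empty]) simp
    have "0 \<le> (LINT s:{0..T}|lborel. (residual (\<lambda>x. 0) n (\<rho> s) (u s))\<^sup>2)"
      unfolding set_lebesgue_integral_def by (intro integral_nonneg_AE AE_I2) auto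
    then have "\<beta> * (mean \<rho>\<^sub>0 (trunc n) - mean (\<rho> T) (trunc n)) \<le>
        enn2real (\<integral>\<^sup>+t\<in>{0..T}. Lagrangian \<beta> h (\<rho> t) (u t) \<partial>lborel)"
      using flow_lower_bound(2)[OF flow T fin t0, of 1 n] by simp
    also have "\<dots> \<le> ?C" using cost_restrict_le True by (intro enn2real_mono) auto
    finally have "\<beta> * (mean \<rho>\<^sub>0 (trunc n) - mean (\<rho> T) (trunc n)) \<le> ?C" .
    moreover have "\<beta> * (mean \<rho>\<^sub>0 (trunc n) - mean (\<rho> T) excess) \<le> \<beta> * (mean \<rho>\<^sub>0 (trunc n) - mean (\<rho> T) (trunc n))"
      using mean_trunc_bounds(2)[OF flow_density[OF flow T], of n] \<beta>_pos by (intro mult_left_mono) auto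
    ultimately show ?thesis by linarith
  qed
  have "\<beta> * (mean \<rho>\<^sub>0 (trunc n) - 0) \<le> ?C" for n
  proof (rule tendsto_upperbound)
    show "((\<lambda>T. \<beta> * (mean \<rho>\<^sub>0 (trunc n) - mean (\<rho> T) excess)) \<longlongrightarrow> \<beta> * (mean \<rho>\<^sub>0 (trunc n) - 0)) at_top"
      by (intro tendsto_intros admissible_mean_excess_tendsto[OF adm])
    show "\<forall>\<^sub>F T in at_top. \<beta> * (mean \<rho>\<^sub>0 (trunc n) - mean (\<rho> T) excess) \<le> ?C"
      using eventually_ge_at_top[of 0] by eventually_elim (rule le)
  qed simp
  then have "\<beta> * mean \<rho>\<^sub>0 (trunc n) \<le> ?C" for n by simp
  then have "\<beta> * mean \<rho>\<^sub>0 excess \<le> ?C"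
    by (intro tendsto_upperbound[OF tendsto_mult[OF tendsto_const mean_trunc_tendsto[OF p0]]]) auto
  then have "ennreal (\<beta> * mean \<rho>\<^sub>0 excess) \<le> ennreal ?C" by (rule ennreal_leI)
  also have "ennreal ?C = cost \<beta> h \<rho> u" using True by (intro ennreal_enn2real) simp
  finally show ?thesis .
qed (simp add: less_top[symmetric])

end

section \<open>Solutions of the equation are optimal\<close>

lemma AE_eq_0_imp_continuous_eq_0:
  fixes f :: "'a::euclidean_space \<Rightarrow> real"
  assumes f: "continuous_on UNIV f" "AE x in lborel. f x = 0"
  shows "f x = 0"
proof (rule ccontr)
  assume x: "f x \<noteq> 0"
  have o: "open {x. f x \<noteq> 0}" using f(1) by (intro open_Collect_neq continuous_intros) auto
  have "{x. f x \<noteq> 0} \<in> null_sets lborel"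
    using f(2) o by (subst (asm) AE_iff_null) auto
  then have "{x. f x \<noteq> 0} \<in> null_sets lebesgue" by (rule null_sets_completionI)
  then have "negligible {x. f x \<noteq> 0}" by (simp add: negligible_iff_null_sets)
  then show False using open_not_negligible[OF o] x by auto
qed

context observation
begin

text \<open>Along a solution of the equation the mean of \<open>f\<close> changes at the rate \<open>- \<beta> * cov f \<rho>\<close>
  (\<open>flux_rate_solution\<close>).\<close>

definition cov :: "('a \<Rightarrow> real) \<Rightarrow> ('a \<Rightarrow> real) \<Rightarrow> real" where
  "cov f \<rho> = mean \<rho> (\<lambda>x. f x * excess x) - mean \<rho> f * mean \<rho> excess"

lemma bounded_times_excess_integrable:
  assumes p: "\<rho> \<in> prob_densities" and [measurable]: "f \<in> borel_measurable borel" and c: "\<And>x. \<bar>f x\<bar> \<le> c"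
  shows "integrable lborel (\<lambda>x. f x * excess x * \<rho> x)" "\<bar>mean \<rho> (\<lambda>x. f x * excess x)\<bar> \<le> c * mean \<rho> excess"
proof -
  note prob_densityD(1)[OF p, measurable]
  have le: "norm (f x * excess x * \<rho> x) \<le> c * (excess x * \<rho> x)" for x
    using mult_right_mono[OF c[of x], of "excess x * \<rho> x"] excess_nonneg[of x] prob_densityD(2)[OF p, of x]
    by (simp add: abs_mult mult.assoc)
  have i: "integrable lborel (\<lambda>x. c * (excess x * \<rho> x))" by (intro integrable_mult_right excess_integrable p)
  show I: "integrable lborel (\<lambda>x. f x * excess x * \<rho> x)"
  proof (rule Bochner_Integration.integrable_bound[OF i])
    show "AE x in lborel. norm (f x * excess x * \<rho> x) \<le> norm (c * (excess x * \<rho> x))"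
      by (intro AE_I2 order_trans[OF le]) simp
  qed measurable
  have "norm (mean \<rho> (\<lambda>x. f x * excess x)) \<le> (LINT x|lborel. norm (f x * excess x * \<rho> x))"
    unfolding mean_def by (rule integral_norm_bound)
  also have "\<dots> \<le> (LINT x|lborel. c * (excess x * \<rho> x))" by (intro integral_mono integrable_norm I i le)
  finally show "\<bar>mean \<rho> (\<lambda>x. f x * excess x)\<bar> \<le> c * mean \<rho> excess" by (simp add: mean_def)
qed

lemma cov_bounds:
  assumes p: "\<rho> \<in> prob_densities" and fm[measurable]: "f \<in> borel_measurable borel" and c: "\<And>x. \<bar>f x\<bar> \<le> c"
  shows "integrable lborel (\<lambda>x. (f x - d) * (excess x - mean \<rho> excess) * \<rho> x)"
    and "cov f \<rho> = (LINT x|lborel. (f x - d) * (excess x - mean \<rho> excess) * \<rho> x)"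
    and "\<bar>cov f \<rho>\<bar> \<le> 2 * c * mean \<rho> excess"
proof -
  let ?M = "mean \<rho> excess"
  have eq: "(f x - d) * (excess x - ?M) * \<rho> x =
      f x * excess x * \<rho> x - ?M * (f x * \<rho> x) - d * (excess x * \<rho> x) + d * ?M * \<rho> x" for x
    by (simp add: algebra_simps)
  note i = bounded_times_excess_integrable[OF p fm c] integrable_bounded_times_density[OF p fm c]
    excess_integrable[OF p] prob_densityD(3)[OF p]
  show "integrable lborel (\<lambda>x. (f x - d) * (excess x - ?M) * \<rho> x)"
    unfolding eq using i by auto
  show "cov f \<rho> = (LINT x|lborel. (f x - d) * (excess x - ?M) * \<rho> x)"
    unfolding eq using i prob_densityD(4)[OF p] by (simp add: cov_def mean_def)
  have "\<bar>mean \<rho> f * ?M\<bar> \<le> c * ?M"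
    using abs_mean_le[OF p fm c] mean_excess_nonneg[OF p] by (simp add: abs_mult mult_right_mono)
  then show "\<bar>cov f \<rho>\<bar> \<le> 2 * c * ?M" using i(2) unfolding cov_def by linarith
qed

text \<open>A potential well: a nonincreasing function of the cost that lives where the cost is near its
  minimum. Along a solution its mean cannot decrease, so mass near the minimizer is never lost.\<close>

definition well :: "real \<Rightarrow> 'a \<Rightarrow> real" where
  "well \<epsilon> x = (max 0 (\<epsilon> - excess x))\<^sup>2"

lemma well_nonneg: "0 \<le> well \<epsilon> x" by (simp add: well_def)

lemma well_le: "0 \<le> \<epsilon> \<Longrightarrow> well \<epsilon> x \<le> \<epsilon>\<^sup>2"
  unfolding well_def using excess_nonneg[of x] by (intro power_mono) auto

lemma well_abs: "0 \<le> \<epsilon> \<Longrightarrow> \<bar>well \<epsilon> x\<bar> \<le> \<epsilon>\<^sup>2"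
  using well_nonneg well_le by (simp add: abs_of_nonneg)

lemma well_excess_le: "well \<epsilon> x * excess x \<le> \<epsilon> * well \<epsilon> x"
proof (cases "excess x \<le> \<epsilon>")
  case True then show ?thesis using mult_right_mono[OF True well_nonneg[of \<epsilon> x]] by (simp add: mult.commute)
qed (simp add: well_def)

lemma well_C1: "\<exists>W. C1_grad (well \<epsilon>) W"
proof -
  have "C1_grad (\<lambda>x. \<epsilon> - excess x) (\<lambda>x. 0 - gradient h x)" by (intro C1_grad_diff C1_grad_const excess_C1)
  moreover have "continuous_on UNIV (\<lambda>x. 2 * max 0 (\<epsilon> - excess x))"
    by (intro continuous_intros C1_grad_continuous[OF excess_C1])
  ultimately show ?thesis
    unfolding well_def[abs_def]
    by (intro exI) (rule C1_grad_compose[where \<phi>="\<lambda>y. (max 0 y)\<^sup>2" and \<phi>'="\<lambda>y. 2 * max 0 y",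
          OF _ max_zero_square_derivative])
qed

lemma well_test_fun: obtains r where "0 < r" "\<And>\<epsilon>. \<epsilon> \<le> r \<Longrightarrow> test_fun (well \<epsilon>)"
proof -
  obtain D r where D: "compact D" "0 < r" "\<And>x. x \<notin> D \<Longrightarrow> h xbar + r < h x" using h_coercive by blast
  have "test_fun (well \<epsilon>)" if "\<epsilon> \<le> r" for \<epsilon>
  proof -
    obtain W where "C1_grad (well \<epsilon>) W" using well_C1 by blast
    then show ?thesis
    proof (rule test_funI[OF _ D(1)])
      fix x assume "x \<notin> D"
      from D(3)[OF this] that show "well \<epsilon> x = 0" by (simp add: well_def excess_def)
    qed
  qed
  then show thesis using that D(2) by blast
qed

lemma well_measurable [measurable]: "well \<epsilon> \<in> borel_measurable borel"
  unfolding well_def[abs_def] by measurable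

text \<open>Chebyshev's inequality for two oppositely ordered functions of the excess cost: the integrand of the
  covariance is nonpositive once the well is centred at its value where the cost equals its mean.\<close>

lemma cov_well_nonpos:
  assumes p: "\<rho> \<in> prob_densities" and e: "0 \<le> \<epsilon>"
  shows "cov (well \<epsilon>) \<rho> \<le> 0"
proof -
  let ?M = "mean \<rho> excess"
  have "(well \<epsilon> x - (max 0 (\<epsilon> - ?M))\<^sup>2) * (excess x - ?M) \<le> 0" for x
  proof (cases "excess x \<le> ?M")
    case True
    then have "(max 0 (\<epsilon> - ?M))\<^sup>2 \<le> well \<epsilon> x" unfolding well_def by (intro power_mono) auto
    then show ?thesis using True by (intro mult_nonneg_nonpos) auto
  next
    case False
    then have "well \<epsilon> x \<le> (max 0 (\<epsilon> - ?M))\<^sup>2" unfolding well_def by (intro power_mono) auto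
    then show ?thesis using False by (intro mult_nonpos_nonneg) auto
  qed
  then have "0 \<le> (LINT x|lborel. - ((well \<epsilon> x - (max 0 (\<epsilon> - ?M))\<^sup>2) * (excess x - ?M) * \<rho> x))"
    using prob_densityD(2)[OF p] by (intro integral_nonneg_AE AE_I2) (simp add: mult_nonpos_nonneg)
  then show ?thesis
    unfolding cov_bounds(2)[OF p well_measurable well_abs[OF e], of "(max 0 (\<epsilon> - ?M))\<^sup>2"] by simp
qed

text \<open>Here the two functions are equally ordered. Centred at the truncated mean, the integrand of the
  covariance is nonnegative and tends to that of the variance, so Fatou's lemma applies.\<close>

lemma cov_trunc:
  assumes p: "\<rho> \<in> prob_densities"
  shows "0 \<le> cov (trunc n) \<rho>"
    and "(\<integral>\<^sup>+x. ennreal ((excess x - mean \<rho> excess)\<^sup>2 * \<rho> x) \<partial>lborel) \<le> liminf (\<lambda>n. ennreal (cov (trunc n) \<rho>))"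
proof -
  note prob_densityD(1)[OF p, measurable]
  let ?M = "mean \<rho> excess"
  let ?w = "\<lambda>n x. (trunc n x - saturate n ?M) * (excess x - ?M) * \<rho> x"
  have nn: "0 \<le> ?w n x" for n x
  proof -
    have "?w n x = (real (Suc n))\<^sup>2 / ((real (Suc n) + excess x) * (real (Suc n) + ?M)) * (excess x - ?M)\<^sup>2 * \<rho> x"
      by (simp only: trunc_def saturate_diff[OF excess_nonneg mean_excess_nonneg[OF p]] power2_eq_square[of "excess x - ?M"] mult.assoc)
    then show ?thesis
      using saturate_slope(1)[OF excess_nonneg mean_excess_nonneg[OF p], of n x] prob_densityD(2)[OF p, of x]
      by (simp only:) (intro mult_nonneg_nonneg zero_le_power2)
  qed
  have c: "integrable lborel (?w n)" "cov (trunc n) \<rho> = (LINT x|lborel. ?w n x)" for n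
    by (rule cov_bounds[OF p trunc_measurable trunc_bounds(4)])+
  have c_nn: "(\<integral>\<^sup>+x. ennreal (?w n x) \<partial>lborel) = ennreal (cov (trunc n) \<rho>)" for n
    unfolding c(2) by (intro nn_integral_eq_integral c(1) AE_I2 nn)
  show "0 \<le> cov (trunc n) \<rho>" unfolding c(2) by (intro integral_nonneg_AE AE_I2 nn)
  have lim: "(\<lambda>n. ?w n x) \<longlonglongrightarrow> (excess x - ?M)\<^sup>2 * \<rho> x" for x
    unfolding power2_eq_square
    by (intro tendsto_intros trunc_tendsto saturate_tendsto mean_excess_nonneg[OF p])
  have "(\<integral>\<^sup>+x. ennreal ((excess x - ?M)\<^sup>2 * \<rho> x) \<partial>lborel) = (\<integral>\<^sup>+x. liminf (\<lambda>n. ennreal (?w n x)) \<partial>lborel)"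
    by (intro nn_integral_cong lim_imp_Liminf[symmetric] tendsto_ennrealI lim) simp
  also have "\<dots> \<le> liminf (\<lambda>n. \<integral>\<^sup>+x. ennreal (?w n x) \<partial>lborel)"
    by (rule nn_integral_liminf) measurable
  finally show "(\<integral>\<^sup>+x. ennreal ((excess x - ?M)\<^sup>2 * \<rho> x) \<partial>lborel) \<le> liminf (\<lambda>n. ennreal (cov (trunc n) \<rho>))"
    unfolding c_nn .
qed

lemma flux_rate_solution:
  assumes p: "\<rho> \<in> prob_densities" and s: "solves_pde \<beta> h \<rho> u" and f: "test_fun f"
  shows "flux_rate f \<rho> u = - \<beta> * cov f \<rho>"
proof -
  note test_fun_measurable[OF f, measurable]
  obtain c where c: "\<And>x. \<bar>f x\<bar> \<le> c" using f by (elim test_funE) blast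
  have "flux_rate f \<rho> u = - mean \<rho> (\<lambda>x. f x * (\<beta> * (excess x - mean \<rho> excess)))"
    using flux_rate_weighted_divergence[OF s[unfolded solves_pde_def] f] by (simp add: h_minus_mean[OF p])
  also have "\<dots> = - mean \<rho> (\<lambda>x. \<beta> * ((f x - 0) * (excess x - mean \<rho> excess)))" by (simp add: ac_simps)
  also have "\<dots> = - \<beta> * cov f \<rho>"
    unfolding cov_bounds(2)[OF p test_fun_measurable(1)[OF f] c, of 0] by (simp add: mean_def mult.assoc)
  finally show ?thesis .
qed

lemma Lagrangian_solution:
  assumes p: "\<rho> \<in> prob_densities" and s: "solves_pde \<beta> h \<rho> u"
  shows "Lagrangian \<beta> h \<rho> u = ennreal (\<beta>\<^sup>2) * (\<integral>\<^sup>+x. ennreal ((excess x - mean \<rho> excess)\<^sup>2 * \<rho> x) \<partial>lborel)"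
proof -
  note prob_densityD(1)[OF p, measurable]
  define a where "a = (SOME a. weighted_divergence \<rho> u a)"
  have b: "weighted_divergence \<rho> u (\<lambda>x. \<beta> * (h x - mean \<rho> h))" using s by (simp add: solves_pde_def)
  then have a: "weighted_divergence \<rho> u a" unfolding a_def by (rule someI[of "weighted_divergence \<rho> u"])
  let ?v = "\<lambda>x. (excess x - mean \<rho> excess)\<^sup>2 * \<rho> x"
  have "kinetic \<rho> u = (\<integral>\<^sup>+x. ennreal (1/2 * \<bar>a x\<bar>\<^sup>2 * \<rho> x) \<partial>lborel)"
    using a unfolding a_def kinetic_def by auto
  also have "\<dots> = (\<integral>\<^sup>+x. ennreal (\<beta>\<^sup>2/2) * ennreal (?v x) \<partial>lborel)"
  proof (rule nn_integral_cong_AE)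
    show "AE x in lborel. ennreal (1/2 * \<bar>a x\<bar>\<^sup>2 * \<rho> x) = ennreal (\<beta>\<^sup>2/2) * ennreal (?v x)"
      using weighted_divergence_unique[OF a b]
    proof eventually_elim
      case (elim x)
      then have "\<rho> x = 0 \<or> a x = \<beta> * (excess x - mean \<rho> excess)" by (simp add: h_minus_mean[OF p])
      then have "1/2 * \<bar>a x\<bar>\<^sup>2 * \<rho> x = \<beta>\<^sup>2/2 * ?v x" by (auto simp: power_mult_distrib)
      then show ?case using prob_densityD(2)[OF p, of x] by (simp add: ennreal_mult[symmetric])
    qed
  qed
  finally have k: "kinetic \<rho> u = ennreal (\<beta>\<^sup>2/2) * (\<integral>\<^sup>+x. ennreal (?v x) \<partial>lborel)"
    by (simp add: nn_integral_cmult)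
  have "(\<integral>\<^sup>+x. ennreal (\<beta>\<^sup>2/2 * \<bar>h x - mean \<rho> h\<bar>\<^sup>2 * \<rho> x) \<partial>lborel) = (\<integral>\<^sup>+x. ennreal (\<beta>\<^sup>2/2) * ennreal (?v x) \<partial>lborel)"
    unfolding h_minus_mean[OF p] using prob_densityD(2)[OF p]
    by (intro nn_integral_cong) (simp add: ennreal_mult[symmetric] mult.assoc)
  then have "(\<integral>\<^sup>+x. ennreal (\<beta>\<^sup>2/2 * \<bar>h x - mean \<rho> h\<bar>\<^sup>2 * \<rho> x) \<partial>lborel) = ennreal (\<beta>\<^sup>2/2) * (\<integral>\<^sup>+x. ennreal (?v x) \<partial>lborel)"
    by (simp add: nn_integral_cmult)
  then show ?thesis
    unfolding Lagrangian_def k by (simp add: distrib_right[symmetric] ennreal_plus[symmetric] del: ennreal_plus)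
qed

context
  fixes \<rho>\<^sub>0 :: "'a \<Rightarrow> real" and \<rho> u
  assumes flow: "controlled_flow \<rho>\<^sub>0 \<rho> u"
    and pde: "AE t in lborel. 0 \<le> t \<longrightarrow> solves_pde \<beta> h (\<rho> t) (u t)"
    and initial_pos: "\<And>x. 0 < \<rho>\<^sub>0 x"
begin

lemma solution_rate:
  assumes f: "test_fun f"
  shows "AE t in lborel. 0 \<le> t \<longrightarrow> flux_rate f (\<rho> t) (u t) = - \<beta> * cov f (\<rho> t)"
  using pde
proof eventually_elim
  case (elim t)
  then show ?case using flux_rate_solution[OF flow_density[OF flow] _ f] by blast
qed

lemma solution_mean_diff_ge:
  assumes f: "test_fun f" and st: "0 \<le> s" "s \<le> t"
    and c: "\<And>r. s \<le> r \<Longrightarrow> r \<le> t \<Longrightarrow> c \<le> - \<beta> * cov f (\<rho> r)"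
  shows "c * (t - s) \<le> mean (\<rho> t) f - mean (\<rho> s) f"
proof -
  have i: "integrable lborel (\<lambda>r. indicator {s..t} r *\<^sub>R flux_rate f (\<rho> r) (u r))"
    using flow_rate(1)[OF flow f st] by (simp add: set_integrable_def)
  have "c * (t - s) = (LINT r|lborel. indicator {s..t} r * c)" using st by simp
  also have "\<dots> \<le> (LINT r|lborel. indicator {s..t} r *\<^sub>R flux_rate f (\<rho> r) (u r))"
  proof (rule integral_mono_AE[OF _ i])
    show "integrable lborel (\<lambda>r. indicator {s..t} r * c)" by (intro integrable_mult_left integrable_real_indicator) (auto simp: emeasure_lborel_Icc_eq)
    show "AE r in lborel. indicator {s..t} r * c \<le> indicator {s..t} r *\<^sub>R flux_rate f (\<rho> r) (u r)"
      using solution_rate[OF f] by eventually_elim (use c st in \<open>auto simp: indicator_def\<close>)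
  qed
  also have "\<dots> = mean (\<rho> t) f - mean (\<rho> s) f"
    using flow_rate(2)[OF flow f st] by (simp add: set_lebesgue_integral_def)
  finally show ?thesis .
qed

lemma well_mean_mono:
  assumes "test_fun (well \<epsilon>)" "0 \<le> \<epsilon>" "0 \<le> s" "s \<le> t"
  shows "mean (\<rho> s) (well \<epsilon>) \<le> mean (\<rho> t) (well \<epsilon>)"
proof -
  have "0 \<le> - \<beta> * cov (well \<epsilon>) (\<rho> r)" if "s \<le> r" for r
    using cov_well_nonpos[OF flow_density[OF flow] assms(2), of r] that assms(3) \<beta>_pos
    by (simp add: mult_nonneg_nonpos)
  then show ?thesis using solution_mean_diff_ge[OF assms(1,3,4), of 0] by simp
qed

lemma well_mean_initial_pos:
  assumes e: "0 < \<epsilon>" shows "0 < mean \<rho>\<^sub>0 (well \<epsilon>)"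
proof (rule ccontr)
  have p: "\<rho>\<^sub>0 \<in> prob_densities" using flow_density[OF flow, of 0] by (simp add: flow_0[OF flow])
  have nn: "AE x in lborel. 0 \<le> well \<epsilon> x * \<rho>\<^sub>0 x" using well_nonneg initial_pos by (intro AE_I2) (simp add: less_imp_le)
  have i: "integrable lborel (\<lambda>x. well \<epsilon> x * \<rho>\<^sub>0 x)"
    by (rule integrable_bounded_times_density[OF p _ well_abs]) (use e in auto)
  assume "\<not> 0 < mean \<rho>\<^sub>0 (well \<epsilon>)"
  then have "mean \<rho>\<^sub>0 (well \<epsilon>) = 0" using integral_nonneg_AE[OF nn] by (simp add: mean_def)
  then have "AE x in lborel. well \<epsilon> x * \<rho>\<^sub>0 x = 0"
    unfolding mean_def using integral_nonneg_eq_0_iff_AE[OF i nn] by simp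
  then have "AE x in lborel. well \<epsilon> x = 0"
    by eventually_elim (use initial_pos less_imp_neq in force)
  moreover obtain W where "C1_grad (well \<epsilon>) W" using well_C1 by blast
  ultimately have "well \<epsilon> xbar = 0" using AE_eq_0_imp_continuous_eq_0 C1_grad_continuous by blast
  then show False using e by (simp add: well_def excess_def)
qed

text \<open>Second moments are finite at each time, but not uniformly on time intervals, so the mean cost
  could a priori be a wild function of time. The equation tested against a well controls it: it expresses the
  product of the mean cost and the mean of the well by integrable functions of time, and the mean of the well
  stays above its initial value.\<close>

lemma mean_excess_integrable:
  assumes T: "0 \<le> T" shows "set_integrable lborel {0..T} (\<lambda>s. mean (\<rho> s) excess)"
proof -
  obtain \<epsilon> where e: "0 < \<epsilon>" and tw: "test_fun (well \<epsilon>)" using well_test_fun by (metis order_refl)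
  let ?Y = "mean \<rho>\<^sub>0 (well \<epsilon>)" and ?I = "indicator {0..T} :: real \<Rightarrow> real"
  have y0: "0 < ?Y" by (rule well_mean_initial_pos[OF e])
  let ?D = "\<lambda>s. (?I s *\<^sub>R flux_rate (well \<epsilon>) (\<rho> s) (u s) + \<beta> * (?I s * \<epsilon>^3)) / (\<beta> * ?Y)"
  have D: "integrable lborel ?D"
    using flow_rate(1)[OF flow tw order_refl T]
    by (intro integrable_divide Bochner_Integration.integrable_add integrable_mult_right integrable_mult_left
        integrable_real_indicator) (auto simp: set_integrable_def emeasure_lborel_Icc_eq)
  have m: "(\<lambda>s. ?I s *\<^sub>R mean (\<rho> s) excess) \<in> borel_measurable lborel"
    using flow_mean_measurable_Icc[OF flow excess_measurable order_refl, of T] by simp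
  show ?thesis
    unfolding set_integrable_def
  proof (rule Bochner_Integration.integrable_bound[OF D m])
    show "AE s in lborel. norm (?I s *\<^sub>R mean (\<rho> s) excess) \<le> norm (?D s)"
      using solution_rate[OF tw]
    proof eventually_elim
      case (elim s)
      show ?case
      proof (cases "s \<in> {0..T}")
        case True
        then have s: "0 \<le> s" by simp
        note p = flow_density[OF flow s]
        let ?M = "mean (\<rho> s) excess" and ?y = "mean (\<rho> s) (well \<epsilon>)"
        have M0: "0 \<le> ?M" by (rule mean_excess_nonneg[OF p])
        have "mean (\<rho> s) (\<lambda>x. well \<epsilon> x * excess x) \<le> \<epsilon> ^ 3"
        proof -
          have "\<bar>well \<epsilon> x * excess x\<bar> \<le> \<epsilon> ^ 3" for x
            using order_trans[OF well_excess_le mult_left_mono[OF well_le]] e well_nonneg[of \<epsilon> x] excess_nonneg[of x]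
            by (simp add: power3_eq_cube power2_eq_square abs_mult mult.assoc)
          from abs_mean_le[of "\<rho> s" "\<lambda>x. well \<epsilon> x * excess x" "\<epsilon> ^ 3", OF p _ this] show ?thesis by auto
        qed
        moreover have "flux_rate (well \<epsilon>) (\<rho> s) (u s) = - \<beta> * cov (well \<epsilon>) (\<rho> s)" using elim s by simp
        then have "\<beta> * (?y * ?M) = flux_rate (well \<epsilon>) (\<rho> s) (u s) + \<beta> * mean (\<rho> s) (\<lambda>x. well \<epsilon> x * excess x)"
          by (simp add: cov_def algebra_simps)
        ultimately have upper: "\<beta> * (?y * ?M) \<le> flux_rate (well \<epsilon>) (\<rho> s) (u s) + \<beta> * \<epsilon> ^ 3"
          using \<beta>_pos by (simp add: mult_left_mono)
        have "?Y \<le> ?y" using well_mean_mono[OF tw less_imp_le[OF e] order_refl s] by (simp add: flow_0[OF flow])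
        then have "\<beta> * (?Y * ?M) \<le> \<beta> * (?y * ?M)" using \<beta>_pos M0 by (intro mult_left_mono mult_right_mono) auto
        from order_trans[OF this upper]
        have "?M * (\<beta> * ?Y) \<le> flux_rate (well \<epsilon>) (\<rho> s) (u s) + \<beta> * \<epsilon> ^ 3" by (simp only: ac_simps)
        then have "?M \<le> ?D s" using True \<beta>_pos y0 by (simp add: pos_le_divide_eq)
        also have "\<dots> \<le> norm (?D s)" unfolding real_norm_def by (rule abs_ge_self)
        finally show ?thesis using True M0 by (simp only: indicator_simps scaleR_one real_norm_def abs_of_nonneg)
      qed simp
    qed
  qed
qed

text \<open>The cutoff is removed with the dominating function \<open>2 \<beta> (Suc n)\<close> times the mean cost, whose
  integrability in time was established for this purpose.\<close>

lemma trunc_mean_diff: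
  assumes st: "0 \<le> s" "s \<le> t"
  shows "set_integrable lborel {s..t} (\<lambda>r. cov (trunc n) (\<rho> r))"
    and "mean (\<rho> s) (trunc n) - mean (\<rho> t) (trunc n) = \<beta> * (LINT r:{s..t}|lborel. cov (trunc n) (\<rho> r))"
proof -
  let ?I = "indicator {s..t} :: real \<Rightarrow> real"
  let ?F = "\<lambda>j r. ?I r *\<^sub>R flux_rate (cut_trunc n j) (\<rho> r) (u r)"
  let ?D = "\<lambda>r. (2 * \<beta> * real (Suc n)) * (?I r *\<^sub>R mean (\<rho> r) excess)"
  have t: "0 \<le> t" using st by simp
  have D: "integrable lborel ?D"
    using set_integrable_subset[OF mean_excess_integrable[OF t], of "{s..t}"] st
    by (intro integrable_mult_right) (auto simp: set_integrable_def)
  have F: "integrable lborel (?F j)" for j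
    using flow_rate(1)[OF flow cut_trunc_test_fun st] by (simp add: set_integrable_def)
  have cm: "(\<lambda>r. ?I r *\<^sub>R (- \<beta> * cov (trunc n) (\<rho> r))) \<in> borel_measurable lborel"
  proof -
    note flow_mean_measurable_Icc[OF flow _ st(1), of _ t, measurable]
    have "(\<lambda>r. - \<beta> * (?I r * mean (\<rho> r) (\<lambda>x. trunc n x * excess x) -
        (?I r * mean (\<rho> r) (trunc n)) * (?I r * mean (\<rho> r) excess))) \<in> borel_measurable borel" by measurable
    moreover have "- \<beta> * (?I r * mean (\<rho> r) (\<lambda>x. trunc n x * excess x) -
        (?I r * mean (\<rho> r) (trunc n)) * (?I r * mean (\<rho> r) excess)) = ?I r *\<^sub>R (- \<beta> * cov (trunc n) (\<rho> r))" for r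
      by (simp add: cov_def indicator_def)
    ultimately show ?thesis by (simp only: measurable_lborel2)
  qed
  have cut_bd: "\<bar>cut_trunc n j x\<bar> \<le> real (Suc n)" for j x
    using cut_trunc_abs[of n j x] trunc_bounds(3)[of n x] by linarith
  have lim: "AE r in lborel. (\<lambda>j. ?F j r) \<longlonglongrightarrow> ?I r *\<^sub>R (- \<beta> * cov (trunc n) (\<rho> r))"
  proof -
    have "AE r in lborel. \<forall>j. 0 \<le> r \<longrightarrow> flux_rate (cut_trunc n j) (\<rho> r) (u r) = - \<beta> * cov (cut_trunc n j) (\<rho> r)"
      unfolding AE_all_countable using solution_rate[OF cut_trunc_test_fun] by blast
    then show ?thesis
  proof eventually_elim
    case (elim r)
    show ?case
    proof (cases "r \<in> {s..t}")
      case True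
      then have r: "0 \<le> r" using st by simp
      note p = flow_density[OF flow r]
      have "(\<lambda>j. mean (\<rho> r) (\<lambda>x. cut_trunc n j x * excess x)) \<longlonglongrightarrow> mean (\<rho> r) (\<lambda>x. trunc n x * excess x)"
      proof (rule mean_dominated_convergence[OF p])
        show "(\<lambda>j. cut_trunc n j x * excess x) \<longlonglongrightarrow> trunc n x * excess x" for x
          by (intro tendsto_mult cut_trunc_tendsto tendsto_const)
        show "integrable lborel (\<lambda>x. trunc n x * excess x * \<rho> r x)"
          by (rule bounded_times_excess_integrable(1)[OF p _ trunc_bounds(4)]) simp
        show "\<bar>cut_trunc n j x * excess x\<bar> \<le> trunc n x * excess x" for j x
          using mult_right_mono[OF cut_trunc_abs excess_nonneg] excess_nonneg[of x] by (simp add: abs_mult)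
      qed measurable
      then have "(\<lambda>j. - \<beta> * cov (cut_trunc n j) (\<rho> r)) \<longlonglongrightarrow> - \<beta> * cov (trunc n) (\<rho> r)"
        unfolding cov_def by (intro tendsto_intros mean_cut_trunc_tendsto p)
      then show ?thesis using True r elim by simp
    qed simp
  qed
  qed
  have bd: "AE r in lborel. norm (?F j r) \<le> ?D r" for j
    using solution_rate[OF cut_trunc_test_fun, of n j]
  proof eventually_elim
    case (elim r)
    show ?case
    proof (cases "r \<in> {s..t}")
      case True
      then have r: "0 \<le> r" using st by simp
      have "norm (?F j r) = \<beta> * \<bar>cov (cut_trunc n j) (\<rho> r)\<bar>" using elim r True \<beta>_pos by (simp add: abs_mult)
      also have "\<dots> \<le> \<beta> * (2 * real (Suc n) * mean (\<rho> r) excess)"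
        using \<beta>_pos by (intro mult_left_mono cov_bounds(3)[OF flow_density[OF flow r] _ cut_bd]) auto
      finally show ?thesis using True by (simp add: ac_simps)
    qed simp
  qed
  have Fm: "?F j \<in> borel_measurable lborel" for j using F by auto
  have i: "integrable lborel (\<lambda>r. ?I r *\<^sub>R (- \<beta> * cov (trunc n) (\<rho> r)))"
    by (rule integrable_dominated_convergence[OF cm Fm D lim bd])
  have "integrable lborel (\<lambda>r. - inverse \<beta> * (?I r *\<^sub>R (- \<beta> * cov (trunc n) (\<rho> r))))" by (rule integrable_mult_right[OF i])
  moreover have "- inverse \<beta> * (?I r *\<^sub>R (- \<beta> * cov (trunc n) (\<rho> r))) = ?I r *\<^sub>R cov (trunc n) (\<rho> r)" for r
    using \<beta>_pos by simp
  ultimately show "set_integrable lborel {s..t} (\<lambda>r. cov (trunc n) (\<rho> r))"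
    by (simp only: set_integrable_def)
  have "(\<lambda>j. LINT r|lborel. ?F j r) \<longlonglongrightarrow> (LINT r|lborel. ?I r *\<^sub>R (- \<beta> * cov (trunc n) (\<rho> r)))"
    by (rule integral_dominated_convergence[OF cm Fm D lim bd])
  moreover have "(LINT r|lborel. ?F j r) = mean (\<rho> t) (cut_trunc n j) - mean (\<rho> s) (cut_trunc n j)" for j
    using flow_rate(2)[OF flow cut_trunc_test_fun st] by (simp add: set_lebesgue_integral_def)
  moreover have "(\<lambda>j. mean (\<rho> t) (cut_trunc n j) - mean (\<rho> s) (cut_trunc n j)) \<longlonglongrightarrow>
      mean (\<rho> t) (trunc n) - mean (\<rho> s) (trunc n)"
    by (intro tendsto_diff mean_cut_trunc_tendsto flow_density[OF flow] st t)
  ultimately have "(LINT r|lborel. ?I r *\<^sub>R (- \<beta> * cov (trunc n) (\<rho> r))) = mean (\<rho> t) (trunc n) - mean (\<rho> s) (trunc n)"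
    using LIMSEQ_unique by force
  moreover have "(LINT r|lborel. ?I r *\<^sub>R (- \<beta> * cov (trunc n) (\<rho> r))) = - \<beta> * (LINT r:{s..t}|lborel. cov (trunc n) (\<rho> r))"
    unfolding set_lebesgue_integral_def integral_mult_right_zero[symmetric] by (simp add: ac_simps)
  ultimately show "mean (\<rho> s) (trunc n) - mean (\<rho> t) (trunc n) = \<beta> * (LINT r:{s..t}|lborel. cov (trunc n) (\<rho> r))"
    by simp
qed

lemma mean_excess_antimono:
  assumes st: "0 \<le> s" "s \<le> t" shows "mean (\<rho> t) excess \<le> mean (\<rho> s) excess"
proof (rule LIMSEQ_le[OF mean_trunc_tendsto mean_trunc_tendsto])
  show "\<rho> t \<in> prob_densities" "\<rho> s \<in> prob_densities" using st by (auto intro: flow_density[OF flow])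
  have "0 \<le> (LINT r:{s..t}|lborel. cov (trunc n) (\<rho> r))" for n
    unfolding set_lebesgue_integral_def
    using st by (intro integral_nonneg_AE AE_I2) (auto simp: indicator_def intro!: cov_trunc(1) flow_density[OF flow])
  then have "0 \<le> mean (\<rho> s) (trunc n) - mean (\<rho> t) (trunc n)" for n
    unfolding trunc_mean_diff(2)[OF st] using \<beta>_pos by simp
  then show "\<exists>N. \<forall>n\<ge>N. mean (\<rho> t) (trunc n) \<le> mean (\<rho> s) (trunc n)" by auto
qed

text \<open>If the mean cost stayed above \<open>c\<close>, a well of depth at most \<open>c / 2\<close> would gain at least
  \<open>\<beta> c / 2\<close> times its initial mean per unit of time, while its mean is bounded.\<close>

lemma mean_excess_tendsto_0: "((\<lambda>t. mean (\<rho> t) excess) \<longlongrightarrow> 0) at_top"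
proof (rule order_tendstoI)
  fix c :: real assume "c < 0"
  show "\<forall>\<^sub>F t in at_top. c < mean (\<rho> t) excess"
    using eventually_ge_at_top[of 0]
    by eventually_elim (use mean_excess_nonneg[OF flow_density[OF flow]] \<open>c < 0\<close> in force)
next
  fix c :: real assume c: "0 < c"
  have "\<exists>t\<ge>0. mean (\<rho> t) excess < c"
  proof (rule ccontr)
    assume "\<not> (\<exists>t\<ge>0. mean (\<rho> t) excess < c)"
    then have large: "c \<le> mean (\<rho> t) excess" if "0 \<le> t" for t using that by force
    obtain r where r: "0 < r" "\<And>\<epsilon>. \<epsilon> \<le> r \<Longrightarrow> test_fun (well \<epsilon>)" using well_test_fun by blast
    define \<epsilon> where "\<epsilon> = min r (c / 2)"
    have e: "0 < \<epsilon>" "\<epsilon> \<le> c / 2" and tw: "test_fun (well \<epsilon>)" using r c by (auto simp: \<epsilon>_def)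
    define y where "y t = mean (\<rho> t) (well \<epsilon>)" for t
    have y0: "0 < y 0" unfolding y_def flow_0[OF flow] by (rule well_mean_initial_pos[OF e(1)])
    have rate: "\<beta> * (c / 2 * y 0) \<le> - \<beta> * cov (well \<epsilon>) (\<rho> t)" if t: "0 \<le> t" for t
    proof -
      note p = flow_density[OF flow t]
      have wab: "\<bar>well \<epsilon> x\<bar> \<le> \<epsilon>\<^sup>2" for x using e by (intro well_abs) auto
      have "mean (\<rho> t) (\<lambda>x. well \<epsilon> x * excess x) \<le> (LINT x|lborel. \<epsilon> * (well \<epsilon> x * \<rho> t x))"
        unfolding mean_def
      proof (rule integral_mono)
        show "integrable lborel (\<lambda>x. well \<epsilon> x * excess x * \<rho> t x)"
          by (rule bounded_times_excess_integrable(1)[OF p _ wab]) simp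
        show "integrable lborel (\<lambda>x. \<epsilon> * (well \<epsilon> x * \<rho> t x))"
          by (intro integrable_mult_right integrable_bounded_times_density[OF p _ wab]) simp
        show "well \<epsilon> x * excess x * \<rho> t x \<le> \<epsilon> * (well \<epsilon> x * \<rho> t x)" for x
          using mult_right_mono[OF well_excess_le prob_densityD(2)[OF p]] by (simp add: mult.assoc)
      qed
      then have "mean (\<rho> t) (\<lambda>x. well \<epsilon> x * excess x) \<le> \<epsilon> * y t" by (simp add: y_def mean_def)
      moreover have yt: "y 0 \<le> y t" unfolding y_def by (rule well_mean_mono[OF tw _ order_refl t]) (use e in simp)
      then have "\<epsilon> * y t \<le> c / 2 * y t" using e y0 by (intro mult_right_mono) auto
      moreover have "c * y t \<le> mean (\<rho> t) excess * y t" using large[OF t] y0 yt by (intro mult_right_mono) auto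
      moreover have "c / 2 * y 0 \<le> c / 2 * y t" using yt c by (intro mult_left_mono) auto
      moreover have "c * y t = c / 2 * y t + c / 2 * y t" by simp
      ultimately have "c / 2 * y 0 \<le> - cov (well \<epsilon>) (\<rho> t)"
        unfolding cov_def y_def[symmetric] mult.commute[of "y t"] by linarith
      from mult_left_mono[OF this less_imp_le[OF \<beta>_pos]] show ?thesis by simp
    qed
    have "\<beta> * (c / 2 * y 0) * t \<le> \<epsilon>\<^sup>2" if t: "0 \<le> t" for t
    proof -
      have "\<beta> * (c / 2 * y 0) * (t - 0) \<le> y t - y 0"
        unfolding y_def by (rule solution_mean_diff_ge[OF tw order_refl t]) (use rate[unfolded y_def] in auto)
      moreover have "y t \<le> \<epsilon>\<^sup>2"
        using abs_mean_le[OF flow_density[OF flow t] well_measurable well_abs[OF less_imp_le[OF e(1)]]]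
        unfolding y_def by (simp add: abs_le_iff)
      ultimately show ?thesis using y0 by simp
    qed
    moreover have "0 < \<beta> * (c / 2 * y 0)" using \<beta>_pos c y0 by simp
    moreover have False if K: "0 < K" "\<And>t. 0 \<le> t \<Longrightarrow> K * t \<le> e" "0 \<le> e" for K e :: real
      using K(2)[of "(e + 1) / K"] K(1,3) by (simp add: field_simps)
    ultimately show False using zero_le_power2 by blast
  qed
  then obtain t0 where t0: "0 \<le> t0" "mean (\<rho> t0) excess < c" by blast
  show "\<forall>\<^sub>F t in at_top. mean (\<rho> t) excess < c"
    using eventually_ge_at_top[of t0]
    by eventually_elim (use mean_excess_antimono[OF t0(1)] t0(2) in force)
qed

lemma solution_admissible: "admissible h xbar \<rho>\<^sub>0 \<rho> u"
proof -
  have "((\<lambda>t. mean (\<rho> t) excess + h xbar) \<longlongrightarrow> 0 + h xbar) at_top"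
    by (intro tendsto_intros mean_excess_tendsto_0)
  moreover have "\<forall>\<^sub>F t in at_top. mean (\<rho> t) excess + h xbar = mean (\<rho> t) h"
    using eventually_ge_at_top[of 0] by eventually_elim (simp add: mean_h[OF flow_density[OF flow]])
  ultimately have "((\<lambda>t. mean (\<rho> t) h) \<longlongrightarrow> h xbar) at_top"
    unfolding add_0 by (rule Lim_transform_eventually)
  then show ?thesis using flow by (simp add: admissible_def)
qed

text \<open>The cost is \<open>\<beta>\<^sup>2\<close> times the time integral of the variance. The lower limit \<open>V\<close> of the covariances
  with truncated costs lies above the variance, is measurable in time, and has an integral that Fatou's
  lemma bounds by the total decrease of the mean.\<close>

lemma solution_cost_le: "cost \<beta> h \<rho> u \<le> ennreal (\<beta> * mean \<rho>\<^sub>0 excess)"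
proof -
  define V where "V t = liminf (\<lambda>n. ennreal (cov (trunc n) (\<rho> t)))" for t
  let ?C = "\<lambda>T n t. ennreal (indicator {0..T} t *\<^sub>R cov (trunc n) (\<rho> t))"
  have Cm: "?C T n \<in> borel_measurable lborel" if "0 \<le> T" for T n
    using trunc_mean_diff(1)[OF order_refl that, of n] by (auto simp: set_integrable_def)
  have VC: "V t * indicator {0..T} t = liminf (\<lambda>n. ?C T n t)" for t T
    by (cases "t \<in> {0..T}") (simp_all add: V_def Liminf_const)
  have V: "(\<integral>\<^sup>+t. V t * indicator {0..T} t \<partial>lborel) \<le> ennreal (mean \<rho>\<^sub>0 excess / \<beta>)" if T: "0 \<le> T" for T
  proof -
    have "(\<integral>\<^sup>+t. V t * indicator {0..T} t \<partial>lborel) \<le> liminf (\<lambda>n. \<integral>\<^sup>+t. ?C T n t \<partial>lborel)"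
      unfolding VC by (rule nn_integral_liminf[OF Cm[OF T]])
    also have "(\<lambda>n. \<integral>\<^sup>+t. ?C T n t \<partial>lborel) = (\<lambda>n. ennreal ((mean \<rho>\<^sub>0 (trunc n) - mean (\<rho> T) (trunc n)) / \<beta>))"
    proof
      fix n
      have "(\<integral>\<^sup>+t. ?C T n t \<partial>lborel) = ennreal (LINT t:{0..T}|lborel. cov (trunc n) (\<rho> t))"
        unfolding set_lebesgue_integral_def
        using trunc_mean_diff(1)[OF order_refl T, of n]
        by (intro nn_integral_eq_integral) (auto simp: set_integrable_def indicator_def
            intro!: AE_I2 cov_trunc(1) flow_density[OF flow])
      then show "(\<integral>\<^sup>+t. ?C T n t \<partial>lborel) = ennreal ((mean \<rho>\<^sub>0 (trunc n) - mean (\<rho> T) (trunc n)) / \<beta>)"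
        using trunc_mean_diff(2)[OF order_refl T, of n] \<beta>_pos by (simp add: flow_0[OF flow])
    qed
    also have "liminf \<dots> = ennreal ((mean \<rho>\<^sub>0 excess - mean (\<rho> T) excess) / \<beta>)"
      using flow_density[OF flow T] flow_density[OF flow, of 0]
      by (intro lim_imp_Liminf tendsto_ennrealI tendsto_intros mean_trunc_tendsto)
        (use \<beta>_pos in \<open>auto simp: flow_0[OF flow]\<close>)
    also have "\<dots> \<le> ennreal (mean \<rho>\<^sub>0 excess / \<beta>)"
      using mean_excess_nonneg[OF flow_density[OF flow T]] \<beta>_pos by (intro ennreal_leI divide_right_mono) auto
    finally show ?thesis .
  qed
  have Vm: "(\<lambda>t. V t * indicator {0..T} t) \<in> borel_measurable lborel" if "0 \<le> T" for T
    unfolding VC using Cm[OF that] by measurable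
  have "cost \<beta> h \<rho> u \<le> (\<integral>\<^sup>+t. (SUP i. ennreal (\<beta>\<^sup>2) * (V t * indicator {0..real i} t)) \<partial>lborel)"
    unfolding cost_def
  proof (rule nn_integral_mono_AE)
    show "AE t in lborel. Lagrangian \<beta> h (\<rho> t) (u t) * indicator {0..} t \<le>
        (SUP i. ennreal (\<beta>\<^sup>2) * (V t * indicator {0..real i} t))"
      using pde
    proof eventually_elim
      case (elim t)
      show ?case
      proof (cases "0 \<le> t")
        case True
        obtain i where i: "t \<le> real i" using real_arch_simple by blast
        note p = flow_density[OF flow True]
        have "Lagrangian \<beta> h (\<rho> t) (u t) * indicator {0..} t \<le> ennreal (\<beta>\<^sup>2) * (V t * indicator {0..real i} t)"
          using True i cov_trunc(2)[OF p] Lagrangian_solution[OF p] elim by (simp add: V_def mult_left_mono)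
        then show ?thesis by (rule SUP_upper2[OF UNIV_I])
      qed simp
    qed
  qed
  also have "\<dots> = (SUP i. \<integral>\<^sup>+t. ennreal (\<beta>\<^sup>2) * (V t * indicator {0..real i} t) \<partial>lborel)"
  proof (rule nn_integral_monotone_convergence_SUP)
    show "incseq (\<lambda>i t. ennreal (\<beta>\<^sup>2) * (V t * indicator {0..real i} t))"
      by (auto simp: incseq_def le_fun_def indicator_def intro!: mult_left_mono)
    show "(\<lambda>t. ennreal (\<beta>\<^sup>2) * (V t * indicator {0..real i} t)) \<in> borel_measurable lborel" for i
      using Vm[of "real i"] by measurable
  qed
  also have "\<dots> \<le> ennreal (\<beta> * mean \<rho>\<^sub>0 excess)"
  proof (rule SUP_least)
    fix i
    have "(\<integral>\<^sup>+t. ennreal (\<beta>\<^sup>2) * (V t * indicator {0..real i} t) \<partial>lborel) =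
        ennreal (\<beta>\<^sup>2) * (\<integral>\<^sup>+t. V t * indicator {0..real i} t \<partial>lborel)"
      using Vm[of "real i"] by (intro nn_integral_cmult) simp
    also have "\<dots> \<le> ennreal (\<beta>\<^sup>2) * ennreal (mean \<rho>\<^sub>0 excess / \<beta>)" by (intro mult_left_mono V) auto
    also have "\<dots> = ennreal (\<beta> * mean \<rho>\<^sub>0 excess)"
      using \<beta>_pos mean_excess_nonneg[OF flow_density[OF flow, of 0]]
      by (simp add: ennreal_mult[symmetric] power2_eq_square flow_0[OF flow])
    finally show "(\<integral>\<^sup>+t. ennreal (\<beta>\<^sup>2) * (V t * indicator {0..real i} t) \<partial>lborel) \<le> ennreal (\<beta> * mean \<rho>\<^sub>0 excess)" .
  qed
  finally show ?thesis .
qed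

end

end

section \<open>Growth of functions with bounded second derivatives\<close>

lemma Ck_2_imp_C1_grad:
  assumes "Ck 2 f"
  shows "C1_grad f (gradient f)" "b \<in> Basis \<Longrightarrow> C1_grad (partial_deriv b f) (gradient (partial_deriv b f))"
proof -
  have d: "f differentiable (at x)" and p: "b \<in> Basis \<Longrightarrow> Ck 1 (partial_deriv b f)" for x b
    using assms by (auto simp: numeral_2_eq_2)
  show "b \<in> Basis \<Longrightarrow> C1_grad (partial_deriv b f) (gradient (partial_deriv b f))" for b
    using p Ck_1_iff_C1_grad by blast
  then have "\<forall>b\<in>Basis. Ck 0 (partial_deriv b f)" using C1_grad_continuous by (simp only: Ck.simps) blast
  then have "Ck (Suc 0) f" using d by (simp only: Ck.simps) blast
  then show "C1_grad f (gradient f)" by (simp only: Ck_1_iff_C1_grad[symmetric] One_nat_def)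
qed

text \<open>The mean value inequality, applied to each partial derivative.\<close>

lemma gradient_linear_growth:
  fixes f :: "'a::euclidean_space \<Rightarrow> real"
  assumes f: "Ck 2 f" "bounded_hessian f"
  shows "\<exists>A\<ge>0. \<forall>x. norm (gradient f x) \<le> A * (1 + norm x)"
proof -
  have C: "C1_grad f (gradient f)" by (rule Ck_2_imp_C1_grad[OF f(1)])
  have "\<exists>A\<ge>0. \<forall>x. \<bar>partial_deriv b f x\<bar> \<le> A * (1 + norm x)" if b: "b \<in> Basis" for b
  proof -
    let ?p = "partial_deriv b f"
    have p: "C1_grad ?p (gradient ?p)" by (rule Ck_2_imp_C1_grad(2)[OF f(1) b])
    have "\<exists>B. \<forall>x. \<bar>partial_deriv c ?p x\<bar> \<le> B" if "c \<in> Basis" for c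
      using f(2) b that by (auto simp: bounded_hessian_def bounded_iff)
    then obtain B where B: "\<And>c x. c \<in> Basis \<Longrightarrow> \<bar>partial_deriv c ?p x\<bar> \<le> B c" by metis
    have g: "norm (gradient ?p x) \<le> sum B Basis" for x
    proof (rule order_trans[OF norm_le_l1 sum_mono])
      show "\<bar>gradient ?p x \<bullet> c\<bar> \<le> B c" if "c \<in> Basis" for c
        using B[OF that, of x] unfolding C1_grad_partial_deriv[OF p] .
    qed
    have l: "\<bar>?p x - ?p 0\<bar> \<le> sum B Basis * norm (x - 0)" for x
      by (rule C1_grad_mean_value_bound[OF p convex_UNIV _ _ g]) auto
    have s0: "0 \<le> sum B Basis" using g[of 0] norm_ge_zero order_trans by blast
    show ?thesis
    proof (intro exI[of _ "\<bar>?p 0\<bar> + sum B Basis"] conjI allI)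
      fix x
      have "\<bar>?p x\<bar> \<le> \<bar>?p 0\<bar> + sum B Basis * norm x" using l[of x] by simp
      also have "\<dots> \<le> (\<bar>?p 0\<bar> + sum B Basis) * (1 + norm x)"
        using s0 by (simp add: algebra_simps)
      finally show "\<bar>?p x\<bar> \<le> (\<bar>?p 0\<bar> + sum B Basis) * (1 + norm x)" .
    qed (use s0 in auto)
  qed
  then obtain A where A: "\<And>b. b \<in> Basis \<Longrightarrow> 0 \<le> A b" "\<And>b x. b \<in> Basis \<Longrightarrow> \<bar>partial_deriv b f x\<bar> \<le> A b * (1 + norm x)"
    by metis
  show ?thesis
  proof (intro exI[of _ "sum A Basis"] conjI allI)
    show "0 \<le> sum A Basis" by (intro sum_nonneg A(1))
    show "norm (gradient f x) \<le> sum A Basis * (1 + norm x)" for x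
      unfolding sum_distrib_right
      by (rule order_trans[OF norm_le_l1 sum_mono]) (use A(2) in \<open>simp only: C1_grad_partial_deriv[OF C]\<close>)
  qed
qed

lemma quadratic_growth:
  assumes f: "C1_grad f G" and A: "0 \<le> A" "\<And>x. norm (G x) \<le> A * (1 + norm x)"
  shows "\<bar>f x\<bar> \<le> (\<bar>f 0\<bar> + A) * (1 + norm x)\<^sup>2"
proof -
  have "\<bar>f x - f 0\<bar> \<le> (A * (1 + norm x)) * norm (x - 0)"
  proof (rule C1_grad_mean_value_bound[OF f convex_cball[of 0 "norm x"]])
    show "norm (G z) \<le> A * (1 + norm x)" if "z \<in> cball 0 (norm x)" for z
      using that A(1) by (intro order_trans[OF A(2)] mult_left_mono) auto
  qed auto
  then have "\<bar>f x\<bar> \<le> \<bar>f 0\<bar> + A * (1 + norm x) * norm x" by simp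
  also have "\<dots> \<le> \<bar>f 0\<bar> * (1 + norm x)\<^sup>2 + A * (1 + norm x) * (1 + norm x)"
    using A(1) by (intro add_mono mult_left_mono mult_right_mono) (auto simp: power2_eq_square algebra_simps)
  finally show ?thesis by (simp add: power2_eq_square algebra_simps)
qed

lemma one_plus_power_le_exp: "0 \<le> (y::real) \<Longrightarrow> (1 + y) ^ n \<le> exp (real n * y)"
  using power_mono[OF exp_ge_add_one_self, of y n] by (simp add: exp_of_nat_mult)

text \<open>The ball of radius \<open>n + 1\<close> has volume at most \<open>4\<^sup>d exp (d n)\<close>, where \<open>d\<close> is the dimension, so
  with the exponent \<open>d + 1\<close> the unit shells contribute a geometric series.\<close>

lemma integrable_exp_neg_norm:
  "integrable lborel (\<lambda>x::'a::euclidean_space. exp (- (real (DIM('a)) + 1) * norm x))"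
proof (rule integrableI_nonneg)
  let ?d = "DIM('a)" and ?K = "real (DIM('a)) + 1"
  let ?g = "\<lambda>n x. ennreal (exp (- ?K * real n)) * indicator (cball 0 (real (Suc n))) (x::'a)"
  have "(\<integral>\<^sup>+x. ennreal (exp (- ?K * norm x)) \<partial>(lborel::'a measure)) \<le> (\<integral>\<^sup>+x. (\<Sum>n. ?g n x) \<partial>lborel)"
  proof (intro nn_integral_mono)
    fix x :: 'a
    define n where "n = nat \<lfloor>norm x\<rfloor>"
    have n: "real n \<le> norm x" "norm x \<le> real (Suc n)" unfolding n_def by (auto simp: floor_le_iff le_of_int_ceiling) linarith
    have "ennreal (exp (- ?K * norm x)) \<le> ?g n x"
      using n by (auto simp: indicator_def intro!: ennreal_leI mult_left_mono)
    also have "\<dots> = (\<Sum>k\<in>{n}. ?g k x)"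
      by (simp only: sum.insert finite.emptyI empty_iff not_False_eq_True sum.empty add_0_right)
    also have "\<dots> \<le> (\<Sum>k. ?g k x)" by (rule sum_le_suminf) auto
    finally show "ennreal (exp (- ?K * norm x)) \<le> (\<Sum>n. ?g n x)" .
  qed
  also have "\<dots> = (\<Sum>n. \<integral>\<^sup>+x. ?g n x \<partial>(lborel::'a measure))"
    by (rule nn_integral_suminf)
      (intro borel_measurable_times_ennreal borel_measurable_const borel_measurable_indicator; simp)
  also have "\<dots> \<le> (\<Sum>n. ennreal (4 ^ ?d * exp (- real n)))"
  proof (intro suminf_le summableI)
    fix n
    have sub: "cball (0::'a) (real (Suc n)) \<subseteq> cbox (- (real (Suc n) *\<^sub>R One)) (real (Suc n) *\<^sub>R One)"
    proof
      fix x :: 'a assume "x \<in> cball 0 (real (Suc n))"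
      then have "\<bar>x \<bullet> i\<bar> \<le> real (Suc n)" if "i \<in> Basis" for i
        using Basis_le_norm[OF that, of x] by (simp del: of_nat_Suc)
      then show "x \<in> cbox (- (real (Suc n) *\<^sub>R One)) (real (Suc n) *\<^sub>R One)"
        unfolding mem_box by (fastforce simp: abs_le_iff simp del: of_nat_Suc)
    qed
    have "emeasure lborel (cball (0::'a) (real (Suc n))) \<le> emeasure lborel (cbox (- (real (Suc n) *\<^sub>R One)) (real (Suc n) *\<^sub>R (One::'a)))"
      by (rule emeasure_mono[OF sub]) simp
    also have "\<dots> = ennreal ((2 * real (Suc n)) ^ ?d)"
      by (subst emeasure_lborel_cbox) (auto simp: algebra_simps simp del: of_nat_Suc)
    also have "\<dots> \<le> ennreal (4 ^ ?d * exp (real ?d * real n))"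
    proof (rule ennreal_leI)
      have "(2 * real (Suc n)) ^ ?d = 2 ^ ?d * (1 + real n) ^ ?d" by (simp only: power_mult_distrib of_nat_Suc)
      also have "\<dots> \<le> 4 ^ ?d * exp (real ?d * real n)"
        by (intro mult_mono one_plus_power_le_exp power_mono) auto
      finally show "(2 * real (Suc n)) ^ ?d \<le> 4 ^ ?d * exp (real ?d * real n)" .
    qed
    finally have "ennreal (exp (- ?K * real n)) * emeasure lborel (cball (0::'a) (real (Suc n))) \<le>
        ennreal (exp (- ?K * real n)) * ennreal (4 ^ ?d * exp (real ?d * real n))"
      by (rule mult_left_mono) simp
    also have "\<dots> = ennreal (4 ^ ?d * exp (- real n))"
      by (simp add: ennreal_mult[symmetric] exp_add[symmetric] algebra_simps)
    finally show "(\<integral>\<^sup>+x. ?g n x \<partial>(lborel::'a measure)) \<le> ennreal (4 ^ ?d * exp (- real n))"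
      by (subst nn_integral_cmult_indicator) auto
  qed
  also have "\<dots> < \<infinity>"
  proof -
    have "summable (\<lambda>n. 4 ^ ?d * exp (- 1 :: real) ^ n)" by (intro summable_mult summable_geometric) simp
    then have "summable (\<lambda>n. 4 ^ ?d * exp (- real n))" by (simp add: exp_of_nat_mult[symmetric])
    then have "(\<Sum>n. ennreal (4 ^ ?d * exp (- real n))) \<noteq> top" by (intro ennreal_suminf_neq_top) auto
    then show ?thesis by (simp add: less_top)
  qed
  finally show "(\<integral>\<^sup>+x. ennreal (exp (- ?K * norm x)) \<partial>(lborel::'a measure)) < \<infinity>" .
qed auto

section \<open>Potentials that grow faster than linearly\<close>

text \<open>The radial derivative tends to infinity.\<close>

definition superlinear :: "('a::euclidean_space \<Rightarrow> 'a) \<Rightarrow> bool" where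
  "superlinear G \<longleftrightarrow> (\<forall>K. \<exists>R. \<forall>x. R \<le> norm x \<longrightarrow> K * norm x \<le> G x \<bullet> x)"

lemma less_liminf_radialD:
  assumes "ereal c < liminf_radial f"
  shows "\<exists>R. \<forall>x. R \<le> norm x \<longrightarrow> c * norm x \<le> gradient f x \<bullet> x"
proof -
  have "eventually (\<lambda>x. ereal c < ereal (gradient f x \<bullet> (x /\<^sub>R norm x))) at_infinity"
    using assms unfolding liminf_radial_def by (rule less_LiminfD)
  then obtain R where R: "\<And>x. R \<le> norm x \<Longrightarrow> c < gradient f x \<bullet> (x /\<^sub>R norm x)"
    by (auto simp: eventually_at_infinity)
  have "c * norm x \<le> gradient f x \<bullet> x" if "R \<le> norm x" for x
  proof (cases "x = 0")
    case False
    then show ?thesis using R[OF that] by (simp add: field_simps)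
  qed simp
  then show ?thesis by blast
qed

lemma superlinear_perturbation:
  assumes V: "liminf_radial V = \<infinity>" and h: "- \<infinity> < liminf_radial h" and t: "0 \<le> t"
  shows "superlinear (\<lambda>x. gradient V x + t *\<^sub>R gradient h x)"
  unfolding superlinear_def
proof
  fix K
  obtain c where c: "ereal c < liminf_radial h" using h ereal_dense2 by blast
  obtain R1 where R1: "\<And>x. R1 \<le> norm x \<Longrightarrow> c * norm x \<le> gradient h x \<bullet> x"
    using less_liminf_radialD[OF c] by blast
  obtain R2 where R2: "\<And>x. R2 \<le> norm x \<Longrightarrow> (K - t * c) * norm x \<le> gradient V x \<bullet> x"
    using less_liminf_radialD[of "K - t * c" V] V by auto
  have "K * norm x \<le> (gradient V x + t *\<^sub>R gradient h x) \<bullet> x" if "max R1 R2 \<le> norm x" for x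
    using R2[of x] mult_left_mono[OF R1[of x] t] that by (simp add: inner_add_left algebra_simps)
  then show "\<exists>R. \<forall>x. R \<le> norm x \<longrightarrow> K * norm x \<le> (gradient V x + t *\<^sub>R gradient h x) \<bullet> x" by blast
qed

text \<open>Moving the start of a ray from the origin to a point \<open>q\<close> of the unit ball changes the radial
  derivative by at most the norm of the gradient. That is at most linear in the distance, whereas \<open>G x \<bullet> x\<close>
  exceeds every multiple of it, so the potential still grows at any prescribed slope along the ray.\<close>

lemma superlinear_along_rays:
  assumes U: "C1_grad U G" and A: "0 \<le> A" "\<And>x. norm (G x) \<le> A * (1 + norm x)" and S: "superlinear G"
  shows "\<exists>R\<ge>1. \<forall>x q r. R \<le> norm x \<longrightarrow> norm q \<le> 1 \<longrightarrow> 0 \<le> r \<longrightarrow>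
    U x + K * norm (r *\<^sub>R (x - q)) \<le> U (x + r *\<^sub>R (x - q))"
proof -
  obtain R0 where R0: "\<And>x. R0 \<le> norm x \<Longrightarrow> (2 * A + 2 * \<bar>K\<bar>) * norm x \<le> G x \<bullet> x"
    using S by (auto simp: superlinear_def)
  define R where "R = max 1 R0"
  have "U x + K * norm (r *\<^sub>R (x - q)) \<le> U (x + r *\<^sub>R (x - q))"
    if x: "R \<le> norm x" and q: "norm q \<le> 1" and r: "0 \<le> r" for x q r
  proof (cases "r = 0")
    case False
    then have r: "0 < r" using r by simp
    define y where "y \<tau> = x + \<tau> *\<^sub>R (x - q)" for \<tau>
    have yq: "y \<tau> - q = (1 + \<tau>) *\<^sub>R (x - q)" for \<tau> by (simp add: y_def algebra_simps)
    have slope: "\<bar>K\<bar> * norm (x - q) \<le> G (y \<tau>) \<bullet> (x - q)" if "0 < \<tau>" for \<tau>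
    proof -
      have "norm ((1 + \<tau>) *\<^sub>R x) - norm (\<tau> *\<^sub>R q) \<le> norm ((1 + \<tau>) *\<^sub>R x - \<tau> *\<^sub>R q)" by (rule norm_triangle_ineq2)
      also have "(1 + \<tau>) *\<^sub>R x - \<tau> *\<^sub>R q = y \<tau>" by (simp add: y_def algebra_simps)
      finally have "(1 + \<tau>) * norm x - \<tau> * norm q \<le> norm (y \<tau>)" using \<open>0 < \<tau>\<close> by simp
      moreover have "\<tau> * norm q \<le> \<tau> * norm x" using q x \<open>0 < \<tau>\<close> unfolding R_def by (intro mult_left_mono) auto
      ultimately have ny: "R \<le> norm (y \<tau>)" using x by (simp add: algebra_simps)
      then have ny1: "1 \<le> norm (y \<tau>)" "R0 \<le> norm (y \<tau>)" by (auto simp: R_def)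
      have "G (y \<tau>) \<bullet> q \<le> norm (G (y \<tau>)) * norm q" by (rule norm_cauchy_schwarz)
      also have "\<dots> \<le> (A * (1 + norm (y \<tau>))) * 1" using A q by (intro mult_mono) auto
      also have "\<dots> \<le> 2 * A * norm (y \<tau>)" using mult_left_mono[OF ny1(1) A(1)] by (simp add: algebra_simps)
      finally have "2 * \<bar>K\<bar> * norm (y \<tau>) \<le> G (y \<tau>) \<bullet> (y \<tau> - q)"
        using R0[OF ny1(2)] by (simp add: inner_diff_right algebra_simps)
      moreover have "norm (y \<tau> - q) \<le> 2 * norm (y \<tau>)" using norm_triangle_ineq4[of "y \<tau>" q] q ny1 by simp
      then have "\<bar>K\<bar> * norm (y \<tau> - q) \<le> \<bar>K\<bar> * (2 * norm (y \<tau>))" by (intro mult_left_mono) auto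
      ultimately have "\<bar>K\<bar> * norm (y \<tau> - q) \<le> G (y \<tau>) \<bullet> (y \<tau> - q)" by linarith
      then have "(1 + \<tau>) * (\<bar>K\<bar> * norm (x - q)) \<le> (1 + \<tau>) * (G (y \<tau>) \<bullet> (x - q))"
        using \<open>0 < \<tau>\<close> unfolding yq by (simp add: mult.left_commute)
      then show ?thesis using \<open>0 < \<tau>\<close> by simp
    qed
    have "((\<lambda>\<tau>. U (y \<tau>)) has_real_derivative G (y \<tau>) \<bullet> (x - q)) (at \<tau>)" for \<tau>
    proof -
      have "(y has_derivative (\<lambda>v. v *\<^sub>R (x - q))) (at \<tau>)" unfolding y_def[abs_def] by (auto intro!: derivative_eq_intros)
      from has_derivative_compose[OF this C1_grad_derivative[OF U]]
      show ?thesis by (simp add: has_field_derivative_def mult.commute[of "_ \<bullet> _"] mult_commute_abs)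
    qed
    then obtain \<tau> where \<tau>: "0 < \<tau>" "\<tau> < r" "U (y r) - U (y 0) = (r - 0) * (G (y \<tau>) \<bullet> (x - q))"
      using MVT2[OF r, of "\<lambda>\<tau>. U (y \<tau>)" "\<lambda>\<tau>. G (y \<tau>) \<bullet> (x - q)"] by blast
    have "K * norm (r *\<^sub>R (x - q)) \<le> r * (\<bar>K\<bar> * norm (x - q))"
      using r by (simp add: mult.left_commute mult_right_mono)
    also have "\<dots> \<le> r * (G (y \<tau>) \<bullet> (x - q))" using slope[OF \<tau>(1)] r by (intro mult_left_mono) auto
    finally show ?thesis using \<tau>(3) by (simp add: y_def)
  qed simp
  then show ?thesis by (intro exI[of _ R]) (auto simp: R_def)
qed

text \<open>Rays from the origin, starting at the sphere of radius \<open>R\<close>; inside it the potential is bounded.\<close>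

lemma superlinear_lower_bound:
  assumes U: "C1_grad U G" and A: "0 \<le> A" "\<And>x. norm (G x) \<le> A * (1 + norm x)" and S: "superlinear G"
    and K: "0 \<le> K"
  shows "\<exists>C>0. \<forall>x. exp (- U x) \<le> C * exp (- K * norm x)"
proof -
  obtain R where R: "1 \<le> R" "\<And>x q r. R \<le> norm x \<Longrightarrow> norm q \<le> 1 \<Longrightarrow> 0 \<le> r \<Longrightarrow>
      U x + K * norm (r *\<^sub>R (x - q)) \<le> U (x + r *\<^sub>R (x - q))"
    using superlinear_along_rays[OF U A S, of K] by blast
  have "bounded (U ` cball 0 R)"
    by (intro compact_imp_bounded compact_continuous_image C1_grad_continuous[OF U]) auto
  then obtain m where "\<forall>y\<in>U ` cball 0 R. norm y \<le> m" unfolding bounded_iff by blast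
  then have m: "\<bar>U x\<bar> \<le> m" if "norm x \<le> R" for x using that by auto
  have low: "- m - K * R + K * norm x \<le> U x" for x
  proof (cases "norm x \<le> R")
    case True
    then have "K * norm x \<le> K * R" using K by (rule mult_left_mono)
    then show ?thesis using m[OF True] by linarith
  next
    case False
    then have x: "0 < norm x" "R < norm x" using R(1) by auto
    let ?y = "(R / norm x) *\<^sub>R x"
    have y: "norm ?y = R" using R(1) x by simp
    have "?y + (norm x / R - 1) *\<^sub>R (?y - 0) = x" using R(1) x by (simp add: algebra_simps)
    moreover have "norm ((norm x / R - 1) *\<^sub>R (?y - 0)) = norm x - R"
    proof -
      have "norm ((norm x / R - 1) *\<^sub>R (?y - 0)) = \<bar>norm x / R - 1\<bar> * R"
        by (subst norm_scaleR) (simp only: diff_0_right y)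
      also have "\<dots> = norm x - R" using R(1) x by (simp add: field_simps abs_of_nonneg)
      finally show ?thesis .
    qed
    ultimately have "U ?y + K * (norm x - R) \<le> U x"
      using R(2)[of ?y 0 "norm x / R - 1"] y R(1) x by simp
    then show ?thesis using m[of ?y] y by (simp add: algebra_simps abs_le_iff)
  qed
  have "exp (- U x) \<le> exp (m + K * R) * exp (- K * norm x)" for x
    unfolding exp_add[symmetric] using low[of x] by simp
  then show ?thesis by (intro exI[of _ "exp (m + K * R)"]) auto
qed

section \<open>An explicit solution of the divergence equation\<close>

text \<open>For a source \<open>s\<close>, the field \<open>x \<mapsto> - (\<integral>\<^sub>1\<^sup>\<infinity> s (z + r (x - z)) r\<^bsup>d-1\<^esup> dr) (x - z)\<close> has divergence
  \<open>s\<close> away from its pole \<open>z\<close>. Average it over \<open>z\<close> with a density \<open>\<theta>\<close>, as Bogovskii does, and split the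
  integral at \<open>r = 2\<close>. With \<open>r = 1 + \<sigma>\<close> the part near \<open>x\<close> is \<open>- bogovskii \<theta> s\<close>. In the other part
  substitute the argument of \<open>s\<close> for \<open>z\<close> and put \<open>r = 1 + 1 / \<sigma>\<close>: it becomes \<open>bogovskii s \<theta>\<close>, the same
  expression with source and density exchanged. Neither part is singular.\<close>

definition bogovskii :: "('a::euclidean_space \<Rightarrow> real) \<Rightarrow> ('a \<Rightarrow> real) \<Rightarrow> 'a \<Rightarrow> 'a" where
  "bogovskii p q x = (\<integral>\<omega>. (indicator {0..1} (fst \<omega>) * (1 + fst \<omega>) ^ (DIM('a) - 1) * p (snd \<omega>) *
     q ((1 + fst \<omega>) *\<^sub>R x - fst \<omega> *\<^sub>R snd \<omega>)) *\<^sub>R (x - snd \<omega>) \<partial>(lborel \<Otimes>\<^sub>M lborel))"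

lemma integrable_indicator_times:
  fixes \<phi> :: "'a::euclidean_space \<Rightarrow> real"
  assumes \<phi>: "integrable lborel \<phi>"
  shows "integrable (lborel \<Otimes>\<^sub>M lborel) (\<lambda>\<omega>. indicator {0..1::real} (fst \<omega>) * \<phi> (snd \<omega>))"
proof (rule lborel_pair.Fubini_integrable)
  have [measurable]: "\<phi> \<in> borel_measurable borel" using \<phi> by auto
  show "(\<lambda>\<omega>. indicator {0..1::real} (fst \<omega>) * \<phi> (snd \<omega>)) \<in> borel_measurable (lborel \<Otimes>\<^sub>M lborel)" by measurable
  show "integrable lborel (\<lambda>s. LINT z|lborel. norm (indicator {0..1::real} (fst (s, z)) * \<phi> (snd (s, z))))"
    by (simp add: abs_mult)
  show "AE s in lborel. integrable lborel (\<lambda>z. indicator {0..1::real} (fst (s, z)) * \<phi> (snd (s, z)))"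
    using \<phi> by simp
qed

lemma integral_reflect:
  fixes f :: "'a::euclidean_space \<Rightarrow> real"
  assumes [measurable]: "f \<in> borel_measurable borel"
  shows "(LINT x|lborel. f (c - x)) = (LINT x|lborel. f x)"
proof -
  have "lborel = density (distr lborel borel (\<lambda>x::'a. c + (-1) *\<^sub>R x)) (\<lambda>_. ennreal (\<bar>-1\<bar> ^ DIM('a)))"
    by (rule lborel_affine) simp
  then have "lborel = distr lborel borel (\<lambda>x::'a. c - x)" by (simp add: density_1)
  then have "(LINT x|lborel. f x) = (LINT x|distr lborel borel (\<lambda>x::'a. c - x). f x)" by simp
  also have "\<dots> = (LINT x|lborel. f (c - x))" by (subst integral_distr) auto
  finally show ?thesis by simp
qed

text \<open>With \<open>y = (1 + \<sigma>) x - \<sigma> z\<close> and \<open>d\<close> the dimension, the divergence of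
  \<open>(1 + \<sigma>)\<^bsup>d-1\<^esup> q y (x - z)\<close> in \<open>x\<close> is the derivative of \<open>(1 + \<sigma>)\<^sup>d q y\<close> in \<open>\<sigma>\<close>. Hence the integral
  over \<open>\<sigma>\<close> leaves only the end points \<open>\<sigma> = 0\<close> and \<open>\<sigma> = 1\<close>.\<close>

lemma bogovskii_divergence:
  fixes p q :: "'a::euclidean_space \<Rightarrow> real"
  assumes pm[measurable]: "p \<in> borel_measurable borel"
    and p: "integrable lborel (\<lambda>z. (1 + norm z) * \<bar>p z\<bar>)"
    and q: "C1_grad q Q" and bd: "\<And>x. \<bar>q x\<bar> \<le> C" "\<And>x. norm (Q x) \<le> C"
  shows "\<exists>D. (\<forall>b\<in>Basis. C1_grad (\<lambda>x. bogovskii p q x \<bullet> b) (D b)) \<and>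
    (\<forall>x. (\<Sum>b\<in>Basis. D b x \<bullet> b) = 2 ^ DIM('a) * (LINT z|lborel. p z * q (2 *\<^sub>R x - z)) - q x * (LINT z|lborel. p z))"
proof -
  let ?d = "DIM('a)" and ?M = "lborel \<Otimes>\<^sub>M lborel :: (real \<times> 'a) measure"
  have [measurable]: "q \<in> borel_measurable borel" "Q \<in> borel_measurable borel"
    by (auto intro!: borel_measurable_continuous_onI C1_grad_continuous[OF q] C1_grad_continuous_grad[OF q])
  have C0: "0 \<le> C" using bd(1)[of 0] by linarith
  define w where "w \<omega> = indicator {0..1} (fst \<omega>) * (1 + fst \<omega>) ^ (?d - 1) * p (snd \<omega>)" for \<omega> :: "real \<times> 'a"
  have [measurable]: "w \<in> borel_measurable ?M" unfolding w_def[abs_def] by measurable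
  define y where "y x \<omega> = (1 + fst \<omega>) *\<^sub>R x - fst \<omega> *\<^sub>R snd \<omega>" for x :: 'a and \<omega> :: "real \<times> 'a"
  have [measurable]: "y x \<in> borel_measurable ?M" for x unfolding y_def[abs_def] by measurable
  define f where "f b x \<omega> = w \<omega> * q (y x \<omega>) * ((x - snd \<omega>) \<bullet> b)" for b x \<omega>
  define D where "D b x \<omega> = w \<omega> *\<^sub>R (((1 + fst \<omega>) * ((x - snd \<omega>) \<bullet> b)) *\<^sub>R Q (y x \<omega>) + q (y x \<omega>) *\<^sub>R b)" for b x \<omega>
  have dom: "norm (w \<omega> *\<^sub>R v) \<le> indicator {0..1} (fst \<omega>) * ((2 ^ ?d * (c * (r + 3))) * ((1 + norm (snd \<omega>)) * \<bar>p (snd \<omega>)\<bar>))"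
    if "fst \<omega> \<in> {0..1} \<Longrightarrow> norm v \<le> c * (1 + 2 * norm (x - snd \<omega>))" "norm x \<le> r" "0 \<le> c" for \<omega> and v :: "'b::real_normed_vector" and x c r
  proof (cases "fst \<omega> \<in> {0..1}")
    case True
    have "1 + 2 * norm (x - snd \<omega>) \<le> 2 * ((r + 3) * (1 + norm (snd \<omega>)))"
    proof -
      have "norm (x - snd \<omega>) \<le> r + norm (snd \<omega>)" using norm_triangle_ineq4[of x "snd \<omega>"] that(2) by linarith
      moreover have "0 \<le> r * norm (snd \<omega>)" by (intro mult_nonneg_nonneg order_trans[OF norm_ge_zero that(2)] norm_ge_zero)
      ultimately show ?thesis
        using norm_ge_zero[of "snd \<omega>"] by (simp add: algebra_simps del: norm_ge_zero)
    qed
    then have "norm v \<le> c * (2 * ((r + 3) * (1 + norm (snd \<omega>))))"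
      using that(1)[OF True] mult_left_mono[OF _ that(3)] order_trans by blast
    then have "norm (w \<omega> *\<^sub>R v) \<le> (2 ^ (?d - 1) * \<bar>p (snd \<omega>)\<bar>) * (c * (2 * ((r + 3) * (1 + norm (snd \<omega>)))))"
      unfolding norm_scaleR
    proof (intro mult_mono)
      have "(1 + fst \<omega>) ^ (?d - 1) \<le> 2 ^ (?d - 1)" using True by (intro power_mono) auto
      then show "\<bar>w \<omega>\<bar> \<le> 2 ^ (?d - 1) * \<bar>p (snd \<omega>)\<bar>" using True by (simp add: w_def abs_mult mult_right_mono)
    qed auto
    also have "\<dots> = (2 ^ (?d - 1) * 2) * (c * (r + 3)) * ((1 + norm (snd \<omega>)) * \<bar>p (snd \<omega>)\<bar>)" by (simp only: ac_simps)
    also have "2 ^ (?d - 1) * 2 = (2 ^ ?d :: real)" using DIM_positive[where 'a='a] by (simp flip: power_Suc2)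
    finally show ?thesis using True by simp
  qed (simp add: w_def)
  have domi: "integrable ?M (\<lambda>\<omega>. indicator {0..1} (fst \<omega>) * (c * ((1 + norm (snd \<omega>)) * \<bar>p (snd \<omega>)\<bar>)))" for c
    by (rule integrable_indicator_times[OF integrable_mult_right[OF p]])
  have fb: "\<bar>q (y x \<omega>) * ((x - snd \<omega>) \<bullet> b)\<bar> \<le> C * (1 + 2 * norm (x - snd \<omega>))" if "b \<in> Basis" for b x \<omega>
    unfolding abs_mult using Basis_le_norm[OF that, of "x - snd \<omega>"] C0 bd(1)[of "y x \<omega>"] by (intro mult_mono) auto
  have fi: "integrable ?M (f b x)" if b: "b \<in> Basis" for b x
  proof (rule Bochner_Integration.integrable_bound[OF domi])
    show "f b x \<in> borel_measurable ?M" unfolding f_def[abs_def] by measurable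
    have "norm (w \<omega> *\<^sub>R (q (y x \<omega>) * ((x - snd \<omega>) \<bullet> b))) \<le>
        indicator {0..1} (fst \<omega>) * ((2 ^ ?d * (C * (norm x + 3))) * ((1 + norm (snd \<omega>)) * \<bar>p (snd \<omega>)\<bar>))" for \<omega>
      by (rule dom[OF _ order_refl C0]) (use fb[OF b] in simp)
    then show "AE \<omega> in ?M. norm (f b x \<omega>) \<le> norm (indicator {0..1} (fst \<omega>) *
        ((2 ^ ?d * (C * (norm x + 3))) * ((1 + norm (snd \<omega>)) * \<bar>p (snd \<omega>)\<bar>)))"
      by (intro AE_I2) (simp only: f_def real_scaleR_def mult.assoc real_norm_def order_trans[OF _ abs_ge_self])
  qed
  have Dbd: "norm (((1 + fst \<omega>) * ((x - snd \<omega>) \<bullet> b)) *\<^sub>R Q (y x \<omega>) + q (y x \<omega>) *\<^sub>R b) \<le> C * (1 + 2 * norm (x - snd \<omega>))"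
    if b: "b \<in> Basis" and "fst \<omega> \<in> {0..1}" for b x \<omega>
  proof -
    have "norm (((1 + fst \<omega>) * ((x - snd \<omega>) \<bullet> b)) *\<^sub>R Q (y x \<omega>)) \<le> (2 * norm (x - snd \<omega>)) * C"
      unfolding norm_scaleR using that Basis_le_norm[OF b, of "x - snd \<omega>"] bd(2)[of "y x \<omega>"]
      by (intro mult_mono) (auto simp: abs_mult intro!: mult_mono)
    moreover have "norm (q (y x \<omega>) *\<^sub>R b) \<le> C" using b bd(1) by simp
    ultimately show ?thesis
      using norm_triangle_ineq[of "((1 + fst \<omega>) * ((x - snd \<omega>) \<bullet> b)) *\<^sub>R Q (y x \<omega>)" "q (y x \<omega>) *\<^sub>R b"]
      by (simp add: algebra_simps)
  qed
  have C1: "C1_grad (\<lambda>x. \<integral>\<omega>. f b x \<omega> \<partial>?M) (\<lambda>x. \<integral>\<omega>. D b x \<omega> \<partial>?M)" and Di: "integrable ?M (D b x)"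
    if b: "b \<in> Basis" for b x
  proof -
    have der: "((\<lambda>x. f b x \<omega>) has_derivative (\<lambda>v. D b x \<omega> \<bullet> v)) (at x)" for x \<omega>
    proof -
      have "((\<lambda>x. y x \<omega>) has_derivative (\<lambda>v. (1 + fst \<omega>) *\<^sub>R v)) (at x)"
        unfolding y_def by (auto intro!: derivative_eq_intros)
      from has_derivative_compose[OF this C1_grad_derivative[OF q]]
      have qy: "((\<lambda>x. q (y x \<omega>)) has_derivative (\<lambda>v. (1 + fst \<omega>) * (Q (y x \<omega>) \<bullet> v))) (at x)" by simp
      have "((\<lambda>x. (x - snd \<omega>) \<bullet> b) has_derivative (\<lambda>v. v \<bullet> b)) (at x)"
        by (auto intro!: derivative_eq_intros)
      from has_derivative_mult_right[OF has_derivative_mult[OF qy this], of "w \<omega>"]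
      show ?thesis unfolding f_def D_def
        by (rule has_derivative_eq_rhs[OF has_derivative_transform_eventually[OF _ always_eventually]])
          (auto simp: fun_eq_iff inner_add_left algebra_simps inner_commute)
    qed
    have cont: "continuous_on UNIV (\<lambda>x. D b x \<omega>)" for \<omega>
      unfolding D_def y_def
      by (intro continuous_intros continuous_on_compose2[OF C1_grad_continuous_grad[OF q, of UNIV]]
          continuous_on_compose2[OF C1_grad_continuous[OF q, of UNIV]]) auto
    have Dm: "D b x \<in> borel_measurable ?M" for x unfolding D_def[abs_def] by measurable
    have dm: "\<exists>G. integrable ?M G \<and> (\<forall>x'\<in>ball x 1. \<forall>\<omega>. norm (D b x' \<omega>) \<le> G \<omega>)" for x
    proof (intro exI[of _ "\<lambda>\<omega>. indicator {0..1} (fst \<omega>) * ((2 ^ ?d * (C * ((norm x + 1) + 3))) * ((1 + norm (snd \<omega>)) * \<bar>p (snd \<omega>)\<bar>))"]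
        conjI domi ballI allI)
      fix x' \<omega> assume "x' \<in> ball x 1"
      then have nx: "norm x' \<le> norm x + 1" using norm_triangle_ineq2[of x' x] by (simp add: dist_norm norm_minus_commute)
      show "norm (D b x' \<omega>) \<le> indicator {0..1} (fst \<omega>) * ((2 ^ ?d * (C * ((norm x + 1) + 3))) * ((1 + norm (snd \<omega>)) * \<bar>p (snd \<omega>)\<bar>))"
        unfolding D_def by (rule dom[OF Dbd[OF b] nx C0])
    qed
    show "C1_grad (\<lambda>x. \<integral>\<omega>. f b x \<omega> \<partial>?M) (\<lambda>x. \<integral>\<omega>. D b x \<omega> \<partial>?M)"
      by (rule C1_grad_integral(1)[OF der cont fi[OF b] Dm dm])
    show "integrable ?M (D b x)" by (rule C1_grad_integral(2)[OF der cont fi[OF b] Dm dm])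
  qed
  have bi: "integrable ?M (\<lambda>\<omega>. (w \<omega> * q (y x \<omega>)) *\<^sub>R (x - snd \<omega>))" for x
  proof (rule Bochner_Integration.integrable_bound[OF domi])
    show "(\<lambda>\<omega>. (w \<omega> * q (y x \<omega>)) *\<^sub>R (x - snd \<omega>)) \<in> borel_measurable ?M" by measurable
    have "norm (w \<omega> *\<^sub>R (q (y x \<omega>) *\<^sub>R (x - snd \<omega>))) \<le>
        indicator {0..1} (fst \<omega>) * ((2 ^ ?d * (C * (norm x + 3))) * ((1 + norm (snd \<omega>)) * \<bar>p (snd \<omega>)\<bar>))" for \<omega>
      by (rule dom[OF _ order_refl C0]) (use bd(1)[of "y x \<omega>"] C0 in \<open>auto intro!: mult_mono\<close>)
    then show "AE \<omega> in ?M. norm ((w \<omega> * q (y x \<omega>)) *\<^sub>R (x - snd \<omega>)) \<le> norm (indicator {0..1} (fst \<omega>) *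
        ((2 ^ ?d * (C * (norm x + 3))) * ((1 + norm (snd \<omega>)) * \<bar>p (snd \<omega>)\<bar>)))"
      by (intro AE_I2) (simp only: scaleR_scaleR[symmetric] order_trans[OF _ abs_ge_self] real_norm_def)
  qed
  have eq: "bogovskii p q x \<bullet> b = (\<integral>\<omega>. f b x \<omega> \<partial>?M)" for b x
  proof -
    have "bogovskii p q x = (\<integral>\<omega>. (w \<omega> * q (y x \<omega>)) *\<^sub>R (x - snd \<omega>) \<partial>?M)"
      by (simp add: bogovskii_def w_def y_def)
    then show ?thesis using integral_inner_left[OF bi, of x b] by (simp add: f_def)
  qed
  have div: "(\<Sum>b\<in>Basis. (\<integral>\<omega>. D b x \<omega> \<partial>?M) \<bullet> b) =
      2 ^ ?d * (LINT z|lborel. p z * q (2 *\<^sub>R x - z)) - q x * (LINT z|lborel. p z)" for x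
  proof -
    let ?h = "\<lambda>\<omega>. \<Sum>b\<in>Basis. D b x \<omega> \<bullet> b"
    have hi: "integrable ?M ?h" using Di by (intro Bochner_Integration.integrable_sum integrable_inner_left) auto
    have "(\<Sum>b\<in>Basis. (\<integral>\<omega>. D b x \<omega> \<partial>?M) \<bullet> b) = (\<integral>\<omega>. ?h \<omega> \<partial>?M)"
      using Di by (subst Bochner_Integration.integral_sum) (auto simp: integral_inner_left)
    also have "\<dots> = (LINT z|lborel. LINT s|lborel. ?h (s, z))"
      using lborel_pair.integral_snd[of "\<lambda>s z. ?h (s, z)"] hi by (simp add: case_prod_beta')
    also have "\<dots> = (LINT z|lborel. p z * (2 ^ ?d * q (2 *\<^sub>R x - z) - q x))"
    proof (intro Bochner_Integration.integral_cong refl)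
      fix z
      define e where "e s = (1 + s) ^ (?d - 1) * ((1 + s) * (Q ((1 + s) *\<^sub>R x - s *\<^sub>R z) \<bullet> (x - z)) + real ?d * q ((1 + s) *\<^sub>R x - s *\<^sub>R z))" for s
      have h: "?h (s, z) = p z * (indicator {0..1} s *\<^sub>R e s)" for s
      proof -
        have "?h (s, z) = w (s, z) * ((\<Sum>b\<in>Basis. (1 + s) * (((x - z) \<bullet> b) * (Q (y x (s, z)) \<bullet> b))) + (\<Sum>b\<in>(Basis::'a set). q (y x (s, z))))"
        proof -
          have "D b x (s, z) \<bullet> b = w (s, z) * ((1 + s) * (((x - z) \<bullet> b) * (Q (y x (s, z)) \<bullet> b)) + q (y x (s, z)))"
            if "b \<in> Basis" for b
            using that by (simp add: D_def inner_add_left ac_simps)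
          then show ?thesis unfolding sum.distrib[symmetric] sum_distrib_left by (intro sum.cong) simp_all
        qed
        also have "(\<Sum>b\<in>Basis. (1 + s) * (((x - z) \<bullet> b) * (Q (y x (s, z)) \<bullet> b))) = (1 + s) * (Q (y x (s, z)) \<bullet> (x - z))"
          unfolding sum_distrib_left[symmetric] euclidean_inner[of "x - z" "Q _", symmetric] by (simp add: inner_commute)
        finally show ?thesis by (simp add: w_def y_def e_def)
      qed
      have "(LINT s|lborel. indicator {0..1} s *\<^sub>R e s) = (1 + 1) ^ ?d * q ((1 + 1) *\<^sub>R x - 1 *\<^sub>R z) - (1 + 0) ^ ?d * q ((1 + 0) *\<^sub>R x - 0 *\<^sub>R z)"
      proof (rule integral_FTC_Icc)
        fix s :: real
        have "((\<lambda>s. (1 + s) *\<^sub>R x - s *\<^sub>R z) has_derivative (\<lambda>v. v *\<^sub>R (x - z))) (at s)"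
          by (auto intro!: derivative_eq_intros simp: algebra_simps)
        from has_derivative_compose[OF this C1_grad_derivative[OF q]]
        have 1: "((\<lambda>s. q ((1 + s) *\<^sub>R x - s *\<^sub>R z)) has_real_derivative Q ((1 + s) *\<^sub>R x - s *\<^sub>R z) \<bullet> (x - z)) (at s)"
          by (simp add: has_field_derivative_def mult_commute_abs)
        have 2: "((\<lambda>s. (1 + s) ^ ?d) has_real_derivative real ?d * (1 + s) ^ (?d - 1)) (at s)"
          by (auto intro!: derivative_eq_intros)
        have pd: "(1 + s) ^ ?d = (1 + s) ^ (?d - 1) * (1 + s)" using DIM_positive[where 'a='a] by (simp flip: power_Suc2)
        have "((\<lambda>s. (1 + s) ^ ?d * q ((1 + s) *\<^sub>R x - s *\<^sub>R z)) has_real_derivative e s) (at s)"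
          by (rule DERIV_cong[OF DERIV_mult[OF 2 1]]) (simp add: e_def pd algebra_simps)
        then show "((\<lambda>s. (1 + s) ^ ?d * q ((1 + s) *\<^sub>R x - s *\<^sub>R z)) has_vector_derivative e s) (at s within {0..1})"
          by (simp add: has_real_derivative_iff_has_vector_derivative has_vector_derivative_at_within)
        show "continuous_on {0..1} e"
          unfolding e_def by (intro continuous_intros continuous_on_compose2[OF C1_grad_continuous_grad[OF q, of UNIV]]
              continuous_on_compose2[OF C1_grad_continuous[OF q, of UNIV]]) auto
      qed simp
      then show "(LINT s|lborel. ?h (s, z)) = p z * (2 ^ ?d * q (2 *\<^sub>R x - z) - q x)"
        unfolding h by simp
    qed
    also have "\<dots> = (LINT z|lborel. 2 ^ ?d * (p z * q (2 *\<^sub>R x - z)) - q x * p z)"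
      by (simp add: algebra_simps)
    also have "\<dots> = 2 ^ ?d * (LINT z|lborel. p z * q (2 *\<^sub>R x - z)) - q x * (LINT z|lborel. p z)"
    proof -
      have ip: "integrable lborel p"
      proof (rule Bochner_Integration.integrable_bound[OF p])
        show "AE z in lborel. norm (p z) \<le> norm ((1 + norm z) * \<bar>p z\<bar>)"
          by (intro AE_I2) (simp add: abs_mult mult_le_cancel_right1 abs_of_nonneg)
      qed measurable
      have ipq: "integrable lborel (\<lambda>z. p z * q (2 *\<^sub>R x - z))"
      proof (rule Bochner_Integration.integrable_bound[OF integrable_mult_right[OF ip, of C]])
        show "AE z in lborel. norm (p z * q (2 *\<^sub>R x - z)) \<le> norm (C * p z)"
          using bd(1) C0 by (intro AE_I2) (auto simp: abs_mult mult.commute[of C] intro!: mult_left_mono)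
      qed measurable
      show ?thesis using ip ipq by simp
    qed
    finally show ?thesis .
  qed
  show ?thesis
    by (intro exI[of _ "\<lambda>b x. \<integral>\<omega>. D b x \<omega> \<partial>?M"] conjI ballI allI div) (simp add: eq C1)
qed

lemma norm_integral_le:
  fixes f :: "'b \<Rightarrow> 'a::euclidean_space"
  assumes f: "f \<in> borel_measurable M" and g: "integrable M g" and le: "\<And>\<omega>. norm (f \<omega>) \<le> g \<omega>"
  shows "norm (\<integral>\<omega>. f \<omega> \<partial>M) \<le> (\<integral>\<omega>. g \<omega> \<partial>M)"
proof -
  have i: "integrable M f"
    by (rule Bochner_Integration.integrable_bound[OF g f])
      (intro AE_I2 order_trans[OF le abs_ge_self, folded real_norm_def])
  show ?thesis by (rule order_trans[OF integral_norm_bound integral_mono[OF integrable_norm[OF i] g le]])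
qed

lemma integral_indicator_times:
  fixes \<phi> :: "'a::euclidean_space \<Rightarrow> real"
  assumes \<phi>: "integrable lborel \<phi>"
  shows "(\<integral>\<omega>. indicator {0..1::real} (fst \<omega>) * \<phi> (snd \<omega>) \<partial>(lborel \<Otimes>\<^sub>M lborel)) = (LINT z|lborel. \<phi> z)"
  using lborel_pair.integral_fst'[OF integrable_indicator_times[OF \<phi>]] by simp

lemma norm_bogovskii_le:
  fixes p q :: "'a::euclidean_space \<Rightarrow> real"
  assumes [measurable]: "p \<in> borel_measurable borel" "q \<in> borel_measurable borel" and g: "integrable lborel g"
    and le: "\<And>\<sigma> z. \<sigma> \<in> {0..1} \<Longrightarrow> \<bar>p z\<bar> * \<bar>q ((1 + \<sigma>) *\<^sub>R x - \<sigma> *\<^sub>R z)\<bar> * norm (x - z) \<le> g z"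
  shows "norm (bogovskii p q x) \<le> 2 ^ DIM('a) * (LINT z|lborel. g z)"
proof -
  let ?M = "lborel \<Otimes>\<^sub>M lborel :: (real \<times> 'a) measure" and ?d = "DIM('a)"
  have "norm (bogovskii p q x) \<le> (\<integral>\<omega>. indicator {0..1::real} (fst \<omega>) * (2 ^ ?d * g (snd \<omega>)) \<partial>?M)"
    unfolding bogovskii_def
  proof (rule norm_integral_le)
    show "integrable ?M (\<lambda>\<omega>. indicator {0..1::real} (fst \<omega>) * (2 ^ ?d * g (snd \<omega>)))"
      by (rule integrable_indicator_times[OF integrable_mult_right[OF g]])
    fix \<omega> :: "real \<times> 'a"
    show "norm ((indicator {0..1} (fst \<omega>) * (1 + fst \<omega>) ^ (?d - 1) * p (snd \<omega>) *
        q ((1 + fst \<omega>) *\<^sub>R x - fst \<omega> *\<^sub>R snd \<omega>)) *\<^sub>R (x - snd \<omega>)) \<le> indicator {0..1} (fst \<omega>) * (2 ^ ?d * g (snd \<omega>))"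
    proof (cases "fst \<omega> \<in> {0..1}")
      case True
      then have "(1 + fst \<omega>) ^ (?d - 1) \<le> 2 ^ (?d - 1)" by (intro power_mono) auto
      also have "\<dots> \<le> 2 ^ ?d" by (intro power_increasing) auto
      finally have "(1 + fst \<omega>) ^ (?d - 1) * (\<bar>p (snd \<omega>)\<bar> * \<bar>q ((1 + fst \<omega>) *\<^sub>R x - fst \<omega> *\<^sub>R snd \<omega>)\<bar> * norm (x - snd \<omega>))
          \<le> 2 ^ ?d * g (snd \<omega>)"
        by (intro mult_mono le[OF True]) auto
      then show ?thesis using True by (simp add: abs_mult mult.assoc)
    qed simp
  qed measurable
  also have "\<dots> = (LINT z|lborel. 2 ^ ?d * g z)" by (rule integral_indicator_times[OF integrable_mult_right[OF g]])
  finally show ?thesis by simp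
qed

definition unit_bump :: "'a::euclidean_space \<Rightarrow> real" where
  "unit_bump x = bump 0 1 x / (LINT x|lborel. bump (0::'a) 1 x)"

lemma integrable_test_fun:
  assumes f: "test_fun f" shows "integrable lborel f"
proof (rule test_funE[OF f])
  fix K c assume "compact K" "\<And>x. \<bar>f x\<bar> \<le> c" "\<And>x. x \<notin> K \<Longrightarrow> f x = 0"
  then show ?thesis by (intro integrable_lborel_bounded_support[of f c K] test_fun_measurable(1)[OF f]) auto
qed

lemma bump_mass_pos: "0 < (LINT x|lborel. bump (0::'a::euclidean_space) 1 x)"
proof -
  have i: "integrable lborel (bump (0::'a) 1)" by (rule integrable_test_fun[OF test_fun_bump]) simp
  have "(LINT x|lborel. bump (0::'a) 1 x) \<noteq> 0"
  proof
    assume "(LINT x|lborel. bump (0::'a) 1 x) = 0"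
    then have "AE x in lborel. bump (0::'a) 1 x = 0"
      using integral_nonneg_eq_0_iff_AE[OF i] bump_nonneg by auto
    then have "bump (0::'a) 1 0 = 0" by (rule AE_eq_0_imp_continuous_eq_0[OF C1_grad_continuous[OF C1_grad_bump]])
    then show False by (simp add: bump_def)
  qed
  moreover have "0 \<le> (LINT x|lborel. bump (0::'a) 1 x)" by (intro integral_nonneg_AE AE_I2 bump_nonneg)
  ultimately show ?thesis by simp
qed

lemma unit_bump_test_fun: "test_fun (unit_bump :: 'a::euclidean_space \<Rightarrow> real)"
proof -
  have "test_fun (\<lambda>x::'a. bump 0 1 x * inverse (LINT x|lborel. bump (0::'a) 1 x))"
    by (rule test_fun_mult[OF test_fun_bump C1_grad_const]) simp
  then show ?thesis by (simp add: unit_bump_def[abs_def] divide_inverse)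
qed

lemma unit_bump_nonneg: "0 \<le> unit_bump x"
  unfolding unit_bump_def by (rule divide_nonneg_pos[OF bump_nonneg bump_mass_pos])

lemma unit_bump_eq_0: "1 \<le> norm x \<Longrightarrow> unit_bump x = 0"
  by (simp add: unit_bump_def bump_eq_0)

lemma unit_bump_integral: "(LINT x|lborel. unit_bump (x::'a::euclidean_space)) = 1"
  using bump_mass_pos[where 'a='a] by (simp add: unit_bump_def)

lemma unit_bump_measurable [measurable]: "unit_bump \<in> borel_measurable borel"
  by (rule test_fun_measurable(1)[OF unit_bump_test_fun])

lemma unit_bump_bounded:
  obtains c where "0 < c" "\<And>x::'a::euclidean_space. \<bar>unit_bump x\<bar> \<le> c" "\<And>x::'a. norm (gradient unit_bump x) \<le> c"
proof (rule test_funE[OF unit_bump_test_fun])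
  fix c assume "0 < c" "\<And>x::'a. \<bar>unit_bump x\<bar> \<le> c" "\<And>x::'a. norm (gradient unit_bump x) \<le> c"
  then show thesis by (rule that)
qed

lemma unit_bump_first_moment: "integrable lborel (\<lambda>x::'a::euclidean_space. (1 + norm x) * \<bar>unit_bump x\<bar>)"
proof -
  obtain c where c: "\<And>x::'a. \<bar>unit_bump x\<bar> \<le> c" using unit_bump_bounded by metis
  show ?thesis
  proof (rule integrable_lborel_bounded_support[where K="cball 0 1" and c="2 * c"])
    show "norm ((1 + norm x) * \<bar>unit_bump x\<bar>) \<le> 2 * c" for x :: 'a
    proof (cases "norm x \<le> 1")
      case True
      then show ?thesis using c[of x] by (auto simp: abs_mult intro!: mult_mono)
    next
      case False
      then show ?thesis using unit_bump_eq_0[of x] c[of x] by simp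
    qed
  qed (auto simp: unit_bump_eq_0)
qed

definition transport_flux :: "('a::euclidean_space \<Rightarrow> real) \<Rightarrow> 'a \<Rightarrow> 'a" where
  "transport_flux s x = bogovskii s unit_bump x - bogovskii unit_bump s x"

text \<open>The two contributions from \<open>\<sigma> = 1\<close> cancel, because the reflection of \<open>z\<close> at \<open>x\<close> exchanges the
  arguments of \<open>s\<close> and of the bump. From \<open>\<sigma> = 0\<close> there remain \<open>s\<close> times the mass of the bump and the
  bump times the mass of \<open>s\<close>, which is zero.\<close>

lemma transport_flux_divergence:
  fixes s :: "'a::euclidean_space \<Rightarrow> real"
  assumes s: "C1_grad s S" and bd: "\<And>x. \<bar>s x\<bar> \<le> C" "\<And>x. norm (S x) \<le> C"
    and s1: "integrable lborel (\<lambda>z. (1 + norm z) * \<bar>s z\<bar>)" and s0: "(LINT x|lborel. s x) = 0"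
  shows "\<exists>D. (\<forall>b\<in>Basis. C1_grad (\<lambda>x. transport_flux s x \<bullet> b) (D b)) \<and> (\<forall>x. (\<Sum>b\<in>Basis. D b x \<bullet> b) = s x)"
proof -
  have [measurable]: "s \<in> borel_measurable borel"
    by (intro borel_measurable_continuous_onI C1_grad_continuous[OF s])
  obtain c where c: "\<And>x::'a. \<bar>unit_bump x\<bar> \<le> c" "\<And>x::'a. norm (gradient unit_bump x) \<le> c" using unit_bump_bounded by metis
  obtain D1 where D1: "\<And>b. b \<in> Basis \<Longrightarrow> C1_grad (\<lambda>x. bogovskii s unit_bump x \<bullet> b) (D1 b)"
    "\<And>x. (\<Sum>b\<in>Basis. D1 b x \<bullet> b) = 2 ^ DIM('a) * (LINT z|lborel. s z * unit_bump (2 *\<^sub>R x - z)) - unit_bump x * (LINT z|lborel. s z)"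
    using bogovskii_divergence[OF _ s1 test_fun_C1_grad[OF unit_bump_test_fun] c] by auto
  obtain D2 where D2: "\<And>b. b \<in> Basis \<Longrightarrow> C1_grad (\<lambda>x. bogovskii unit_bump s x \<bullet> b) (D2 b)"
    "\<And>x. (\<Sum>b\<in>Basis. D2 b x \<bullet> b) = 2 ^ DIM('a) * (LINT z|lborel. unit_bump z * s (2 *\<^sub>R x - z)) - s x * (LINT z|lborel. unit_bump (z::'a))"
    using bogovskii_divergence[OF _ unit_bump_first_moment s bd] by auto
  show ?thesis
  proof (intro exI[of _ "\<lambda>b x. D1 b x - D2 b x"] conjI ballI allI)
    show "C1_grad (\<lambda>x. transport_flux s x \<bullet> b) (\<lambda>x. D1 b x - D2 b x)" if "b \<in> Basis" for b
      unfolding transport_flux_def inner_diff_left by (intro C1_grad_diff D1 D2 that)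
    fix x
    have "(LINT z|lborel. s z * unit_bump (2 *\<^sub>R x - z)) = (LINT z|lborel. unit_bump z * s (2 *\<^sub>R x - z))"
      using integral_reflect[of "\<lambda>z. unit_bump z * s (2 *\<^sub>R x - z)" "2 *\<^sub>R x"] by (simp add: mult.commute)
    then show "(\<Sum>b\<in>Basis. (D1 b x - D2 b x) \<bullet> b) = s x"
      by (simp add: inner_diff_left sum_subtractf D1(2) D2(2) s0 unit_bump_integral)
  qed
qed

text \<open>Uniform over all sources below a given majorant, for use on time intervals.\<close>

lemma transport_flux_bound:
  fixes w :: "'a::euclidean_space \<Rightarrow> real"
  assumes wi: "integrable lborel (\<lambda>z. (1 + norm z) * w z)" and wC: "\<And>z. w z \<le> C"
  shows "\<exists>B. \<forall>s x. s \<in> borel_measurable borel \<longrightarrow> (\<forall>z. \<bar>s z\<bar> \<le> w z) \<longrightarrow> norm (transport_flux s x) \<le> B * (1 + norm x)"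
proof -
  obtain c where c: "0 < c" "\<And>x::'a. \<bar>unit_bump x\<bar> \<le> c" using unit_bump_bounded by metis
  let ?d = "2 ^ DIM('a) :: real"
  let ?a = "LINT z|lborel. (1 + norm z) * w z" and ?b = "LINT z|lborel. (1 + norm (z::'a)) * \<bar>unit_bump z\<bar>"
  show ?thesis
  proof (intro exI allI impI)
    fix s :: "'a \<Rightarrow> real" and x :: 'a assume [measurable]: "s \<in> borel_measurable borel" and sw: "\<forall>z. \<bar>s z\<bar> \<le> w z"
    have nx: "norm (x - z) \<le> (1 + norm x) * (1 + norm z)" for z
      using norm_triangle_ineq4[of x z] mult_nonneg_nonneg[OF norm_ge_zero norm_ge_zero, of x z] norm_ge_zero
      by (simp add: algebra_simps del: norm_ge_zero zero_le_mult_iff)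
    have w0: "0 \<le> w z" for z using sw abs_ge_zero order_trans by blast
    have "norm (bogovskii s unit_bump x) \<le> ?d * (LINT z|lborel. (c * (1 + norm x)) * ((1 + norm z) * w z))"
    proof (rule norm_bogovskii_le)
      show "\<bar>s z\<bar> * \<bar>unit_bump ((1 + \<sigma>) *\<^sub>R x - \<sigma> *\<^sub>R z)\<bar> * norm (x - z) \<le> (c * (1 + norm x)) * ((1 + norm z) * w z)" for \<sigma> z
      proof -
        have "\<bar>s z\<bar> * \<bar>unit_bump ((1 + \<sigma>) *\<^sub>R x - \<sigma> *\<^sub>R z)\<bar> * norm (x - z) \<le> w z * c * ((1 + norm x) * (1 + norm z))"
          using sw c(1) w0 by (intro mult_mono c(2) nx) auto
        then show ?thesis by (simp only: ac_simps)
      qed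
    qed (use wi in auto)
    moreover have "norm (bogovskii unit_bump s x) \<le> ?d * (LINT z|lborel. (C * (1 + norm x)) * ((1 + norm (z::'a)) * \<bar>unit_bump z\<bar>))"
    proof (rule norm_bogovskii_le)
      show "\<bar>unit_bump z\<bar> * \<bar>s ((1 + \<sigma>) *\<^sub>R x - \<sigma> *\<^sub>R z)\<bar> * norm (x - z) \<le> (C * (1 + norm x)) * ((1 + norm z) * \<bar>unit_bump z\<bar>)" for \<sigma> z
      proof -
        have "\<bar>s y\<bar> \<le> C" for y using sw wC order_trans by blast
        then have "\<bar>unit_bump z\<bar> * \<bar>s ((1 + \<sigma>) *\<^sub>R x - \<sigma> *\<^sub>R z)\<bar> * norm (x - z) \<le> \<bar>unit_bump z\<bar> * C * ((1 + norm x) * (1 + norm z))"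
          using order_trans[OF w0 wC] by (intro mult_mono nx) auto
        then show ?thesis by (simp only: ac_simps)
      qed
    qed (use unit_bump_first_moment in auto)
    ultimately have "norm (transport_flux s x) \<le> ?d * (c * (1 + norm x) * ?a) + ?d * (C * (1 + norm x) * ?b)"
      unfolding transport_flux_def integral_mult_right_zero
      using norm_triangle_ineq4[of "bogovskii s unit_bump x" "bogovskii unit_bump s x"] by linarith
    also have "\<dots> = (?d * (c * ?a + C * ?b)) * (1 + norm x)" by (simp add: algebra_simps)
    finally show "norm (transport_flux s x) \<le> (?d * (c * ?a + C * ?b)) * (1 + norm x)" .
  qed
qed

text \<open>Both halves of the flux at \<open>x\<close> only see the source at points which a ray from the unit ball
  reaches after passing through \<open>x\<close>, where the density \<open>exp (- U)\<close> has fallen below its value at \<open>x\<close> by an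
  exponential factor of any prescribed rate. So the flux is itself at most of the size of \<open>exp (- U)\<close>, up to
  a factor of exponential growth, and its square divided by \<open>exp (- U)\<close> remains integrable.\<close>

lemma transport_flux_decay:
  fixes s :: "'a::euclidean_space \<Rightarrow> real"
  assumes U: "C1_grad U G" and A: "0 \<le> A" "\<And>x. norm (G x) \<le> A * (1 + norm x)" and S: "superlinear G"
    and sm[measurable]: "s \<in> borel_measurable borel" and n: "0 \<le> n" and C: "0 \<le> C"
    and s: "\<And>y. \<bar>s y\<bar> \<le> C * exp (n * norm y) * exp (- U y)"
  shows "\<exists>R B m. 0 \<le> m \<and> (\<forall>x. R \<le> norm x \<longrightarrow> norm (transport_flux s x) \<le> B * exp (m * norm x) * exp (- U x))"
proof -
  let ?d = "2 ^ DIM('a) :: real"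
  define k where "k = real (DIM('a)) + 1"
  have k: "0 \<le> k" by (simp add: k_def)
  have ei: "integrable lborel (\<lambda>z::'a. exp (- k * norm z))" unfolding k_def by (rule integrable_exp_neg_norm)
  obtain R where R: "1 \<le> R" "\<And>x q r. R \<le> norm x \<Longrightarrow> norm q \<le> 1 \<Longrightarrow> 0 \<le> r \<Longrightarrow>
      U x + (n + k + 1) * norm (r *\<^sub>R (x - q)) \<le> U (x + r *\<^sub>R (x - q))"
    \<comment> \<open>The slope pays for the growth \<open>n\<close> of the source, for an integrable exponential of rate \<open>k\<close>,
      and for the factor \<open>norm (x - z)\<close>.\<close>
    using superlinear_along_rays[OF U A S, of "n + k + 1"] by blast
  obtain c where c: "0 < c" "\<And>x::'a. \<bar>unit_bump x\<bar> \<le> c" using unit_bump_bounded by metis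
  define I where "I = (LINT z|lborel. exp (- k * norm (z::'a)))"
  have "norm (transport_flux s x) \<le> (?d * C * (1 + c * I)) * exp ((n + 1) * norm x) * exp (- U x)"
    if x: "R \<le> norm x" for x
  proof -
    let ?E = "C * exp (n * norm x) * exp (- U x)"
    have E0: "0 \<le> ?E" using C by simp
    have ray: "\<bar>s (x + r *\<^sub>R (x - q))\<bar> \<le> ?E * exp (- (k + 1) * norm (r *\<^sub>R (x - q)))"
      if "norm q \<le> 1" "0 \<le> r" for q r
    proof -
      let ?v = "r *\<^sub>R (x - q)"
      have "n * norm (x + ?v) \<le> n * (norm x + norm ?v)" using n by (intro mult_left_mono norm_triangle_ineq)
      then have "n * norm (x + ?v) - U (x + ?v) \<le> n * norm x - U x - (k + 1) * norm ?v"
        using R(2)[OF x that] by (simp only: distrib_left distrib_right)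
      then have "exp (n * norm (x + ?v) - U (x + ?v)) \<le> exp (n * norm x - U x - (k + 1) * norm ?v)" by simp
      then have "C * (exp (n * norm (x + ?v)) * exp (- U (x + ?v))) \<le> C * (exp (n * norm x) * exp (- U x) * exp (- (k + 1) * norm ?v))"
        using C unfolding exp_add[symmetric] by (intro mult_left_mono) (simp_all add: algebra_simps)
      then show ?thesis using s[of "x + ?v"] by (simp add: mult.assoc)
    qed
    have "norm (bogovskii unit_bump s x) \<le> ?d * (LINT z|lborel. (exp (norm x) * ?E) * unit_bump (z::'a))"
    proof (rule norm_bogovskii_le)
      fix \<sigma> :: real and z :: 'a assume \<sigma>: "\<sigma> \<in> {0..1}"
      show "\<bar>unit_bump z\<bar> * \<bar>s ((1 + \<sigma>) *\<^sub>R x - \<sigma> *\<^sub>R z)\<bar> * norm (x - z) \<le> (exp (norm x) * ?E) * unit_bump z"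
      proof (cases "norm z \<le> 1")
        case True
        have "(1 + \<sigma>) *\<^sub>R x - \<sigma> *\<^sub>R z = x + \<sigma> *\<^sub>R (x - z)" by (simp add: algebra_simps)
        then have "\<bar>s ((1 + \<sigma>) *\<^sub>R x - \<sigma> *\<^sub>R z)\<bar> \<le> ?E * exp (- (k + 1) * norm (\<sigma> *\<^sub>R (x - z)))"
          using ray[OF True, of \<sigma>] \<sigma> by simp
        also have "\<dots> \<le> ?E * 1" using E0 k by (intro mult_left_mono) (auto intro!: mult_nonpos_nonneg)
        finally have 1: "\<bar>s ((1 + \<sigma>) *\<^sub>R x - \<sigma> *\<^sub>R z)\<bar> \<le> ?E" by simp
        have 2: "norm (x - z) \<le> exp (norm x)"
          using norm_triangle_ineq4[of x z] True exp_ge_add_one_self[of "norm x"] by linarith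
        have "\<bar>unit_bump z\<bar> * \<bar>s ((1 + \<sigma>) *\<^sub>R x - \<sigma> *\<^sub>R z)\<bar> * norm (x - z) \<le> unit_bump z * ?E * exp (norm x)"
          using E0 unit_bump_nonneg[of z] by (intro mult_mono 1 2) auto
        then show ?thesis by (simp only: ac_simps)
      next
        case False
        then show ?thesis by (simp add: unit_bump_eq_0)
      qed
    qed (use integrable_test_fun[OF unit_bump_test_fun] in auto)
    then have b1: "norm (bogovskii unit_bump s x) \<le> ?d * (exp (norm x) * ?E)" by (simp only: integral_mult_right_zero unit_bump_integral mult_1_right)
    have "norm (bogovskii s unit_bump x) \<le> ?d * (LINT z|lborel. (c * ?E) * exp (- k * norm (- x + z)))"
    proof (rule norm_bogovskii_le)
      have [measurable]: "(\<lambda>z::'a. exp (- k * norm z)) \<in> borel_measurable borel" by measurable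
      show "integrable lborel (\<lambda>z. c * ?E * exp (- k * norm (- x + z)))"
      proof (rule integrable_mult_right)
        have "integrable (distr lborel borel ((+) (- x))) (\<lambda>z::'a. exp (- k * norm z))" using ei by (simp add: lborel_distr_plus)
        then show "integrable lborel (\<lambda>z. exp (- k * norm (- x + z)))" by (subst (asm) integrable_distr_eq) auto
      qed
      fix \<sigma> :: real and z :: 'a assume \<sigma>: "\<sigma> \<in> {0..1}"
      let ?q = "(1 + \<sigma>) *\<^sub>R x - \<sigma> *\<^sub>R z"
      show "\<bar>s z\<bar> * \<bar>unit_bump ?q\<bar> * norm (x - z) \<le> c * ?E * exp (- k * norm (- x + z))"
      proof (cases "norm ?q < 1")
        case True
        have "\<sigma> \<noteq> 0" using True x R(1) by auto
        then have \<sigma>: "0 < \<sigma>" using \<sigma> by simp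
        have z: "x + (1 / \<sigma>) *\<^sub>R (x - ?q) = z"
        proof -
          have "x - ?q = \<sigma> *\<^sub>R (z - x)" by (simp add: algebra_simps)
          then show ?thesis using \<sigma> by simp
        qed
        then have zx: "(1 / \<sigma>) *\<^sub>R (x - ?q) = - x + z" by (simp add: algebra_simps)
        have "\<bar>s z\<bar> \<le> ?E * exp (- (k + 1) * norm (- x + z))"
          using ray[of ?q "1 / \<sigma>"] True \<sigma> unfolding z unfolding zx by simp
        then have "\<bar>s z\<bar> * \<bar>unit_bump ?q\<bar> * norm (x - z) \<le> ?E * exp (- (k + 1) * norm (- x + z)) * c * exp (norm (- x + z))"
        proof (intro mult_mono c(2))
          have "norm (x - z) = norm (- x + z)" by (simp add: norm_minus_commute)
          then show "norm (x - z) \<le> exp (norm (- x + z))" using exp_ge_add_one_self[of "norm (- x + z)"] by linarith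
        qed (use E0 c(1) in auto)
        also have "\<dots> = c * ?E * (exp (- (k + 1) * norm (- x + z)) * exp (norm (- x + z)))" by (simp only: ac_simps)
        also have "exp (- (k + 1) * norm (- x + z)) * exp (norm (- x + z)) = exp (- k * norm (- x + z))"
          unfolding exp_add[symmetric] by (simp add: algebra_simps)
        finally show ?thesis .
      next
        case False
        then show ?thesis using unit_bump_eq_0[of ?q] E0 c(1) by simp
      qed
    qed auto
    moreover have "(LINT z|lborel. exp (- k * norm (- x + z))) = I"
      unfolding I_def by (rule integral_translate[of "\<lambda>z. exp (- k * norm z)"]) measurable
    ultimately have b2: "norm (bogovskii s unit_bump x) \<le> ?d * (c * ?E * I)" by (simp only: integral_mult_right_zero)
    have I0: "0 \<le> I" unfolding I_def by (intro integral_nonneg_AE AE_I2) auto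
    have "norm (transport_flux s x) \<le> ?d * (c * ?E * I) + ?d * (exp (norm x) * ?E)"
      using norm_triangle_ineq4[of "bogovskii s unit_bump x" "bogovskii unit_bump s x"] b1 b2 unfolding transport_flux_def by linarith
    also have "\<dots> \<le> ?d * (c * ?E * I) * exp (norm x) + ?d * (exp (norm x) * ?E)"
      using mult_left_mono[of 1 "exp (norm x)" "?d * (c * ?E * I)"] I0 c(1) E0 by simp
    also have "\<dots> = (?d * (1 + c * I)) * (exp (norm x) * ?E)" by (simp add: algebra_simps)
    also have "exp (norm x) * ?E = C * exp ((n + 1) * norm x) * exp (- U x)"
      by (simp add: distrib_right exp_add)
    finally show ?thesis by (simp only: ac_simps)
  qed
  then show ?thesis using n by (intro exI[of _ R] exI[of _ "?d * C * (1 + c * I)"] exI[of _ "n + 1"]) auto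
qed

lemma transport_flux_square_integrable:
  fixes s :: "'a::euclidean_space \<Rightarrow> real"
  assumes U: "C1_grad U G" and A: "0 \<le> A" "\<And>x. norm (G x) \<le> A * (1 + norm x)" and S: "superlinear G"
    and s: "s \<in> borel_measurable borel" "0 \<le> n" "0 \<le> C" "\<And>y. \<bar>s y\<bar> \<le> C * exp (n * norm y) * exp (- U y)"
    and F: "continuous_on UNIV (transport_flux s)"
  shows "integrable lborel (\<lambda>x. (norm (transport_flux s x))\<^sup>2 * exp (U x))"
proof -
  obtain R B m where m: "0 \<le> m" and RB: "\<And>x. R \<le> norm x \<Longrightarrow> norm (transport_flux s x) \<le> B * exp (m * norm x) * exp (- U x)"
    using transport_flux_decay[OF U A S s] by blast
  define k where "k = real (DIM('a)) + 1"
  obtain C' where C': "0 < C'" "\<And>x. exp (- U x) \<le> C' * exp (- (2 * m + k) * norm x)"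
    using superlinear_lower_bound[OF U A S, of "2 * m + k"] m by (auto simp: k_def)
  let ?f = "\<lambda>x. (norm (transport_flux s x))\<^sup>2 * exp (U x)"
  have fc: "continuous_on UNIV ?f" by (intro continuous_intros F C1_grad_continuous[OF U])
  have "integrable lborel (\<lambda>x. indicator (cball 0 R) x *\<^sub>R ?f x)"
    by (intro borel_integrable_compact continuous_on_subset[OF fc]) auto
  moreover have "integrable lborel (\<lambda>x::'a. B\<^sup>2 * C' * exp (- k * norm x))"
    unfolding k_def by (intro integrable_mult_right integrable_exp_neg_norm)
  ultimately show ?thesis
  proof (rule Bochner_Integration.integrable_bound[OF Bochner_Integration.integrable_add])
    show "?f \<in> borel_measurable lborel" using borel_measurable_continuous_onI[OF fc] by simp
    have out: "?f x \<le> B\<^sup>2 * C' * exp (- k * norm x)" if x: "R \<le> norm x" for x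
    proof -
      have "?f x \<le> (B * exp (m * norm x) * exp (- U x))\<^sup>2 * exp (U x)"
        using RB[OF x] by (intro mult_right_mono power_mono) auto
      also have "\<dots> = B\<^sup>2 * exp (2 * m * norm x) * exp (- U x)"
      proof -
        have "(exp (m * norm x))\<^sup>2 = exp (2 * m * norm x)" by (simp add: exp_double[symmetric] mult.assoc)
        moreover have "(exp (- U x))\<^sup>2 * exp (U x) = exp (- U x)"
          unfolding power2_eq_square exp_add[symmetric] by simp
        ultimately show ?thesis by (simp only: power_mult_distrib mult.assoc)
      qed
      also have "\<dots> \<le> B\<^sup>2 * exp (2 * m * norm x) * (C' * exp (- (2 * m + k) * norm x))"
        using C'(2) by (intro mult_left_mono) auto
      also have "\<dots> = B\<^sup>2 * C' * (exp (2 * m * norm x) * exp (- (2 * m + k) * norm x))" by (simp only: ac_simps)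
      also have "exp (2 * m * norm x) * exp (- (2 * m + k) * norm x) = exp (- k * norm x)"
        unfolding exp_add[symmetric] by (simp add: algebra_simps)
      finally show ?thesis .
    qed
    have "?f x \<le> indicator (cball 0 R) x *\<^sub>R ?f x + B\<^sup>2 * C' * exp (- k * norm x)" for x
    proof (cases "norm x \<le> R")
      case True then show ?thesis using C'(1) by simp
    next
      case False then show ?thesis using out[of x] by simp
    qed
    then show "AE x in lborel. norm (?f x) \<le> norm (indicator (cball 0 R) x *\<^sub>R ?f x + B\<^sup>2 * C' * exp (- k * norm x))"
      by (intro AE_I2) (simp add: order_trans[OF _ abs_ge_self])
  qed
qed

lemma bogovskii_measurable:
  fixes p q :: "real \<Rightarrow> 'a::euclidean_space \<Rightarrow> real"
  assumes [measurable]: "(\<lambda>(t, x). p t x) \<in> borel_measurable (borel \<Otimes>\<^sub>M borel)" "(\<lambda>(t, x). q t x) \<in> borel_measurable (borel \<Otimes>\<^sub>M borel)"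
  shows "(\<lambda>(t, x). bogovskii (p t) (q t) x) \<in> borel_measurable (borel \<Otimes>\<^sub>M borel)"
proof -
  have "(\<lambda>a. \<integral>\<omega>. (indicator {0..1} (fst \<omega>) * (1 + fst \<omega>) ^ (DIM('a) - 1) * p (fst a) (snd \<omega>) *
     q (fst a) ((1 + fst \<omega>) *\<^sub>R snd a - fst \<omega> *\<^sub>R snd \<omega>)) *\<^sub>R (snd a - snd \<omega>) \<partial>(lborel \<Otimes>\<^sub>M lborel)) \<in> borel_measurable (borel \<Otimes>\<^sub>M borel)"
  proof (rule sigma_finite_measure.borel_measurable_lebesgue_integral)
    show "sigma_finite_measure (lborel \<Otimes>\<^sub>M lborel :: (real \<times> 'a) measure)" by unfold_locales
    have pm: "(\<lambda>c. (\<lambda>(t, x). p t x) (fst (fst c), snd (snd c))) \<in> borel_measurable ((borel \<Otimes>\<^sub>M borel) \<Otimes>\<^sub>M (lborel \<Otimes>\<^sub>M lborel))"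
      by measurable
    have qm: "(\<lambda>c. (\<lambda>(t, x). q t x) (fst (fst c), (1 + fst (snd c)) *\<^sub>R snd (fst c) - fst (snd c) *\<^sub>R snd (snd c)))
        \<in> borel_measurable ((borel \<Otimes>\<^sub>M borel) \<Otimes>\<^sub>M (lborel \<Otimes>\<^sub>M lborel))"
      by measurable
    note pm[simplified, measurable] qm[simplified, measurable]
    show "(\<lambda>(a, \<omega>). (indicator {0..1} (fst \<omega>) * (1 + fst \<omega>) ^ (DIM('a) - 1) * p (fst a) (snd \<omega>) *
     q (fst a) ((1 + fst \<omega>) *\<^sub>R snd a - fst \<omega> *\<^sub>R snd \<omega>)) *\<^sub>R (snd a - snd \<omega>))
      \<in> borel_measurable ((borel \<Otimes>\<^sub>M borel) \<Otimes>\<^sub>M (lborel \<Otimes>\<^sub>M lborel))"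
      unfolding case_prod_beta' by measurable
  qed
  then show ?thesis by (simp add: bogovskii_def case_prod_beta')
qed

lemma transport_flux_measurable:
  fixes s :: "real \<Rightarrow> 'a::euclidean_space \<Rightarrow> real"
  assumes "(\<lambda>(t, x). s t x) \<in> borel_measurable (borel \<Otimes>\<^sub>M borel)"
  shows "(\<lambda>(t, x). transport_flux (s t) x) \<in> borel_measurable (borel \<Otimes>\<^sub>M borel)"
proof -
  have k: "(\<lambda>(t::real, x::'a). unit_bump x) \<in> borel_measurable (borel \<Otimes>\<^sub>M borel)" by measurable
  from bogovskii_measurable[OF assms k] bogovskii_measurable[OF k assms] show ?thesis
    unfolding transport_flux_def case_prod_beta' by measurable
qed

section \<open>The exponentially tilted flow\<close>

lemma abs_exp_diff_le:
  fixes x y :: real assumes "0 \<le> x" "0 \<le> y" shows "\<bar>exp (- x) - exp (- y)\<bar> \<le> \<bar>x - y\<bar>"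
proof -
  have *: "exp (- a) - exp (- b) \<le> b - a" if "0 \<le> a" "a \<le> b" for a b :: real
  proof -
    have "1 - exp (- (b - a)) \<le> b - a" using exp_ge_add_one_self[of "- (b - a)"] by linarith
    then have "exp (- a) * (1 - exp (- (b - a))) \<le> 1 * (b - a)" using that by (intro mult_mono) auto
    then show ?thesis by (simp add: right_diff_distrib exp_add[symmetric])
  qed
  show ?thesis
  proof (cases "x \<le> y")
    case True
    then have "exp (- y) \<le> exp (- x)" by simp
    then show ?thesis using *[OF assms(1) True] True by simp
  next
    case False
    then have "exp (- x) \<le> exp (- y)" by simp
    then show ?thesis using *[OF assms(2), of x] False by simp
  qed
qed

lemma exp_tilt_continuous:
  fixes a w :: "'a \<Rightarrow> real"
  assumes [measurable]: "a \<in> borel_measurable M" and a: "\<And>x. 0 \<le> a x" and w: "integrable M w"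
  shows "continuous_on {0..} (\<lambda>t. \<integral>x. w x * exp (- (t * a x)) \<partial>M)"
  unfolding continuous_on_sequentially o_def
proof (intro ballI allI impI, elim conjE)
  fix t and X :: "nat \<Rightarrow> real" assume X: "\<forall>n. X n \<in> {0..}" "X \<longlonglongrightarrow> t"
  have [measurable]: "w \<in> borel_measurable M" using w by auto
  show "(\<lambda>n. \<integral>x. w x * exp (- (X n * a x)) \<partial>M) \<longlonglongrightarrow> (\<integral>x. w x * exp (- (t * a x)) \<partial>M)"
  proof (rule integral_dominated_convergence[where w="\<lambda>x. norm (w x)"])
    show "AE x in M. (\<lambda>n. w x * exp (- (X n * a x))) \<longlonglongrightarrow> w x * exp (- (t * a x))"
      by (intro AE_I2 tendsto_intros X)
    show "AE x in M. norm (w x * exp (- (X n * a x))) \<le> norm (w x)" for n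
      using X(1) a by (intro AE_I2) (auto simp: abs_mult intro!: mult_left_le)
  qed (use w in auto)
qed

text \<open>The derivative is one-sided at \<open>0\<close>: for negative \<open>t\<close> the tilt may fail to be integrable. The bound
  \<open>a\<close> on the difference quotients holds because \<open>exp (- x)\<close> is 1-Lipschitz for \<open>x \<ge> 0\<close>.\<close>

lemma exp_tilt_derivative:
  fixes a w :: "'a \<Rightarrow> real"
  assumes [measurable]: "a \<in> borel_measurable M" and a: "\<And>x. 0 \<le> a x"
    and w: "integrable M w" and wa: "integrable M (\<lambda>x. w x * a x)" and t: "0 \<le> t"
  shows "((\<lambda>t. \<integral>x. w x * exp (- (t * a x)) \<partial>M) has_real_derivative
    - (\<integral>x. w x * a x * exp (- (t * a x)) \<partial>M)) (at t within {0..})"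
  unfolding has_field_derivative_iff tendsto_at_iff_sequentially o_def
proof (intro allI impI)
  fix X :: "nat \<Rightarrow> real" assume X: "\<forall>i. X i \<in> {0..} - {t}" "X \<longlonglongrightarrow> t"
  have [measurable]: "w \<in> borel_measurable M" using w by auto
  have i: "integrable M (\<lambda>x. w x * exp (- (s * a x)))" if "0 \<le> s" for s
  proof (rule Bochner_Integration.integrable_bound[OF w])
    show "AE x in M. norm (w x * exp (- (s * a x))) \<le> norm (w x)"
      using that a by (intro AE_I2) (auto simp: abs_mult intro!: mult_left_le)
  qed measurable
  let ?q = "\<lambda>n x. (w x * exp (- (X n * a x)) - w x * exp (- (t * a x))) / (X n - t)"
  have "(\<lambda>n. \<integral>x. ?q n x \<partial>M) \<longlonglongrightarrow> (\<integral>x. - (w x * a x * exp (- (t * a x))) \<partial>M)"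
  proof (rule integral_dominated_convergence[where w="\<lambda>x. norm (w x * a x)"])
    show "AE x in M. (\<lambda>n. ?q n x) \<longlonglongrightarrow> - (w x * a x * exp (- (t * a x)))"
    proof (rule AE_I2)
      fix x
      have "((\<lambda>s. w x * exp (- (s * a x))) has_real_derivative - (w x * a x * exp (- (t * a x)))) (at t)"
        by (auto intro!: derivative_eq_intros)
      then show "(\<lambda>n. ?q n x) \<longlonglongrightarrow> - (w x * a x * exp (- (t * a x)))"
        using X unfolding has_field_derivative_iff tendsto_at_iff_sequentially o_def by auto
    qed
    show "AE x in M. norm (?q n x) \<le> norm (w x * a x)" for n
    proof (rule AE_I2)
      fix x
      have "0 \<le> X n" "X n \<noteq> t" using X(1) by auto
      then have "\<bar>exp (- (X n * a x)) - exp (- (t * a x))\<bar> \<le> \<bar>X n * a x - t * a x\<bar>"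
        using a t by (intro abs_exp_diff_le) auto
      also have "\<dots> = a x * \<bar>X n - t\<bar>" using a by (simp add: left_diff_distrib[symmetric] abs_mult)
      finally have "\<bar>w x\<bar> * \<bar>exp (- (X n * a x)) - exp (- (t * a x))\<bar> \<le> \<bar>w x\<bar> * (a x * \<bar>X n - t\<bar>)"
        by (rule mult_left_mono) simp
      then show "norm (?q n x) \<le> norm (w x * a x)"
        using \<open>X n \<noteq> t\<close> a by (simp add: right_diff_distrib[symmetric] abs_mult divide_le_eq mult.assoc)
    qed
  qed (use wa in auto)
  moreover have "(\<integral>x. ?q n x \<partial>M) = ((\<integral>x. w x * exp (- (X n * a x)) \<partial>M) - (\<integral>x. w x * exp (- (t * a x)) \<partial>M)) / (X n - t)" for n
    using i[of "X n"] i[OF t] X(1) by simp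
  ultimately show "(\<lambda>n. ((\<integral>x. w x * exp (- (X n * a x)) \<partial>M) - (\<integral>x. w x * exp (- (t * a x)) \<partial>M)) / (X n - t))
      \<longlonglongrightarrow> - (\<integral>x. w x * a x * exp (- (t * a x)) \<partial>M)"
    by (simp only: Bochner_Integration.integral_minus)
qed

lemma linear_growth_le_exp:
  assumes "0 \<le> A" "y \<le> A * (1 + r)" shows "y \<le> A * exp (r::real)"
  using order_trans[OF assms(2) mult_left_mono[OF exp_ge_add_one_self assms(1)]] .

text \<open>The initial density is \<open>exp (- V)\<close>.\<close>

locale filtering = observation \<beta> h xbar for \<beta> and h :: "'a::euclidean_space \<Rightarrow> real" and xbar +
  fixes V :: "'a \<Rightarrow> real"
  assumes V_C2: "Ck 2 V" "bounded_hessian V" and V_radial: "liminf_radial V = \<infinity>"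
    and h_C2: "Ck 2 h" "bounded_hessian h" and h_radial: "- \<infinity> < liminf_radial h"
    and initial: "(\<lambda>x. exp (- V x)) \<in> prob_densities"
begin

text \<open>With \<open>a = \<beta> (h - mean)\<close> the continuity equation is \<open>\<partial>\<rho>/\<partial>t = - \<beta> (h - mean) \<rho>\<close>, without derivatives
  in space, and exponential tilting solves it. A velocity is needed only to realise this change of density as
  transport.\<close>

definition potential :: "real \<Rightarrow> 'a \<Rightarrow> real" where
  "potential t x = V x + \<beta> * t * excess x"

definition normalizer :: "real \<Rightarrow> real" where
  "normalizer t = (LINT x|lborel. exp (- potential t x))"

definition tilted :: "real \<Rightarrow> 'a \<Rightarrow> real" where
  "tilted t x = exp (- potential t x) / normalizer t"

definition source :: "real \<Rightarrow> 'a \<Rightarrow> real" where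
  "source t x = \<beta> * (excess x - mean (tilted t) excess) * tilted t x"

definition optimal_drift :: "real \<Rightarrow> 'a \<Rightarrow> 'a" where
  "optimal_drift t x = transport_flux (source t) x /\<^sub>R tilted t x"

lemma V_C1: "C1_grad V (gradient V)" by (rule Ck_2_imp_C1_grad(1)[OF V_C2(1)])

lemma V_measurable [measurable]: "V \<in> borel_measurable borel"
  by (intro borel_measurable_continuous_onI C1_grad_continuous[OF V_C1])

lemma potential_C1: "C1_grad (potential t) (\<lambda>x. gradient V x + (\<beta> * t) *\<^sub>R gradient h x)"
  unfolding potential_def[abs_def] by (intro C1_grad_add V_C1 C1_grad_cmult excess_C1)

lemma potential_superlinear: "0 \<le> t \<Longrightarrow> superlinear (\<lambda>x. gradient V x + (\<beta> * t) *\<^sub>R gradient h x)"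
  using \<beta>_pos by (intro superlinear_perturbation V_radial h_radial) simp

lemma gradient_growth: "\<exists>A\<ge>0. (\<forall>x. norm (gradient h x) \<le> A * (1 + norm x)) \<and>
  (\<forall>x. norm (gradient V x + (\<beta> * t) *\<^sub>R gradient h x) \<le> A * (1 + norm x))"
proof -
  obtain A where A: "0 \<le> A" "\<And>x. norm (gradient V x) \<le> A * (1 + norm x)" using gradient_linear_growth[OF V_C2] by auto
  obtain B where B: "0 \<le> B" "\<And>x. norm (gradient h x) \<le> B * (1 + norm x)" using gradient_linear_growth[OF h_C2] by auto
  show ?thesis
  proof (intro exI[of _ "A + \<bar>\<beta> * t\<bar> * B + B"] conjI allI)
    fix x :: 'a
    have B': "0 \<le> A * (1 + norm x)" "0 \<le> \<bar>\<beta> * t\<bar> * (B * (1 + norm x))" "0 \<le> B * (1 + norm x)" using A(1) B(1) by auto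
    show "norm (gradient h x) \<le> (A + \<bar>\<beta> * t\<bar> * B + B) * (1 + norm x)"
      using B(2)[of x] B' unfolding distrib_right[of _ _ "1 + norm x"] mult.assoc by linarith
    have "norm (gradient V x + (\<beta> * t) *\<^sub>R gradient h x) \<le> norm (gradient V x) + \<bar>\<beta> * t\<bar> * norm (gradient h x)"
      using norm_triangle_ineq[of "gradient V x" "(\<beta> * t) *\<^sub>R gradient h x"] by simp
    also have "\<dots> \<le> A * (1 + norm x) + \<bar>\<beta> * t\<bar> * (B * (1 + norm x))" by (intro add_mono mult_left_mono A B) simp
    finally show "norm (gradient V x + (\<beta> * t) *\<^sub>R gradient h x) \<le> (A + \<bar>\<beta> * t\<bar> * B + B) * (1 + norm x)"
      using B' unfolding distrib_right[of _ _ "1 + norm x"] mult.assoc by linarith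
  qed (use A B in auto)
qed

lemma excess_exp_growth: "\<exists>C>0. \<forall>x. excess x \<le> C * exp (2 * norm x)"
proof -
  obtain A where A: "0 \<le> A" "\<And>x. norm (gradient h x) \<le> A * (1 + norm x)" using gradient_growth by blast
  have le: "excess x \<le> (\<bar>excess 0\<bar> + A + 1) * exp (2 * norm x)" for x
  proof -
    have "excess x \<le> (\<bar>excess 0\<bar> + A) * (1 + norm x)\<^sup>2" using quadratic_growth[OF excess_C1 A, of x] by simp
    also have "\<dots> \<le> (\<bar>excess 0\<bar> + A + 1) * exp (2 * norm x)"
      using A(1) one_plus_power_le_exp[of "norm x" 2] by (intro mult_mono) auto
    finally show ?thesis .
  qed
  then show ?thesis using A(1) by (intro exI[of _ "\<bar>excess 0\<bar> + A + 1"]) auto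
qed

lemma exp_potential_decay: "0 \<le> t \<Longrightarrow> 0 \<le> K \<Longrightarrow> \<exists>C>0. \<forall>x. exp (- potential t x) \<le> C * exp (- K * norm x)"
  using gradient_growth[of t] superlinear_lower_bound[OF potential_C1 _ _ potential_superlinear] by metis

text \<open>The excess cost and all gradients grow at most exponentially, so sources, their gradients and
  their moments are all of this form; the superlinear potential makes them bounded and integrable.\<close>

lemma exp_weighted_integrable:
  fixes w :: "'a \<Rightarrow> 'b::euclidean_space"
  assumes t: "0 \<le> t" and m: "w \<in> borel_measurable borel"
    and w: "\<And>x. norm (w x) \<le> C * exp (n * norm x) * exp (- potential t x)" "0 \<le> n" "0 \<le> C"
  shows "integrable lborel w" and "\<exists>B. \<forall>x. norm (w x) \<le> B"
proof -
  define k where "k = real (DIM('a)) + 1"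
  have k: "0 \<le> k" by (simp add: k_def)
  obtain c where c: "0 < c" "\<And>x. exp (- potential t x) \<le> c * exp (- (n + k) * norm x)"
    using exp_potential_decay[OF t, of "n + k"] k w(2) by auto
  have le: "norm (w x) \<le> C * c * exp (- k * norm x)" for x
  proof -
    have "norm (w x) \<le> C * exp (n * norm x) * (c * exp (- (n + k) * norm x))"
      using w(3) by (intro order_trans[OF w(1)] mult_left_mono c(2)) auto
    also have "\<dots> = C * c * (exp (n * norm x) * exp (- (n + k) * norm x))" by (simp only: ac_simps)
    also have "exp (n * norm x) * exp (- (n + k) * norm x) = exp (- k * norm x)"
      unfolding exp_add[symmetric] by (simp add: algebra_simps)
    finally show ?thesis .
  qed
  show "integrable lborel w"
  proof (rule Bochner_Integration.integrable_bound)
    show "integrable lborel (\<lambda>x::'a. C * c * exp (- k * norm x))"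
      unfolding k_def by (intro integrable_mult_right integrable_exp_neg_norm)
    show "AE x in lborel. norm (w x) \<le> norm (C * c * exp (- k * norm x))"
      by (intro AE_I2 order_trans[OF le]) simp
  qed (use m in simp)
  have "norm (w x) \<le> C * c" for x
    using le[of x] mult_left_mono[of "exp (- k * norm x)" 1 "C * c"] c(1) w(3) k by simp
  then show "\<exists>B. \<forall>x. norm (w x) \<le> B" by blast
qed

lemma potential_0: "potential 0 = V" by (auto simp: potential_def)

lemma exp_potential: "exp (- potential t x) = exp (- V x) * exp (- (t * (\<beta> * excess x)))"
  unfolding exp_add[symmetric] by (simp add: potential_def algebra_simps)

lemma exp_potential_antimono: "s \<le> t \<Longrightarrow> exp (- potential t x) \<le> exp (- potential s x)"
  using \<beta>_pos excess_nonneg[of x] by (simp add: potential_def mult_left_mono mult_right_mono)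

lemma potential_measurable [measurable]: "potential t \<in> borel_measurable borel"
  unfolding potential_def[abs_def] by measurable

lemma exp_potential_integrable: "0 \<le> t \<Longrightarrow> integrable lborel (\<lambda>x. exp (- potential t x))"
  by (rule exp_weighted_integrable(1)[where n=0 and C=1]) auto

lemma normalizer_pos: assumes t: "0 \<le> t" shows "0 < normalizer t"
proof -
  have "normalizer t \<noteq> 0"
  proof
    assume "normalizer t = 0"
    then have "AE x in lborel. exp (- potential t x) = 0"
      using integral_nonneg_eq_0_iff_AE[OF exp_potential_integrable[OF t]] by (auto simp: normalizer_def)
    then have "exp (- potential t 0) = 0"
      by (rule AE_eq_0_imp_continuous_eq_0[rotated]) (intro continuous_intros C1_grad_continuous[OF potential_C1])
    then show False by simp
  qed
  moreover have "0 \<le> normalizer t" unfolding normalizer_def by (intro integral_nonneg_AE AE_I2) auto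
  ultimately show ?thesis by simp
qed

lemma normalizer_antimono: "0 \<le> s \<Longrightarrow> s \<le> t \<Longrightarrow> normalizer t \<le> normalizer s"
  unfolding normalizer_def by (intro integral_mono exp_potential_integrable exp_potential_antimono) auto

lemma normalizer_0: "normalizer 0 = 1"
  using prob_densityD(4)[OF initial] by (simp add: normalizer_def potential_0)

lemma tilted_0: "tilted 0 = (\<lambda>x. exp (- V x))"
  by (auto simp: tilted_def normalizer_0 potential_0)

lemma tilted_pos: "0 \<le> t \<Longrightarrow> 0 < tilted t x"
  using normalizer_pos by (simp add: tilted_def)

lemma tilted_prob_density: assumes t: "0 \<le> t" shows "tilted t \<in> prob_densities"
proof -
  have "integrable lborel (\<lambda>x. (norm x)\<^sup>2 * exp (- potential t x))"
  proof (rule exp_weighted_integrable(1)[OF t])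
    show "norm ((norm x)\<^sup>2 * exp (- potential t x)) \<le> 1 * exp (2 * norm x) * exp (- potential t x)" for x
    proof -
      have "(norm x)\<^sup>2 \<le> (1 + norm x)\<^sup>2" by (intro power_mono) auto
      also have "\<dots> \<le> exp (2 * norm x)" using one_plus_power_le_exp[of "norm x" 2] by simp
      finally show ?thesis by (simp add: mult_right_mono)
    qed
  qed auto
  then have "integrable lborel (\<lambda>x. ((norm x)\<^sup>2 * exp (- potential t x)) / normalizer t)" by (rule integrable_divide)
  then show ?thesis
    using exp_potential_integrable[OF t] normalizer_pos[OF t]
    by (auto simp: prob_densities_def tilted_def[abs_def] normalizer_def[symmetric] less_imp_le)
qed

lemma tilted_C1: "C1_grad (tilted t) (\<lambda>x. (- tilted t x) *\<^sub>R (gradient V x + (\<beta> * t) *\<^sub>R gradient h x))"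
proof -
  have "C1_grad (\<lambda>x. exp (- potential t x)) (\<lambda>x. (- exp (- potential t x)) *\<^sub>R (gradient V x + (\<beta> * t) *\<^sub>R gradient h x))"
    by (rule C1_grad_compose[OF potential_C1, where \<phi>="\<lambda>y. exp (- y)" and \<phi>'="\<lambda>y. - exp (- y)"])
      (auto intro!: derivative_eq_intros continuous_intros C1_grad_continuous[OF potential_C1])
  from C1_grad_cmult[OF this, of "inverse (normalizer t)"] show ?thesis
    by (simp add: tilted_def[abs_def] divide_inverse mult.commute)
qed

lemma source_C1: "C1_grad (source t) (\<lambda>x. \<beta> *\<^sub>R ((excess x - mean (tilted t) excess) *\<^sub>R
    ((- tilted t x) *\<^sub>R (gradient V x + (\<beta> * t) *\<^sub>R gradient h x)) + tilted t x *\<^sub>R gradient h x))"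
proof -
  have "C1_grad (\<lambda>x. excess x - mean (tilted t) excess) (\<lambda>x. gradient h x - 0)"
    by (intro C1_grad_diff excess_C1 C1_grad_const)
  from C1_grad_cmult[OF C1_grad_mult[OF this tilted_C1], of \<beta> t] show ?thesis
    by (simp add: source_def[abs_def] mult.assoc)
qed

lemma source_measurable [measurable]: "source t \<in> borel_measurable borel"
  by (intro borel_measurable_continuous_onI C1_grad_continuous[OF source_C1])

lemma source_bound: assumes t: "0 \<le> t"
  shows "\<exists>C\<ge>0. (\<forall>x. \<bar>source t x\<bar> \<le> C * exp (2 * norm x) * exp (- potential t x)) \<and>
    (\<forall>x. norm (gradient (source t) x) \<le> C * exp (3 * norm x) * exp (- potential t x))"
proof -
  obtain c where c: "0 < c" "\<And>x. excess x \<le> c * exp (2 * norm x)" using excess_exp_growth by blast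
  obtain A where A: "0 \<le> A" "\<And>x. norm (gradient h x) \<le> A * (1 + norm x)"
    "\<And>x. norm (gradient V x + (\<beta> * t) *\<^sub>R gradient h x) \<le> A * (1 + norm x)" using gradient_growth[of t] by blast
  let ?M = "mean (tilted t) excess" and ?Z = "normalizer t"
  have M0: "0 \<le> ?M" by (rule mean_excess_nonneg[OF tilted_prob_density[OF t]])
  note Z = normalizer_pos[OF t]
  have e1: "1 \<le> exp (r * norm (x::'a))" if "0 \<le> r" for r x using that by simp
  have d: "\<bar>excess x - ?M\<bar> \<le> (c + ?M) * exp (2 * norm x)" for x
  proof -
    have "?M * 1 \<le> ?M * exp (2 * norm x)" by (intro mult_left_mono e1 M0) simp
    then show ?thesis using c(2)[of x] excess_nonneg[of x] M0 c(1) unfolding distrib_right by (simp add: abs_le_iff)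
  qed
  have tl: "tilted t x = exp (- potential t x) * inverse ?Z" for x by (simp add: tilted_def divide_inverse)
  define C where "C = \<beta> * ((c + ?M) * A + A + (c + ?M)) * inverse ?Z"
  have C1: "\<beta> * (c + ?M) * inverse ?Z \<le> C" and C2: "\<beta> * ((c + ?M) * A + A) * inverse ?Z \<le> C" and C0: "0 \<le> C"
    unfolding C_def using \<beta>_pos c(1) M0 A(1) Z by (auto intro!: mult_right_mono mult_left_mono mult_nonneg_nonneg add_nonneg_nonneg)
  show ?thesis
  proof (intro exI[of _ C] conjI allI C0)
    fix x
    have "\<bar>source t x\<bar> = \<beta> * \<bar>excess x - ?M\<bar> * (exp (- potential t x) * inverse ?Z)"
      using \<beta>_pos Z by (simp add: source_def tl abs_mult)
    also have "\<dots> \<le> \<beta> * ((c + ?M) * exp (2 * norm x)) * (exp (- potential t x) * inverse ?Z)"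
      using \<beta>_pos Z by (intro mult_right_mono mult_left_mono d) auto
    also have "\<dots> = (\<beta> * (c + ?M) * inverse ?Z) * exp (2 * norm x) * exp (- potential t x)" by (simp only: ac_simps)
    also have "\<dots> \<le> C * exp (2 * norm x) * exp (- potential t x)" by (intro mult_right_mono C1) auto
    finally show "\<bar>source t x\<bar> \<le> C * exp (2 * norm x) * exp (- potential t x)" .
    let ?g = "gradient V x + (\<beta> * t) *\<^sub>R gradient h x"
    have g: "norm ?g \<le> A * exp (norm x)" "norm (gradient h x) \<le> A * exp (norm x)"
      using A by (auto intro: linear_growth_le_exp)
    have "norm (gradient (source t) x) = \<beta> * norm ((excess x - ?M) *\<^sub>R ((- tilted t x) *\<^sub>R ?g) + tilted t x *\<^sub>R gradient h x)"
      unfolding C1_grad_gradient[OF source_C1] using \<beta>_pos by simp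
    also have "\<dots> \<le> \<beta> * (\<bar>excess x - ?M\<bar> * (tilted t x * norm ?g) + tilted t x * norm (gradient h x))"
      using \<beta>_pos tilted_pos[OF t, of x]
      by (intro mult_left_mono order_trans[OF norm_triangle_ineq]) (auto simp: abs_mult)
    also have "\<dots> \<le> \<beta> * (((c + ?M) * exp (2 * norm x)) * (tilted t x * (A * exp (norm x))) + tilted t x * (A * exp (3 * norm x)))"
    proof (intro mult_left_mono add_mono mult_mono d g)
      have "A * exp (norm x) \<le> A * exp (3 * norm x)" using A(1) by (intro mult_left_mono) auto
      then show "norm (gradient h x) \<le> A * exp (3 * norm x)" using g(2) by linarith
    qed (use tilted_pos[OF t, of x] \<beta>_pos c(1) M0 in auto)
    also have "\<dots> = (\<beta> * ((c + ?M) * A + A) * inverse ?Z) * exp (3 * norm x) * exp (- potential t x)"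
    proof -
      have "exp (3 * norm x) = exp (2 * norm x) * exp (norm x)" unfolding exp_add[symmetric] by simp
      then show ?thesis by (simp add: tl algebra_simps)
    qed
    also have "\<dots> \<le> C * exp (3 * norm x) * exp (- potential t x)" by (intro mult_right_mono C2) auto
    finally show "norm (gradient (source t) x) \<le> C * exp (3 * norm x) * exp (- potential t x)" .
  qed
qed

lemma first_moment_integrable:
  assumes t: "0 \<le> t" and m[measurable]: "w \<in> borel_measurable borel"
    and C: "0 \<le> C" "\<And>x. \<bar>w x\<bar> \<le> C * exp (2 * norm x) * exp (- potential t x)"
  shows "integrable lborel (\<lambda>z. (1 + norm z) * \<bar>w z\<bar>)"
proof (rule exp_weighted_integrable(1)[OF t])
  fix x
  have "norm ((1 + norm x) * \<bar>w x\<bar>) \<le> exp (norm x) * (C * exp (2 * norm x) * exp (- potential t x))"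
    using C exp_ge_add_one_self[of "norm x"] by (auto simp: abs_mult intro!: mult_mono)
  also have "\<dots> = C * (exp (norm x) * exp (2 * norm x)) * exp (- potential t x)" by (simp only: ac_simps)
  also have "exp (norm x) * exp (2 * norm x) = exp (3 * norm x)" unfolding exp_add[symmetric] by simp
  finally show "norm ((1 + norm x) * \<bar>w x\<bar>) \<le> C * exp (3 * norm x) * exp (- potential t x)" .
qed (use C(1) in auto)

lemma source_integral: assumes t: "0 \<le> t" shows "(LINT x|lborel. source t x) = 0"
proof -
  note p = tilted_prob_density[OF t]
  have "source t x = \<beta> * (excess x * tilted t x) - \<beta> * mean (tilted t) excess * tilted t x" for x
    by (simp add: source_def algebra_simps)
  then have "(LINT x|lborel. source t x) = (LINT x|lborel. \<beta> * (excess x * tilted t x) - \<beta> * mean (tilted t) excess * tilted t x)"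
    by simp
  also have "\<dots> = \<beta> * mean (tilted t) excess - \<beta> * mean (tilted t) excess * 1"
    using excess_integrable[OF p] prob_densityD[OF p] by (simp add: mean_def)
  finally show ?thesis by simp
qed

lemma flux_divergence: assumes t: "0 \<le> t"
  shows "\<exists>D. (\<forall>b\<in>Basis. C1_grad (\<lambda>x. transport_flux (source t) x \<bullet> b) (D b)) \<and> (\<forall>x. (\<Sum>b\<in>Basis. D b x \<bullet> b) = source t x)"
proof -
  obtain C where C: "0 \<le> C" "\<And>x. \<bar>source t x\<bar> \<le> C * exp (2 * norm x) * exp (- potential t x)"
    "\<And>x. norm (gradient (source t) x) \<le> C * exp (3 * norm x) * exp (- potential t x)" using source_bound[OF t] by blast
  have gm: "gradient (source t) \<in> borel_measurable borel"
    unfolding C1_grad_gradient[OF source_C1] by (intro borel_measurable_continuous_onI C1_grad_continuous_grad[OF source_C1])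
  obtain B1 where B1: "\<And>x. norm (source t x) \<le> B1"
    using exp_weighted_integrable(2)[OF t source_measurable, of t C 2] C by auto
  obtain B2 where B2: "\<And>x. norm (gradient (source t) x) \<le> B2"
    using exp_weighted_integrable(2)[OF t gm C(3)] C(1) by auto
  have "C1_grad (source t) (gradient (source t))" unfolding C1_grad_gradient[OF source_C1] by (rule source_C1)
  then show ?thesis
    by (rule transport_flux_divergence[where C="max B1 B2"])
      (use B1 B2 first_moment_integrable[OF t source_measurable C(1,2)] source_integral[OF t] in \<open>auto simp: le_max_iff_disj\<close>)
qed

lemma flux_continuous: assumes t: "0 \<le> t" shows "continuous_on UNIV (transport_flux (source t))"
proof -
  obtain D where D: "\<And>b. b \<in> Basis \<Longrightarrow> C1_grad (\<lambda>x. transport_flux (source t) x \<bullet> b) (D b)"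
    using flux_divergence[OF t] by blast
  have "continuous_on UNIV (\<lambda>x. \<Sum>b\<in>Basis. (transport_flux (source t) x \<bullet> b) *\<^sub>R b)"
    by (intro continuous_intros C1_grad_continuous[OF D])
  then show ?thesis by (simp add: euclidean_representation)
qed

lemma tilted_drift: "0 \<le> t \<Longrightarrow> tilted t x *\<^sub>R optimal_drift t x = transport_flux (source t) x"
  using tilted_pos[of t x] by (simp add: optimal_drift_def)

lemma locally_integrable_continuous:
  fixes F :: "'c::euclidean_space \<Rightarrow> 'b::euclidean_space"
  assumes F: "continuous_on UNIV F" shows "locally_integrable F"
  unfolding locally_integrable_def set_integrable_def
  by (intro conjI allI impI borel_measurable_continuous_onI F borel_integrable_compact continuous_on_subset[OF F]) auto

lemma flux_integration_by_parts: assumes t: "0 \<le> t" and f: "test_fun f"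
  shows "(LINT x|lborel. gradient f x \<bullet> transport_flux (source t) x) = - (LINT x|lborel. f x * source t x)"
proof -
  obtain D where D: "\<And>b. b \<in> Basis \<Longrightarrow> C1_grad (\<lambda>x. transport_flux (source t) x \<bullet> b) (D b)"
    "\<And>x. (\<Sum>b\<in>Basis. D b x \<bullet> b) = source t x"
    using flux_divergence[OF t] by blast
  show ?thesis using integration_by_parts[OF D(1) f] by (simp add: D(2))
qed

lemma source_eq: assumes t: "0 \<le> t" shows "source t x = tilted t x * (\<beta> * (h x - mean (tilted t) h))"
  unfolding source_def h_minus_mean[OF tilted_prob_density[OF t]] by simp

lemma drift_solves_pde: assumes t: "0 \<le> t" shows "solves_pde \<beta> h (tilted t) (optimal_drift t)"
  unfolding solves_pde_def weighted_divergence_def has_weak_divergence_def tilted_drift[OF t] source_eq[OF t, symmetric]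
  using locally_integrable_continuous[OF flux_continuous[OF t]] locally_integrable_continuous[OF C1_grad_continuous[OF source_C1]]
    flux_integration_by_parts[OF t]
  by auto

lemma drift_solves_pde_classically: assumes t: "0 \<le> t"
  shows "solves_pde_classically \<beta> h (tilted t) (optimal_drift t)"
proof -
  obtain D where D: "\<And>b. b \<in> Basis \<Longrightarrow> C1_grad (\<lambda>x. transport_flux (source t) x \<bullet> b) (D b)"
    "\<And>x. (\<Sum>b\<in>Basis. D b x \<bullet> b) = source t x"
    using flux_divergence[OF t] by blast
  have "divergence (transport_flux (source t)) x = (\<Sum>b\<in>Basis. D b x \<bullet> b)" for x
    unfolding divergence_def by (intro sum.cong refl C1_grad_partial_deriv D)
  then have "divergence (transport_flux (source t)) x = source t x" for x by (simp only: D(2))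
  then show ?thesis
    unfolding solves_pde_classically_def tilted_drift[OF t]
    using tilted_pos[OF t] C1_grad_imp_Ck[OF D(1)] by (auto simp: source_eq[OF t] less_imp_neq[symmetric] simp del: One_nat_def)
qed

lemma drift_square_integrable: assumes t: "0 \<le> t"
  shows "integrable lborel (\<lambda>x. (norm (optimal_drift t x))\<^sup>2 * tilted t x)"
proof -
  obtain C where C: "0 \<le> C" "\<And>x. \<bar>source t x\<bar> \<le> C * exp (2 * norm x) * exp (- potential t x)" using source_bound[OF t] by blast
  obtain A where A: "0 \<le> A" "\<And>x. norm (gradient V x + (\<beta> * t) *\<^sub>R gradient h x) \<le> A * (1 + norm x)" using gradient_growth[of t] by blast
  have "integrable lborel (\<lambda>x. (norm (transport_flux (source t) x))\<^sup>2 * exp (potential t x))"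
    by (rule transport_flux_square_integrable[OF potential_C1 A potential_superlinear[OF t] source_measurable _ C flux_continuous[OF t]]) simp
  then have "integrable lborel (\<lambda>x. normalizer t * ((norm (transport_flux (source t) x))\<^sup>2 * exp (potential t x)))"
    by (rule integrable_mult_right)
  moreover have "normalizer t * ((norm (transport_flux (source t) x))\<^sup>2 * exp (potential t x)) = (norm (optimal_drift t x))\<^sup>2 * tilted t x" for x
  proof -
    have "(norm (optimal_drift t x))\<^sup>2 * tilted t x = (norm (transport_flux (source t) x))\<^sup>2 / tilted t x"
      using tilted_pos[OF t, of x] by (simp add: optimal_drift_def power_divide power2_eq_square field_simps)
    also have "\<dots> = normalizer t * ((norm (transport_flux (source t) x))\<^sup>2 * exp (potential t x))"
      using normalizer_pos[OF t] by (simp add: tilted_def exp_minus field_simps)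
    finally show ?thesis by simp
  qed
  ultimately show ?thesis by simp
qed

lemma joint_measurability:
  shows "(\<lambda>(t, x). tilted t x) \<in> borel_measurable (borel \<Otimes>\<^sub>M borel)"
    and "(\<lambda>(t, x). source t x) \<in> borel_measurable (borel \<Otimes>\<^sub>M borel)"
    and "(\<lambda>(t, x). optimal_drift t x) \<in> borel_measurable (borel \<Otimes>\<^sub>M borel)"
proof -
  have e: "(\<lambda>(t, x). exp (- potential t x)) \<in> borel_measurable (borel \<Otimes>\<^sub>M borel)"
    unfolding potential_def by measurable
  then have "(\<lambda>(t, x). exp (- potential t x)) \<in> borel_measurable (borel \<Otimes>\<^sub>M lborel)" by simp
  then have [measurable]: "normalizer \<in> borel_measurable borel"
    unfolding normalizer_def[abs_def] by (rule lborel.borel_measurable_lebesgue_integral)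
  show tm[measurable]: "(\<lambda>(t, x). tilted t x) \<in> borel_measurable (borel \<Otimes>\<^sub>M borel)"
    using e unfolding tilted_def case_prod_beta' by measurable
  have "(\<lambda>(t, x). excess x * tilted t x) \<in> borel_measurable (borel \<Otimes>\<^sub>M lborel)"
    using tm unfolding case_prod_beta' by measurable
  then have [measurable]: "(\<lambda>t. mean (tilted t) excess) \<in> borel_measurable borel"
    unfolding mean_def by (rule lborel.borel_measurable_lebesgue_integral)
  show s: "(\<lambda>(t, x). source t x) \<in> borel_measurable (borel \<Otimes>\<^sub>M borel)"
    using tm unfolding source_def case_prod_beta' by measurable
  show "(\<lambda>(t, x). optimal_drift t x) \<in> borel_measurable (borel \<Otimes>\<^sub>M borel)"
    using transport_flux_measurable[OF s] tm unfolding optimal_drift_def case_prod_beta' by measurable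
qed

text \<open>On \<open>{0..T}\<close> all sources lie below one integrable majorant \<open>w\<close>: the normalizer is smallest at \<open>T\<close>,
  the tilted weight is largest at \<open>0\<close>.\<close>

lemma flux_locally_bounded: assumes T: "0 \<le> T"
  shows "\<exists>B. \<forall>t\<in>{0..T}. \<forall>x. norm (transport_flux (source t) x) \<le> B * (1 + norm x)"
proof -
  obtain c where c: "0 < c" "\<And>x. excess x \<le> c * exp (2 * norm x)" using excess_exp_growth by blast
  let ?N = "LINT x|lborel. excess x * exp (- V x)"
  define m where "m = ?N / normalizer T"
  note Z = normalizer_pos[OF T]
  have Vi: "integrable lborel (\<lambda>x. excess x * exp (- V x))" using excess_integrable[OF initial] .
  have N0: "0 \<le> ?N" using excess_nonneg by (intro integral_nonneg_AE AE_I2) auto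
  then have m0: "0 \<le> m" using Z by (simp add: m_def)
  define w where "w z = (\<beta> / normalizer T) * ((excess z + m) * exp (- V z))" for z
  have le: "\<bar>source t z\<bar> \<le> w z" if t: "t \<in> {0..T}" for t z
  proof -
    have t0: "0 \<le> t" "t \<le> T" using t by auto
    note Zt = normalizer_pos[OF t0(1)] normalizer_antimono[OF t0]
    have tl: "tilted t x \<le> exp (- V x) / normalizer T" for x
      using exp_potential_antimono[OF t0(1), of x] Z Zt unfolding tilted_def potential_0
      by (intro frac_le) auto
    have M: "mean (tilted t) excess \<le> m"
    proof -
      have "mean (tilted t) excess \<le> (LINT x|lborel. (excess x * exp (- V x)) / normalizer T)"
        unfolding mean_def
      proof (rule integral_mono[OF excess_integrable[OF tilted_prob_density[OF t0(1)]]])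
        show "integrable lborel (\<lambda>x. (excess x * exp (- V x)) / normalizer T)" by (intro integrable_divide Vi)
        show "excess x * tilted t x \<le> (excess x * exp (- V x)) / normalizer T" for x
          using mult_left_mono[OF tl excess_nonneg] by simp
      qed
      then show ?thesis by (simp add: m_def)
    qed
    have "\<bar>excess z - mean (tilted t) excess\<bar> \<le> excess z + m"
      using M mean_excess_nonneg[OF tilted_prob_density[OF t0(1)]] excess_nonneg[of z] m0 by (simp add: abs_le_iff)
    then have "\<beta> * \<bar>excess z - mean (tilted t) excess\<bar> * tilted t z \<le> \<beta> * (excess z + m) * (exp (- V z) / normalizer T)"
      using \<beta>_pos tilted_pos[OF t0(1), of z] excess_nonneg[of z] m0 by (intro mult_mono mult_left_mono tl) auto
    then show ?thesis
      using \<beta>_pos tilted_pos[OF t0(1), of z] by (simp add: source_def w_def abs_mult)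
  qed
  have [measurable]: "w \<in> borel_measurable borel" unfolding w_def[abs_def] by measurable
  have w0: "0 \<le> w z" for z unfolding w_def using \<beta>_pos Z excess_nonneg[of z] m0 by auto
  define C where "C = \<beta> / normalizer T * (c + m)"
  have C0: "0 \<le> C" unfolding C_def using \<beta>_pos Z c(1) m0 by auto
  have wb: "w z \<le> C * exp (2 * norm z) * exp (- potential 0 z)" for z
  proof -
    have "excess z + m \<le> (c + m) * exp (2 * norm z)"
      using c(2)[of z] mult_left_mono[of 1 "exp (2 * norm z)" m] m0 by (simp add: distrib_right)
    then have "w z \<le> (\<beta> / normalizer T) * (((c + m) * exp (2 * norm z)) * exp (- V z))"
      unfolding w_def using \<beta>_pos Z by (intro mult_left_mono mult_right_mono) auto
    then show ?thesis by (simp add: C_def potential_0 mult.assoc)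
  qed
  obtain B where B: "\<And>z. norm (w z) \<le> B"
    using exp_weighted_integrable(2)[OF order_refl, of w C 2] wb w0 C0 by (auto simp: abs_of_nonneg)
  have "integrable lborel (\<lambda>z. (1 + norm z) * \<bar>w z\<bar>)"
    by (rule first_moment_integrable[OF order_refl _ C0]) (use wb w0 in \<open>auto simp: abs_of_nonneg\<close>)
  then have "integrable lborel (\<lambda>z. (1 + norm z) * w z)" using w0 by (simp add: abs_of_nonneg)
  moreover have "w z \<le> B" for z using B[of z] by simp
  ultimately obtain B' where B': "\<forall>s x. s \<in> borel_measurable borel \<longrightarrow> (\<forall>z. \<bar>s z\<bar> \<le> w z) \<longrightarrow>
      norm (transport_flux s x) \<le> B' * (1 + norm x)"
    by (rule exE[OF transport_flux_bound])
  show ?thesis by (intro exI[of _ B'] ballI allI B'[rule_format] source_measurable le)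
qed

lemma tilted_mean_derivative:
  assumes f: "f \<in> borel_measurable borel" "\<And>x. \<bar>f x\<bar> \<le> c" and t: "0 \<le> t"
  shows "((\<lambda>t. mean (tilted t) f) has_real_derivative - \<beta> * cov f (tilted t)) (at t within {0..})"
proof -
  let ?N = "\<lambda>\<phi> t. LINT x|lborel. (\<phi> x * exp (- V x)) * exp (- (t * (\<beta> * excess x)))"
  have mean: "mean (tilted t) \<phi> = ?N \<phi> t / normalizer t" for \<phi> t
    unfolding mean_def tilted_def exp_potential by (simp add: mult.assoc)
  have part: "normalizer t = ?N (\<lambda>x. 1) t" for t unfolding normalizer_def exp_potential by simp
  have be: "(\<lambda>x. \<beta> * excess x) \<in> borel_measurable lborel" "0 \<le> \<beta> * excess x" for x
    using \<beta>_pos excess_nonneg[of x] by auto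
  have d: "(?N \<phi> has_real_derivative - (\<beta> * ?N (\<lambda>x. \<phi> x * excess x) t)) (at t within {0..})"
    if p: "\<phi> \<in> borel_measurable borel" "\<And>x. \<bar>\<phi> x\<bar> \<le> c" for \<phi> c
  proof -
    have "integrable lborel (\<lambda>x. \<phi> x * exp (- V x))" by (rule integrable_bounded_times_density[OF initial p])
    moreover have "integrable lborel (\<lambda>x. \<phi> x * exp (- V x) * (\<beta> * excess x))"
      using integrable_mult_right[OF bounded_times_excess_integrable(1)[OF initial p], of \<beta>] by (simp add: ac_simps)
    ultimately have "(?N \<phi> has_real_derivative - (LINT x|lborel. \<phi> x * exp (- V x) * (\<beta> * excess x) * exp (- (t * (\<beta> * excess x))))) (at t within {0..})"
      by (rule exp_tilt_derivative[OF be _ _ t])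
    moreover have "\<phi> x * exp (- V x) * (\<beta> * excess x) * exp (- (t * (\<beta> * excess x))) =
        \<beta> * ((\<phi> x * excess x * exp (- V x)) * exp (- (t * (\<beta> * excess x))))" for x by (simp only: ac_simps)
    ultimately show ?thesis by simp
  qed
  note Z = normalizer_pos[OF t]
  have "((\<lambda>t. ?N f t / ?N (\<lambda>x. 1) t) has_real_derivative
     (- (\<beta> * ?N (\<lambda>x. f x * excess x) t) * ?N (\<lambda>x. 1) t - ?N f t * - (\<beta> * ?N (\<lambda>x. 1 * excess x) t)) / (?N (\<lambda>x. 1) t * ?N (\<lambda>x. 1) t)) (at t within {0..})"
    by (rule DERIV_divide[OF d[OF f] d[of "\<lambda>x. 1" 1]]) (use Z part[of t] in auto)
  moreover have "(- (\<beta> * ?N (\<lambda>x. f x * excess x) t) * ?N (\<lambda>x. 1) t - ?N f t * - (\<beta> * ?N (\<lambda>x. 1 * excess x) t)) / (?N (\<lambda>x. 1) t * ?N (\<lambda>x. 1) t)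
     = - \<beta> * cov f (tilted t)"
    unfolding cov_def mean part[symmetric] using Z by (simp add: field_simps)
  ultimately show ?thesis unfolding mean part by simp
qed

lemma tilted_cov_continuous:
  assumes f: "f \<in> borel_measurable borel" "\<And>x. \<bar>f x\<bar> \<le> c"
  shows "continuous_on {0..} (\<lambda>t. cov f (tilted t))"
proof -
  have be: "(\<lambda>x. \<beta> * excess x) \<in> borel_measurable lborel" "0 \<le> \<beta> * excess x" for x
    using \<beta>_pos excess_nonneg[of x] by auto
  have part: "normalizer = (\<lambda>t. LINT x|lborel. (1 * exp (- V x)) * exp (- (t * (\<beta> * excess x))))"
    unfolding normalizer_def[abs_def] exp_potential by simp
  have "continuous_on {0..} normalizer"
    unfolding part using prob_densityD(3)[OF initial] by (intro exp_tilt_continuous be) simp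
  moreover have "continuous_on {0..} (\<lambda>t. LINT x|lborel. (\<phi> x * exp (- V x)) * exp (- (t * (\<beta> * excess x))))"
    if "integrable lborel (\<lambda>x. \<phi> x * exp (- V x))" for \<phi>
    by (intro exp_tilt_continuous be that)
  moreover have "mean (tilted t) \<phi> = (LINT x|lborel. (\<phi> x * exp (- V x)) * exp (- (t * (\<beta> * excess x)))) / normalizer t" for \<phi> t
    unfolding mean_def tilted_def exp_potential by (simp add: mult.assoc)
  ultimately have m: "continuous_on {0..} (\<lambda>t. mean (tilted t) \<phi>)" if "integrable lborel (\<lambda>x. \<phi> x * exp (- V x))" for \<phi>
    using that normalizer_pos by (simp only:) (intro continuous_on_divide, auto simp: less_imp_neq[symmetric])
  show ?thesis unfolding cov_def
    by (intro continuous_intros m bounded_times_excess_integrable(1)[OF initial f] integrable_bounded_times_density[OF initial f]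
        excess_integrable[OF initial])
qed

text \<open>Fubini reduces the weak equation to single times. There integration by parts replaces the flux by
  its source, and the source integrated against \<open>f\<close> is minus the time derivative of the mean of \<open>f\<close>.\<close>

lemma tilted_flow: "controlled_flow (\<lambda>x. exp (- V x)) tilted optimal_drift"
  unfolding controlled_flow_def
proof (intro conjI allI impI)
  have cl: "{0..} \<times> UNIV \<in> sets (borel :: (real \<times> 'a) measure)" by (intro borel_closed closed_Times) auto
  show "set_borel_measurable borel ({0..} \<times> UNIV) (\<lambda>(t, x). tilted t x)"
    "set_borel_measurable borel ({0..} \<times> UNIV) (\<lambda>(t, x). optimal_drift t x)"
    using joint_measurability(1,3) cl unfolding set_borel_measurable_def borel_prod by auto
  show "tilted t \<in> prob_densities" "integrable lborel (\<lambda>x. (norm (optimal_drift t x))\<^sup>2 * tilted t x)" if "0 \<le> t" for t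
    using that by (rule tilted_prob_density, rule drift_square_integrable)
  show "tilted 0 = (\<lambda>x. exp (- V x))" by (rule tilted_0)
  fix f :: "'a \<Rightarrow> real" and t :: real assume f: "test_fun f" and t: "0 \<le> t"
  note test_fun_measurable[OF f, measurable]
  let ?w = "\<lambda>p. indicator ({0..t} \<times> UNIV) p *\<^sub>R (case p of (s, x) \<Rightarrow> gradient f x \<bullet> (tilted s x *\<^sub>R optimal_drift s x))"
  obtain K c where K: "compact K" "0 < c" "\<And>x. \<bar>f x\<bar> \<le> c" "\<And>x. norm (gradient f x) \<le> c"
    "\<And>x. x \<notin> K \<Longrightarrow> gradient f x = 0" using f by (elim test_funE) blast
  obtain r where r: "\<And>x. x \<in> K \<Longrightarrow> norm x \<le> r" using compact_imp_bounded[OF K(1)] by (auto simp: bounded_iff)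
  obtain B where B: "\<And>s x. s \<in> {0..t} \<Longrightarrow> norm (transport_flux (source s) x) \<le> B * (1 + norm x)"
    using flux_locally_bounded[OF t] by blast
  have wm: "?w \<in> borel_measurable borel"
  proof -
    have cl: "{0..t} \<times> UNIV \<in> sets (borel \<Otimes>\<^sub>M borel :: (real \<times> 'a) measure)" by simp
    show ?thesis unfolding borel_prod[symmetric]
      using joint_measurability(1,3) cl unfolding case_prod_beta' by measurable
  qed
  have wi: "integrable lborel ?w"
  proof (rule integrable_lborel_bounded_support[OF wm, where K="{0..t} \<times> K" and c="\<bar>c * (B * (1 + r))\<bar>"])
    show "compact ({0..t} \<times> K)" by (intro compact_Times K(1)) auto
    show "?w p = 0" if "p \<notin> {0..t} \<times> K" for p
      using that K(5)[of "snd p"] by (cases p) (auto simp: indicator_def)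
    show "norm (?w p) \<le> \<bar>c * (B * (1 + r))\<bar>" for p
    proof (cases "p \<in> {0..t} \<times> K")
      case True
      obtain s x where p: "p = (s, x)" by (cases p)
      have s: "s \<in> {0..t}" and x: "x \<in> K" using True p by auto
      have "0 \<le> B * (1 + norm (0::'a))" using order_trans[OF norm_ge_zero B[OF s, of 0]] .
      then have B0: "0 \<le> B" by simp
      have "norm (?w p) = \<bar>gradient f x \<bullet> transport_flux (source s) x\<bar>"
        using s tilted_drift[of s x] by (simp add: p del: inner_scaleR_right)
      also have "\<dots> \<le> norm (gradient f x) * norm (transport_flux (source s) x)" by (rule Cauchy_Schwarz_ineq2)
      also have "\<dots> \<le> c * (B * (1 + r))"
        using K(2) B0 r[OF x] by (intro mult_mono K(4) order_trans[OF B[OF s] mult_left_mono]) auto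
      finally show ?thesis by linarith
    next
      case False
      then show ?thesis using K(5)[of "snd p"] by (cases p) (auto simp: indicator_def)
    qed
  qed
  then show "set_integrable lborel ({0..t} \<times> UNIV) (\<lambda>(s, x). gradient f x \<bullet> (tilted s x *\<^sub>R optimal_drift s x))"
    by (simp add: set_integrable_def)
  have wi': "integrable (lborel \<Otimes>\<^sub>M lborel) ?w" using wi by (simp add: lborel_prod)
  have inner: "(LINT x|lborel. ?w (s, x)) = indicator {0..t} s *\<^sub>R (- \<beta> * cov f (tilted s))" for s
  proof (cases "s \<in> {0..t}")
    case True
    then have s: "0 \<le> s" by simp
    have "(LINT x|lborel. ?w (s, x)) = flux_rate f (tilted s) (optimal_drift s)"
      using True by (simp add: flux_rate_def)
    then show ?thesis using True flux_rate_solution[OF tilted_prob_density[OF s] drift_solves_pde[OF s] f] by simp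
  qed simp
  have "(LINT (s, x):{0..t} \<times> UNIV|lborel. gradient f x \<bullet> (tilted s x *\<^sub>R optimal_drift s x)) =
      (LINT p|(lborel \<Otimes>\<^sub>M lborel). ?w p)"
    by (simp add: set_lebesgue_integral_def lborel_prod)
  also have "\<dots> = (LINT s|lborel. indicator {0..t} s *\<^sub>R (- \<beta> * cov f (tilted s)))"
    using lborel_pair.integral_fst'[OF wi'] unfolding inner by simp
  also have "\<dots> = mean (tilted t) f - mean (tilted 0) f"
  proof (rule integral_FTC_Icc[OF t])
    fix s assume s: "0 \<le> s" "s \<le> t"
    have "((\<lambda>t. mean (tilted t) f) has_real_derivative - \<beta> * cov f (tilted s)) (at s within {0..t})"
      by (rule has_field_derivative_subset[OF tilted_mean_derivative[OF test_fun_measurable(1)[OF f] K(3) s(1)]]) auto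
    then show "((\<lambda>t. mean (tilted t) f) has_vector_derivative - \<beta> * cov f (tilted s)) (at s within {0..t})"
      by (simp add: has_real_derivative_iff_has_vector_derivative)
  next
    show "continuous_on {0..t} (\<lambda>s. - \<beta> * cov f (tilted s))"
      by (intro continuous_intros continuous_on_subset[OF tilted_cov_continuous[OF test_fun_measurable(1)[OF f] K(3)]]) auto
  qed
  finally show "(LINT x|lborel. f x * tilted t x) - (LINT x|lborel. f x * exp (- V x)) =
      (LINT (s, x):{0..t} \<times> UNIV|lborel. gradient f x \<bullet> (tilted s x *\<^sub>R optimal_drift s x))"
    by (simp add: mean_def tilted_0)
qed

end

section \<open>A countable family of test functions suffices\<close>

text \<open>A continuous function on a compact set is determined up to \<open>\<epsilon>\<close> by finitely many pairs of a basic
  open set and a value from a countable dense set; picking one member of the family for each such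
  finite description that fits some member gives the countable dense part.\<close>

lemma countable_uniformly_dense:
  fixes F :: "('a::euclidean_space \<Rightarrow> 'b::euclidean_space) set"
  assumes K: "compact K" and cont: "\<And>f. f \<in> F \<Longrightarrow> continuous_on K f"
  shows "\<exists>C\<subseteq>F. countable C \<and> (\<forall>f\<in>F. \<forall>e>0. \<exists>g\<in>C. \<forall>x\<in>K. dist (f x) (g x) < e)"
proof -
  obtain B :: "'a set set" where B: "countable B" "topological_basis B" using ex_countable_basis by blast
  obtain D :: "'b set" where D: "countable D" "\<And>X. open X \<Longrightarrow> X \<noteq> {} \<Longrightarrow> \<exists>d\<in>D. d \<in> X"
    using countable_dense_exists by metis
  define fits where "fits f P n \<longleftrightarrow> K \<subseteq> (\<Union>p\<in>P. fst p) \<and>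
      (\<forall>p\<in>P. \<forall>x\<in>fst p \<inter> K. dist (f x) (snd p) < 1 / real (Suc n))" for f :: "'a \<Rightarrow> 'b" and P n
  have ex: "\<exists>P. finite P \<and> P \<subseteq> B \<times> D \<and> fits f P n" if f: "f \<in> F" for f n
  proof -
    let ?e = "1 / real (Suc n)"
    have "\<exists>U v. U \<in> B \<and> v \<in> D \<and> x \<in> U \<and> (\<forall>y\<in>U \<inter> K. dist (f y) v < ?e)" if x: "x \<in> K" for x
    proof -
      obtain v where v: "v \<in> D" "v \<in> ball (f x) (?e / 2)"
        using D(2)[of "ball (f x) (?e / 2)"] by (auto simp del: of_nat_Suc)
      obtain d where d: "0 < d" "\<And>y. y \<in> K \<Longrightarrow> dist y x < d \<Longrightarrow> dist (f y) (f x) < ?e / 2"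
        using cont[OF f, unfolded continuous_on_iff, rule_format, OF x, of "?e / 2"] by (auto simp del: of_nat_Suc)
      obtain U where U: "U \<in> B" "x \<in> U" "U \<subseteq> ball x d"
        using topological_basisE[OF B(2) open_ball, of x x d] d(1) by auto
      have "dist (f y) v < ?e" if "y \<in> U \<inter> K" for y
      proof -
        have "dist (f y) (f x) < ?e / 2" using that U(3) by (intro d(2)) (auto simp: dist_commute)
        then show ?thesis using v(2) dist_triangle[of "f y" v "f x"] unfolding mem_ball by linarith
      qed
      then show ?thesis using U v by blast
    qed
    then obtain U v where Uv: "\<And>x. x \<in> K \<Longrightarrow> U x \<in> B \<and> v x \<in> D \<and> x \<in> U x \<and> (\<forall>y\<in>U x \<inter> K. dist (f y) (v x) < ?e)"
      by metis
    obtain X where X: "X \<subseteq> K" "finite X" "K \<subseteq> (\<Union>x\<in>X. U x)"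
      by (rule compactE_image[OF K, of K U]) (use Uv topological_basis_open[OF B(2)] in blast)+
    show ?thesis
      by (intro exI[of _ "(\<lambda>x. (U x, v x)) ` X"] conjI) (use X Uv in \<open>auto simp: fits_def simp del: of_nat_Suc\<close>)
  qed
  define data where "data = {P. finite P \<and> P \<subseteq> B \<times> D} \<times> (UNIV :: nat set)"
  have cd: "countable data"
    unfolding data_def using B(1) D(1) by (intro countable_SIGMA countable_Collect_finite_subset) auto
  define pick where "pick q = (SOME f. f \<in> F \<and> fits f (fst q) (snd q))" for q
  define C where "C = pick ` {q \<in> data. \<exists>f\<in>F. fits f (fst q) (snd q)}"
  have pick: "pick q \<in> F \<and> fits (pick q) (fst q) (snd q)" if "\<exists>f\<in>F. fits f (fst q) (snd q)" for q
    using someI_ex[of "\<lambda>f. f \<in> F \<and> fits f (fst q) (snd q)"] that unfolding pick_def by blast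
  show ?thesis
  proof (intro exI[of _ C] conjI ballI allI impI)
    show "C \<subseteq> F" using pick by (auto simp: C_def)
    show "countable C" unfolding C_def by (intro countable_image countable_subset[OF _ cd]) auto
    fix f e assume f: "f \<in> F" and e: "(0::real) < e"
    obtain n where n: "1 / real (Suc n) < e / 2" using nat_approx_posE[of "e / 2"] e by auto
    obtain P where P: "finite P" "P \<subseteq> B \<times> D" "fits f P n" using ex[OF f] by blast
    let ?g = "pick (P, n)"
    have g: "fits ?g P n" using pick[of "(P, n)"] f P(3) by auto
    have "?g \<in> C" unfolding C_def using f P by (intro imageI) (auto simp: data_def)
    moreover have "dist (f x) (?g x) < e" if x: "x \<in> K" for x
    proof -
      obtain p where p: "p \<in> P" "x \<in> fst p" using P(3) x by (auto simp: fits_def)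
      have "dist (f x) (snd p) < 1 / real (Suc n)" "dist (?g x) (snd p) < 1 / real (Suc n)"
        using P(3) g p x unfolding fits_def by blast+
      then show ?thesis using dist_triangle2[of "f x" "?g x" "snd p"] n by linarith
    qed
    ultimately show "\<exists>g\<in>C. \<forall>x\<in>K. dist (f x) (g x) < e" by blast
  qed
qed

lemma countable_dense_test_funs:
  obtains T :: "('a::euclidean_space \<Rightarrow> real) set" where "countable T" "\<And>g. g \<in> T \<Longrightarrow> test_fun g"
    "\<And>f e. test_fun f \<Longrightarrow> 0 < e \<Longrightarrow> \<exists>g\<in>T. \<forall>x. \<bar>f x - g x\<bar> \<le> e \<and> norm (gradient f x - gradient g x) \<le> e"
proof -
  define F :: "nat \<Rightarrow> ('a \<Rightarrow> real) set" where
    "F N = {f. test_fun f \<and> (\<forall>x. x \<notin> cball 0 (real N) \<longrightarrow> f x = 0 \<and> gradient f x = 0)}" for N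
  define \<phi> where "\<phi> f x = (f x, gradient f x)" for f :: "'a \<Rightarrow> real" and x
  have "\<exists>T\<subseteq>F N. countable T \<and> (\<forall>f\<in>F N. \<forall>e>0. \<exists>g\<in>T. \<forall>x\<in>cball 0 (real N). dist (\<phi> f x) (\<phi> g x) < e)" for N
  proof -
    have c: "continuous_on (cball 0 (real N)) k" if "k \<in> \<phi> ` F N" for k
      using that by (auto simp: F_def \<phi>_def intro!: continuous_on_Pair C1_grad_continuous C1_grad_continuous_grad test_fun_C1_grad)
    have "\<exists>C\<subseteq>\<phi> ` F N. countable C \<and>
      (\<forall>k\<in>\<phi> ` F N. \<forall>e>0. \<exists>l\<in>C. \<forall>x\<in>cball 0 (real N). dist (k x) (l x) < e)"
      by (rule countable_uniformly_dense[OF compact_cball c])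
    then obtain C where "C \<subseteq> \<phi> ` F N \<and> countable C \<and>
      (\<forall>k\<in>\<phi> ` F N. \<forall>e>0. \<exists>l\<in>C. \<forall>x\<in>cball 0 (real N). dist (k x) (l x) < e)" ..
    then have C: "C \<subseteq> \<phi> ` F N" "countable C"
      "\<forall>k\<in>\<phi> ` F N. \<forall>e>0. \<exists>l\<in>C. \<forall>x\<in>cball 0 (real N). dist (k x) (l x) < e" by auto
    then obtain T where T: "countable T" "T \<subseteq> F N" "C = \<phi> ` T" using countable_subset_image[of C \<phi> "F N"] by blast
    have "\<forall>f\<in>F N. \<forall>e>0. \<exists>g\<in>T. \<forall>x\<in>cball 0 (real N). dist (\<phi> f x) (\<phi> g x) < e"
      using C(3) unfolding T(3) by (simp only: ball_simps bex_simps)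
    with T show ?thesis by (intro exI[of _ T] conjI)
  qed
  then have "\<exists>T. \<forall>N. T N \<subseteq> F N \<and> countable (T N) \<and>
      (\<forall>f\<in>F N. \<forall>e>0. \<exists>g\<in>T N. \<forall>x\<in>cball 0 (real N). dist (\<phi> f x) (\<phi> g x) < e)"
    by (intro choice allI)
  then obtain T where T': "\<forall>N. T N \<subseteq> F N \<and> countable (T N) \<and>
      (\<forall>f\<in>F N. \<forall>e>0. \<exists>g\<in>T N. \<forall>x\<in>cball 0 (real N). dist (\<phi> f x) (\<phi> g x) < e)" ..
  have T: "\<And>N. T N \<subseteq> F N" "\<And>N. countable (T N)"
    "\<And>N f e. f \<in> F N \<Longrightarrow> 0 < e \<Longrightarrow> \<exists>g\<in>T N. \<forall>x\<in>cball 0 (real N). dist (\<phi> f x) (\<phi> g x) < e"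
    using T' by auto
  show thesis
  proof (rule that[of "\<Union>N. T N"])
    show "countable (\<Union>N. T N)" using T(2) by blast
    show "test_fun g" if "g \<in> (\<Union>N. T N)" for g using that T(1) by (auto simp: F_def)
    fix f :: "'a \<Rightarrow> real" and e :: real assume f: "test_fun f" and e: "0 < e"
    obtain K where K: "compact K" "\<And>x. x \<notin> K \<Longrightarrow> f x = 0" "\<And>x. x \<notin> K \<Longrightarrow> gradient f x = 0"
      using f by (elim test_funE) blast
    obtain r where r: "\<And>x. x \<in> K \<Longrightarrow> norm x \<le> r" using compact_imp_bounded[OF K(1)] by (auto simp: bounded_iff)
    obtain N where N: "r \<le> real N" using real_arch_simple by blast
    have fN: "f \<in> F N"
    proof -
      have "x \<notin> K" if "x \<notin> cball 0 (real N)" for x using r[of x] N that by auto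
      then show ?thesis using f K by (auto simp: F_def)
    qed
    then obtain g where g: "g \<in> T N" "\<And>x. x \<in> cball 0 (real N) \<Longrightarrow> dist (\<phi> f x) (\<phi> g x) < e"
      using T(3)[OF _ e] by blast
    have gN: "g \<in> F N" using g(1) T(1) by blast
    have "\<bar>f x - g x\<bar> \<le> e \<and> norm (gradient f x - gradient g x) \<le> e" for x
    proof (cases "x \<in> cball 0 (real N)")
      case True
      have "dist (f x) (g x) \<le> dist (\<phi> f x) (\<phi> g x)" "dist (gradient f x) (gradient g x) \<le> dist (\<phi> f x) (\<phi> g x)"
        using dist_fst_le[of "\<phi> f x" "\<phi> g x"] dist_snd_le[of "\<phi> f x" "\<phi> g x"] by (simp_all add: \<phi>_def)
      then show ?thesis using g(2)[OF True] by (simp add: dist_norm)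
    next
      case False
      then show ?thesis using fN gN e by (auto simp: F_def)
    qed
    then show "\<exists>g\<in>(\<Union>N. T N). \<forall>x. \<bar>f x - g x\<bar> \<le> e \<and> norm (gradient f x - gradient g x) \<le> e" using g(1) by blast
  qed
qed

section \<open>Optimal controls solve the equation\<close>

context observation
begin

definition defect :: "('a \<Rightarrow> real) \<Rightarrow> ('a \<Rightarrow> real) \<Rightarrow> ('a \<Rightarrow> 'a) \<Rightarrow> real" where
  "defect f \<rho> u = flux_rate f \<rho> u + \<beta> * cov f \<rho>"

lemma residual_tendsto_defect:
  assumes p: "\<rho> \<in> prob_densities" and f: "test_fun f"
  shows "(\<lambda>n. residual f n \<rho> u) \<longlonglongrightarrow> defect f \<rho> u"
proof -
  note test_fun_measurable[OF f, measurable]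
  obtain c where c: "\<And>x. \<bar>f x\<bar> \<le> c" using f by (elim test_funE) blast
  have "(\<lambda>n. mean \<rho> (\<lambda>x. f x * trunc n x)) \<longlonglongrightarrow> mean \<rho> (\<lambda>x. f x * excess x)"
  proof (rule mean_dominated_convergence[OF p])
    show "(\<lambda>n. f x * trunc n x) \<longlonglongrightarrow> f x * excess x" for x by (intro tendsto_mult tendsto_const trunc_tendsto)
    have "integrable lborel (\<lambda>x. c * (excess x * \<rho> x))" by (intro integrable_mult_right excess_integrable p)
    then show "integrable lborel (\<lambda>x. c * excess x * \<rho> x)" by (simp add: mult.assoc)
    show "\<bar>f x * trunc n x\<bar> \<le> c * excess x" for n x
      unfolding abs_mult using c[of x] trunc_bounds(1,2)[of n x] by (intro mult_mono) auto
  qed measurable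
  then show ?thesis unfolding residual_def defect_def cov_def by (intro tendsto_intros mean_trunc_tendsto p)
qed

text \<open>For a flow of minimal cost the lower bound has no room left: the squared residuals integrate to
  at most a multiple of what truncation removed from the initial mean, which tends to zero.\<close>

lemma optimal_defect_eq_0:
  assumes adm: "admissible h xbar \<rho>\<^sub>0 \<rho> u" and opt: "cost \<beta> h \<rho> u \<le> ennreal (\<beta> * mean \<rho>\<^sub>0 excess)"
    and f: "test_fun f"
  shows "AE s in lborel. 0 \<le> s \<longrightarrow> defect f (\<rho> s) (u s) = 0"
proof -
  have flow: "controlled_flow \<rho>\<^sub>0 \<rho> u" using adm by (simp add: admissible_def)
  have p0: "\<rho>\<^sub>0 \<in> prob_densities" using flow_density[OF flow, of 0] by (simp add: flow_0[OF flow])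
  obtain c where c: "0 < c" "\<And>x. \<bar>f x\<bar> \<le> c" using f by (elim test_funE) blast
  let ?r = "\<lambda>n s. (residual f n (\<rho> s) (u s))\<^sup>2"
  have fin: "(\<integral>\<^sup>+t\<in>{0..T}. Lagrangian \<beta> h (\<rho> t) (u t) \<partial>lborel) < \<infinity>" for T
    using order_trans[OF cost_restrict_le opt] by (rule order.strict_trans1) simp
  have int: "set_integrable lborel {0..T} (?r n)" if "0 \<le> T" for n T
    by (rule flow_lower_bound(1)[OF flow that fin f c(2,1)])
  have small: "(LINT s:{0..T}|lborel. ?r n s) \<le> 2 * c\<^sup>2 * (\<beta> * (mean \<rho>\<^sub>0 excess - mean \<rho>\<^sub>0 (trunc n)))" if T: "0 \<le> T" for T n
  proof (rule tendsto_lowerbound)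
    show "((\<lambda>S. 2 * c\<^sup>2 * (\<beta> * (mean \<rho>\<^sub>0 excess - mean \<rho>\<^sub>0 (trunc n) + mean (\<rho> S) excess))) \<longlongrightarrow>
        2 * c\<^sup>2 * (\<beta> * (mean \<rho>\<^sub>0 excess - mean \<rho>\<^sub>0 (trunc n)))) at_top"
      using tendsto_mult[OF tendsto_const tendsto_mult[OF tendsto_const tendsto_add[OF tendsto_const admissible_mean_excess_tendsto[OF adm]]]]
      by fastforce
    show "\<forall>\<^sub>F S in at_top. (LINT s:{0..T}|lborel. ?r n s) \<le>
        2 * c\<^sup>2 * (\<beta> * (mean \<rho>\<^sub>0 excess - mean \<rho>\<^sub>0 (trunc n) + mean (\<rho> S) excess))"
      using eventually_ge_at_top[of T]
    proof eventually_elim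
      case (elim S)
      then have S: "0 \<le> S" using T by simp
      have "(LINT s:{0..T}|lborel. ?r n s) \<le> (LINT s:{0..S}|lborel. ?r n s)"
        unfolding set_lebesgue_integral_def
        using int[OF T] int[OF S] elim by (intro integral_mono) (auto simp: set_integrable_def indicator_def)
      moreover have "(LINT s:{0..S}|lborel. ?r n s) / (2 * c\<^sup>2) + \<beta> * (mean \<rho>\<^sub>0 (trunc n) - mean (\<rho> S) (trunc n)) \<le> \<beta> * mean \<rho>\<^sub>0 excess"
      proof -
        have "enn2real (\<integral>\<^sup>+t\<in>{0..S}. Lagrangian \<beta> h (\<rho> t) (u t) \<partial>lborel) \<le> enn2real (ennreal (\<beta> * mean \<rho>\<^sub>0 excess))"
          by (intro enn2real_mono order_trans[OF cost_restrict_le opt]) simp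
        also have "\<dots> = \<beta> * mean \<rho>\<^sub>0 excess" using \<beta>_pos mean_excess_nonneg[OF p0] by simp
        finally show ?thesis using flow_lower_bound(2)[OF flow S fin f c(2,1), of n] by linarith
      qed
      moreover have "\<beta> * mean (\<rho> S) (trunc n) \<le> \<beta> * mean (\<rho> S) excess"
        using mean_trunc_bounds(2)[OF flow_density[OF flow S]] \<beta>_pos by (intro mult_left_mono) auto
      ultimately have "(LINT s:{0..T}|lborel. ?r n s) / (2 * c\<^sup>2) \<le> \<beta> * (mean \<rho>\<^sub>0 excess - mean \<rho>\<^sub>0 (trunc n) + mean (\<rho> S) excess)"
        using divide_right_mono[of "LINT s:{0..T}|lborel. ?r n s" "LINT s:{0..S}|lborel. ?r n s" "2 * c\<^sup>2"]
        by (simp add: right_diff_distrib distrib_left)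
      then show ?case using c(1) by (simp add: divide_le_eq mult.commute)
    qed
  qed simp
  have "AE s in lborel. 0 \<le> s \<and> s \<le> real N \<longrightarrow> defect f (\<rho> s) (u s) = 0" for N
  proof -
    let ?g = "\<lambda>n s. ennreal (indicator {0..real N} s *\<^sub>R ?r n s)"
    have gm: "?g n \<in> borel_measurable lborel" for n
      using int[of "real N" n] by (auto simp: set_integrable_def)
    have "(\<integral>\<^sup>+s. liminf (\<lambda>n. ?g n s) \<partial>lborel) \<le> liminf (\<lambda>n. \<integral>\<^sup>+s. ?g n s \<partial>lborel)"
      by (rule nn_integral_liminf[OF gm])
    also have "\<dots> \<le> liminf (\<lambda>n. ennreal (2 * c\<^sup>2 * (\<beta> * (mean \<rho>\<^sub>0 excess - mean \<rho>\<^sub>0 (trunc n)))))"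
    proof (intro Liminf_mono always_eventually allI)
      fix n
      have "(\<integral>\<^sup>+s. ?g n s \<partial>lborel) = ennreal (LINT s:{0..real N}|lborel. ?r n s)"
        unfolding set_lebesgue_integral_def using int[of "real N" n]
        by (intro nn_integral_eq_integral) (auto simp: set_integrable_def)
      also have "\<dots> \<le> ennreal (2 * c\<^sup>2 * (\<beta> * (mean \<rho>\<^sub>0 excess - mean \<rho>\<^sub>0 (trunc n))))"
        by (intro ennreal_leI small) simp
      finally show "(\<integral>\<^sup>+s. ?g n s \<partial>lborel) \<le> ennreal (2 * c\<^sup>2 * (\<beta> * (mean \<rho>\<^sub>0 excess - mean \<rho>\<^sub>0 (trunc n))))" .
    qed
    also have "\<dots> = ennreal (2 * c\<^sup>2 * (\<beta> * (mean \<rho>\<^sub>0 excess - mean \<rho>\<^sub>0 excess)))"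
      by (intro lim_imp_Liminf tendsto_ennrealI tendsto_mult tendsto_diff tendsto_const mean_trunc_tendsto p0) simp
    finally have "(\<integral>\<^sup>+s. liminf (\<lambda>n. ?g n s) \<partial>lborel) = 0" by simp
    then have "AE s in lborel. liminf (\<lambda>n. ?g n s) = 0"
      using gm by (subst (asm) nn_integral_0_iff_AE) (auto intro: borel_measurable_liminf)
    then show ?thesis
    proof eventually_elim
      case (elim s)
      show ?case
      proof
        assume s: "0 \<le> s \<and> s \<le> real N"
        have "(\<lambda>n. ?g n s) \<longlonglongrightarrow> ennreal ((defect f (\<rho> s) (u s))\<^sup>2)"
          using s by (auto intro!: tendsto_ennrealI tendsto_power residual_tendsto_defect flow_density[OF flow] f)
        then have "ennreal ((defect f (\<rho> s) (u s))\<^sup>2) = 0" using elim lim_imp_Liminf[of sequentially] by fastforce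
        then show "defect f (\<rho> s) (u s) = 0" by simp
      qed
    qed
  qed
  then have "AE s in lborel. \<forall>N. 0 \<le> s \<and> s \<le> real N \<longrightarrow> defect f (\<rho> s) (u s) = 0"
    unfolding AE_all_countable by blast
  then show ?thesis by eventually_elim (use real_arch_simple in blast)
qed

text \<open>The defect is continuous in the test function for uniform convergence of the function and its
  gradient, since both the flux and the source are integrable.\<close>

lemma solves_pde_if_defect_eq_0:
  assumes p: "\<rho> \<in> prob_densities" and um[measurable]: "u \<in> borel_measurable borel"
    and u2: "integrable lborel (\<lambda>x. (norm (u x))\<^sup>2 * \<rho> x)"
    and T: "\<And>g. g \<in> T \<Longrightarrow> test_fun g" "\<And>g. g \<in> T \<Longrightarrow> defect g \<rho> u = 0"
    and dense: "\<And>f e. test_fun f \<Longrightarrow> 0 < e \<Longrightarrow> \<exists>g\<in>T. \<forall>x. \<bar>f x - g x\<bar> \<le> e \<and> norm (gradient f x - gradient g x) \<le> e"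
  shows "solves_pde \<beta> h \<rho> u"
proof -
  note prob_densityD(1)[OF p, measurable]
  define F where "F x = \<rho> x *\<^sub>R u x" for x
  define s where "s x = \<rho> x * (\<beta> * (h x - mean \<rho> h))" for x
  have Fi: "integrable lborel F" unfolding F_def[abs_def] by (rule integrable_times_density_of_square[OF p um u2])
  have s_eq: "s x = \<beta> * (excess x * \<rho> x) - \<beta> * mean \<rho> excess * \<rho> x" for x
    by (simp add: s_def h_minus_mean[OF p] algebra_simps)
  have si: "integrable lborel s" unfolding s_eq[abs_def] using excess_integrable[OF p] prob_densityD(3)[OF p] by auto
  have [measurable]: "F \<in> borel_measurable borel" "s \<in> borel_measurable borel" using Fi si by auto
  have loc: "locally_integrable k" if "integrable lborel k" for k :: "'a \<Rightarrow> 'b::euclidean_space"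
  proof -
    have "set_integrable lborel UNIV k" using that by (simp add: set_integrable_def)
    then show ?thesis using that
      by (auto simp: locally_integrable_def compact_imp_closed intro: set_integrable_subset[of lborel UNIV])
  qed
  define \<Phi> where "\<Phi> f = (LINT x|lborel. gradient f x \<bullet> F x + f x * s x)" for f
  have fi: "integrable lborel (\<lambda>x. gradient f x \<bullet> F x)" "integrable lborel (\<lambda>x. f x * s x)" if f: "test_fun f" for f
  proof -
    note test_fun_measurable[OF f, measurable]
    obtain c where c: "\<And>x. \<bar>f x\<bar> \<le> c" "\<And>x. norm (gradient f x) \<le> c" using f by (elim test_funE) blast
    show "integrable lborel (\<lambda>x. gradient f x \<bullet> F x)"
    proof (rule Bochner_Integration.integrable_bound[OF integrable_mult_right[OF integrable_norm[OF Fi], of c]])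
      have "norm (gradient f x \<bullet> F x) \<le> c * norm (F x)" for x
        unfolding real_norm_def by (intro order_trans[OF Cauchy_Schwarz_ineq2] mult_right_mono c) simp
      then show "AE x in lborel. norm (gradient f x \<bullet> F x) \<le> norm (c * norm (F x))"
        by (intro AE_I2) (metis abs_ge_self order_trans real_norm_def)
    qed measurable
    show "integrable lborel (\<lambda>x. f x * s x)"
    proof (rule Bochner_Integration.integrable_bound[OF integrable_mult_right[OF integrable_norm[OF si], of c]])
      have "norm (f x * s x) \<le> c * norm (s x)" for x
        unfolding real_norm_def abs_mult by (intro mult_right_mono c) simp
      then show "AE x in lborel. norm (f x * s x) \<le> norm (c * norm (s x))"
        by (intro AE_I2) (metis abs_ge_self order_trans real_norm_def)
    qed measurable
  qed
  have \<Phi>: "\<Phi> f = (LINT x|lborel. gradient f x \<bullet> F x) + (LINT x|lborel. f x * s x)" if "test_fun f" for f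
    unfolding \<Phi>_def using fi[OF that] by simp
  have \<Phi>_defect: "\<Phi> f = defect f \<rho> u" if f: "test_fun f" for f
  proof -
    obtain c where c: "\<And>x. \<bar>f x\<bar> \<le> c" using f by (elim test_funE) blast
    have "(LINT x|lborel. f x * s x) = (LINT x|lborel. \<beta> * ((f x - 0) * (excess x - mean \<rho> excess) * \<rho> x))"
      by (simp add: s_def h_minus_mean[OF p] ac_simps)
    also have "\<dots> = \<beta> * cov f \<rho>"
      unfolding cov_bounds(2)[OF p test_fun_measurable(1)[OF f] c, of 0] by (rule integral_mult_right_zero)
    finally show ?thesis unfolding \<Phi>[OF f] by (simp add: defect_def flux_rate_def F_def)
  qed
  have zero: "\<Phi> f = 0" if f: "test_fun f" for f
  proof -
    define I where "I = (LINT x|lborel. norm (F x) + \<bar>s x\<bar>)"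
    have Ii: "integrable lborel (\<lambda>x. norm (F x) + \<bar>s x\<bar>)" using Fi si by auto
    have "\<bar>\<Phi> f\<bar> \<le> 0 + e" if e: "0 < e" for e
    proof -
      have I0: "0 \<le> I" unfolding I_def by (intro integral_nonneg_AE AE_I2) auto
      define d where "d = e / (I + 1)"
      have d: "0 < d" unfolding d_def using e I0 by simp
      obtain g where g: "g \<in> T" "\<And>x. \<bar>f x - g x\<bar> \<le> d" "\<And>x. norm (gradient f x - gradient g x) \<le> d"
        using dense[OF f d] by blast
      note g' = T(1)[OF g(1)]
      note test_fun_measurable[OF f, measurable] test_fun_measurable[OF g', measurable]
      have "\<Phi> f = \<Phi> f - \<Phi> g" using \<Phi>_defect[OF g'] T(2)[OF g(1)] by simp
      also have "\<dots> = (LINT x|lborel. (gradient f x - gradient g x) \<bullet> F x + (f x - g x) * s x)"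
        unfolding \<Phi>_def using fi[OF f] fi[OF g']
        by (subst Bochner_Integration.integral_diff[symmetric]) (auto simp: inner_diff_left algebra_simps)
      also have "norm \<dots> \<le> (LINT x|lborel. d * (norm (F x) + \<bar>s x\<bar>))"
      proof (rule norm_integral_le)
        show "integrable lborel (\<lambda>x. d * (norm (F x) + \<bar>s x\<bar>))" by (rule integrable_mult_right[OF Ii])
        fix x
        have "\<bar>(gradient f x - gradient g x) \<bullet> F x\<bar> \<le> d * norm (F x)"
          by (intro order_trans[OF Cauchy_Schwarz_ineq2] mult_right_mono g) simp
        moreover have "\<bar>(f x - g x) * s x\<bar> \<le> d * \<bar>s x\<bar>" unfolding abs_mult by (intro mult_right_mono g) simp
        ultimately show "norm ((gradient f x - gradient g x) \<bullet> F x + (f x - g x) * s x) \<le> d * (norm (F x) + \<bar>s x\<bar>)"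
          unfolding real_norm_def distrib_left by linarith
      qed measurable
      also have "\<dots> = d * I" unfolding I_def by (rule integral_mult_right_zero)
      also have "\<dots> \<le> e" using I0 e by (simp add: d_def divide_le_eq mult_left_mono)
      finally show ?thesis by simp
    qed
    then have "\<bar>\<Phi> f\<bar> \<le> 0" by (rule field_le_epsilon)
    then show ?thesis by simp
  qed
  show ?thesis
    unfolding solves_pde_def weighted_divergence_def has_weak_divergence_def F_def[symmetric] s_def[symmetric]
  proof (intro conjI allI impI loc Fi si)
    show "(\<lambda>x. \<beta> * (h x - mean \<rho> h)) \<in> borel_measurable borel" by measurable
    show "(LINT x|lborel. gradient f x \<bullet> F x) = - (LINT x|lborel. f x * s x)" if "test_fun f" for f
      using zero[OF that] \<Phi>[OF that] by simp
  qed
qed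

lemma optimal_imp_solution:
  assumes adm: "admissible h xbar \<rho>\<^sub>0 \<rho> u" and opt: "cost \<beta> h \<rho> u \<le> ennreal (\<beta> * mean \<rho>\<^sub>0 excess)"
  shows "AE t in lborel. 0 \<le> t \<longrightarrow> solves_pde \<beta> h (\<rho> t) (u t)"
proof -
  have flow: "controlled_flow \<rho>\<^sub>0 \<rho> u" using adm by (simp add: admissible_def)
  obtain T :: "('a \<Rightarrow> real) set" where T: "countable T" "\<And>g. g \<in> T \<Longrightarrow> test_fun g"
    "\<And>f e. test_fun f \<Longrightarrow> 0 < e \<Longrightarrow> \<exists>g\<in>T. \<forall>x. \<bar>f x - g x\<bar> \<le> e \<and> norm (gradient f x - gradient g x) \<le> e"
    using countable_dense_test_funs by blast
  have "AE t in lborel. \<forall>g\<in>T. 0 \<le> t \<longrightarrow> defect g (\<rho> t) (u t) = 0"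
    unfolding AE_ball_countable[OF T(1)] using optimal_defect_eq_0[OF adm opt T(2)] by blast
  then show ?thesis
  proof eventually_elim
    case (elim t)
    show ?case
    proof
      assume t: "0 \<le> t"
      show "solves_pde \<beta> h (\<rho> t) (u t)"
        by (rule solves_pde_if_defect_eq_0[OF flow_density[OF flow t] flow_control_measurable[OF flow t]
              flow_square_integrable[OF flow t] T(2) _ T(3)]) (use elim t in auto)
    qed
  qed
qed

end

section \<open>The value function and the optimal controls\<close>

theorem theorem3:
  fixes \<beta> :: real and h \<rho>\<^sub>0 :: "'a::euclidean_space \<Rightarrow> real" and xbar :: 'a
  assumes "\<beta> > 0" and "A1 \<rho>\<^sub>0" and "A2 \<rho>\<^sub>0 h" and "A3 h xbar"
  shows "enn2ereal (value_fun \<beta> h xbar \<rho>\<^sub>0) =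
           ereal (\<beta> * (LINT x|lborel. h x * \<rho>\<^sub>0 x) - \<beta> * h xbar) \<and>
         (\<exists>\<rho> u. optimal_control \<beta> h xbar \<rho>\<^sub>0 \<rho> u \<and>
           (\<forall>t\<ge>0. solves_pde \<beta> h (\<rho> t) (u t) \<and> solves_pde_classically \<beta> h (\<rho> t) (u t))) \<and>
         (\<forall>\<rho> u. controlled_flow \<rho>\<^sub>0 \<rho> u \<longrightarrow>
           (optimal_control \<beta> h xbar \<rho>\<^sub>0 \<rho> u \<longleftrightarrow>
             (AE t in lborel. 0 \<le> t \<longrightarrow> solves_pde \<beta> h (\<rho> t) (u t))))"
proof -
  obtain V where V: "\<rho>\<^sub>0 = (\<lambda>x. exp (- V x))" "Ck 2 V" "bounded_hessian V" "liminf_radial V = \<infinity>"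
    and p0: "\<rho>\<^sub>0 \<in> prob_densities"
    using assms(2) by (auto simp: A1_def)
  have h: "Ck 2 h" "bounded_hessian h" "- \<infinity> < liminf_radial h" using assms(3) by (auto simp: A2_def)
  have h1: "C1_grad h (gradient h)" by (rule Ck_2_imp_C1_grad(1)[OF h(1)])
  have growth: "\<exists>C. \<forall>x. h x - h xbar \<le> C * (1 + (norm x)\<^sup>2)"
  proof -
    obtain A where A: "0 \<le> A" "\<And>x. norm (gradient h x) \<le> A * (1 + norm x)" using gradient_linear_growth[OF h(1,2)] by blast
    have "h x - h xbar \<le> (2 * (\<bar>h 0\<bar> + A) + \<bar>h xbar\<bar>) * (1 + (norm x)\<^sup>2)" for x
    proof -
      have "(1 + norm x)\<^sup>2 \<le> 2 * (1 + (norm x)\<^sup>2)"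
        using zero_le_power2[of "norm x - 1"] by (simp add: power2_eq_square algebra_simps)
      then have "(\<bar>h 0\<bar> + A) * (1 + norm x)\<^sup>2 \<le> (\<bar>h 0\<bar> + A) * (2 * (1 + (norm x)\<^sup>2))"
        using A(1) by (intro mult_left_mono) auto
      moreover have "\<bar>h xbar\<bar> * 1 \<le> \<bar>h xbar\<bar> * (1 + (norm x)\<^sup>2)" by (intro mult_left_mono) auto
      moreover have "(2 * (\<bar>h 0\<bar> + A) + \<bar>h xbar\<bar>) * (1 + (norm x)\<^sup>2) =
          (\<bar>h 0\<bar> + A) * (2 * (1 + (norm x)\<^sup>2)) + \<bar>h xbar\<bar> * (1 + (norm x)\<^sup>2)"
        by (simp add: algebra_simps)
      ultimately show ?thesis
        using quadratic_growth[OF h1 A, of x] abs_ge_self[of "h x"] abs_ge_minus_self[of "h xbar"] by linarith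
    qed
    then show ?thesis by blast
  qed
  interpret filtering \<beta> h xbar V
    using assms(1,4) V p0 h h1 growth by unfold_locales (auto simp: A3_def)
  let ?m = "mean \<rho>\<^sub>0 excess"
  have m0: "0 \<le> ?m" by (rule mean_excess_nonneg[OF p0])
  have lower: "ennreal (\<beta> * ?m) \<le> value_fun \<beta> h xbar \<rho>\<^sub>0"
    unfolding value_fun_def by (rule Inf_greatest) (auto intro: cost_lower_bound)
  have pos: "0 < \<rho>\<^sub>0 x" for x by (simp add: V(1))
  have flow: "controlled_flow \<rho>\<^sub>0 tilted optimal_drift" using tilted_flow by (simp add: V(1))
  have pde: "AE t in lborel. 0 \<le> t \<longrightarrow> solves_pde \<beta> h (tilted t) (optimal_drift t)"
    by (intro AE_I2 impI drift_solves_pde)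
  have "value_fun \<beta> h xbar \<rho>\<^sub>0 \<le> cost \<beta> h tilted optimal_drift"
    unfolding value_fun_def using solution_admissible[OF flow pde pos] by (intro Inf_lower) blast
  also have "\<dots> \<le> ennreal (\<beta> * ?m)" by (rule solution_cost_le[OF flow pde pos])
  finally have val: "value_fun \<beta> h xbar \<rho>\<^sub>0 = ennreal (\<beta> * ?m)" using lower by simp
  have optimal: "optimal_control \<beta> h xbar \<rho>\<^sub>0 \<rho> u \<longleftrightarrow> (AE t in lborel. 0 \<le> t \<longrightarrow> solves_pde \<beta> h (\<rho> t) (u t))"
    if fl: "controlled_flow \<rho>\<^sub>0 \<rho> u" for \<rho> u
  proof
    assume "optimal_control \<beta> h xbar \<rho>\<^sub>0 \<rho> u"
    then show "AE t in lborel. 0 \<le> t \<longrightarrow> solves_pde \<beta> h (\<rho> t) (u t)"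
      by (intro optimal_imp_solution[of \<rho>\<^sub>0]) (auto simp: optimal_control_def val)
  next
    assume pd: "AE t in lborel. 0 \<le> t \<longrightarrow> solves_pde \<beta> h (\<rho> t) (u t)"
    note adm = solution_admissible[OF fl pd pos]
    have "cost \<beta> h \<rho> u = ennreal (\<beta> * ?m)"
      using solution_cost_le[OF fl pd pos] cost_lower_bound[OF adm] by (rule order.antisym)
    then show "optimal_control \<beta> h xbar \<rho>\<^sub>0 \<rho> u" using adm by (simp add: optimal_control_def val)
  qed
  have "enn2ereal (value_fun \<beta> h xbar \<rho>\<^sub>0) = ereal (\<beta> * (LINT x|lborel. h x * \<rho>\<^sub>0 x) - \<beta> * h xbar)"
  proof -
    have "\<beta> * ?m = \<beta> * (LINT x|lborel. h x * \<rho>\<^sub>0 x) - \<beta> * h xbar"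
      using mean_h[OF p0] by (simp add: mean_def[of \<rho>\<^sub>0 h] algebra_simps)
    moreover have "enn2ereal (ennreal (\<beta> * ?m)) = ereal (\<beta> * ?m)"
      using m0 \<beta>_pos by (intro enn2ereal_ennreal) simp
    ultimately show ?thesis by (simp only: val)
  qed
  then show ?thesis
    using optimal flow pde drift_solves_pde drift_solves_pde_classically by blast
qed

end
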